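(* Let $g\in\mathcal{D}$ and suppose that the Volterra operator $\mathbf{T}_g$ acts boundedly on $\mathcal{H}^1$. Then $g$ is in $(\mathcal{H}^1)^\ast$.
   Context: $\mathcal{D}$ is the class of functions expressible as a Dirichlet series in some half-plane $\{s:\mathrm{Re}\,s>\theta\}$. Let $(p_j)_{j\ge1}$ be the increasing sequence of primes; for $n=\prod_jp_j^{\kappa_j}$ put $\kappa(n)=(\kappa_1,\kappa_2,\dots)$. The Bohr lift of $f(s)=\sum_{n\ge1}a_nn^{-s}$ is $\mathcal{B}f(z)=\sum_{n\ge1}a_nz^{\kappa(n)}$. Let $m_\infty$ be the normalized Haar measure on $\mathbb{T}^\infty$. $\mathcal{H}^1$ is the space of Dirichlet series $f$ with $\mathcal{B}f\in H^1(\mathbb{D}^\infty)$ (the closure in $L^1(\mathbb{T}^\infty)$ of the analytic polynomials in finitely many variables), with $\|f\|_{\mathcal{H}^1}=\int_{\mathbb{T}^\infty}|\mathcal{B}f|\,dm_\infty$. $\mathbf{T}_gf(s)=-\int_s^{+\infty}f(w)g'(w)\,dw$ (integral along the horizontal half-line from $s$, for $\mathrm{Re}\,s$ large enough), which is again a Dirichlet series; it acts boundedly on $\mathcal{H}^1$ if it maps $\mathcal{H}^1$ into itself with finite operator norm. For $g(s)=\sum b_nn^{-s}$, "$g$ is in $(\mathcal{H}^1)^\ast$" means that the functional $f\mapsto\langle f,g\rangle_{\mathcal{H}^2}=\sum_na_n\overline{b_n}$, defined on Dirichlet polynomials $f(s)=\sum a_nn^{-s}$, extends to a bounded linear functional on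 $\mathcal{H}^1$. *)

theory Defs
  imports "HOL-Probability.Probability" "HOL-Computational_Algebra.Primes"
begin

text \<open>Dirichlet series start at \<open>n = 1\<close>; the value \<open>a 0\<close> of a coefficient sequence is never used.
  Functions are total, but all that matters is their restriction to some half-plane
  \<open>Re s > \<theta>\<close>.\<close>

definition has_dirichlet_series :: "(complex \<Rightarrow> complex) \<Rightarrow> (nat \<Rightarrow> complex) \<Rightarrow> bool" where
  "has_dirichlet_series f a \<longleftrightarrow>
     (\<exists>\<theta>::real. \<forall>s. Re s > \<theta> \<longrightarrow> (\<lambda>n. a (Suc n) * of_nat (Suc n) powr (- s)) sums f s)"

definition class_D :: "(complex \<Rightarrow> complex) set" where
  "class_D = {f. \<exists>a. has_dirichlet_series f a}"

text \<open>The increasing sequence of primes, indexed from 0.\<close>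

definition nth_prime :: "nat \<Rightarrow> nat" where
  "nth_prime j = enumerate {p::nat. prime p} j"

definition kappa :: "nat \<Rightarrow> nat \<Rightarrow> nat" where
  "kappa n j = multiplicity (nth_prime j) n"

text \<open>The monomial of a finitely supported multi-index.\<close>

definition monomial :: "(nat \<Rightarrow> nat) \<Rightarrow> (nat \<Rightarrow> complex) \<Rightarrow> complex" where
  "monomial \<kappa> z = (\<Prod>j\<in>{j. \<kappa> j \<noteq> 0}. z j ^ \<kappa> j)"

text \<open>The normalized Haar measure of the infinite torus is the countable product of normalized
  arc length on the unit circle.\<close>

definition circle_measure :: "complex measure" where
  "circle_measure =
     distr (uniform_measure lborel {0..1::real}) (restrict_space borel (sphere 0 1))
       (\<lambda>t. cis (2 * pi * t))"

definition torus_measure :: "(nat \<Rightarrow> complex) measure" where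
  "torus_measure = Pi\<^sub>M UNIV (\<lambda>_. circle_measure)"

definition analytic_polynomials :: "((nat \<Rightarrow> complex) \<Rightarrow> complex) set" where
  "analytic_polynomials =
     {(\<lambda>z. \<Sum>\<kappa>\<in>K. c \<kappa> * monomial \<kappa> z) | K c. finite K \<and> (\<forall>\<kappa>\<in>K. finite {j. \<kappa> j \<noteq> 0})}"

text \<open>The closure of the analytic polynomials in \<open>L\<^sup>1\<close> of the torus. The elements are functions
  rather than classes of functions modulo equality almost everywhere.\<close>

definition H1_torus :: "((nat \<Rightarrow> complex) \<Rightarrow> complex) set" where
  "H1_torus =
     {F. integrable torus_measure F \<and>
         (\<forall>\<epsilon>>0. \<exists>P\<in>analytic_polynomials. (\<integral>z. norm (F z - P z) \<partial>torus_measure) < \<epsilon>)}"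

definition fourier_coeff :: "((nat \<Rightarrow> complex) \<Rightarrow> complex) \<Rightarrow> (nat \<Rightarrow> nat) \<Rightarrow> complex" where
  "fourier_coeff F \<kappa> = (\<integral>z. F z * cnj (monomial \<kappa> z) \<partial>torus_measure)"

text \<open>The power series \<open>\<Sum>n. a n * monomial (kappa n) z\<close> need not converge on the torus; its being
  a function \<open>F\<close> in the Hardy space means that it is the Fourier series of \<open>F\<close>. The map \<open>kappa\<close>
  is a bijection from the positive integers to the finitely supported multi-indices, and all other
  Fourier coefficients of \<open>F\<close> vanish because \<open>F\<close> is in the Hardy space.\<close>

definition is_bohr_lift :: "(complex \<Rightarrow> complex) \<Rightarrow> ((nat \<Rightarrow> complex) \<Rightarrow> complex) \<Rightarrow> bool" where
  "is_bohr_lift f F \<longleftrightarrow>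
     F \<in> H1_torus \<and>
     (\<exists>a. has_dirichlet_series f a \<and> (\<forall>n\<ge>1. fourier_coeff F (kappa n) = a n))"

definition H1 :: "(complex \<Rightarrow> complex) set" where
  "H1 = {f. \<exists>F. is_bohr_lift f F}"

text \<open>The choice is immaterial: Dirichlet coefficients are unique, and a function on the torus is
  determined almost everywhere by its Fourier coefficients.\<close>

definition bohr_lift :: "(complex \<Rightarrow> complex) \<Rightarrow> (nat \<Rightarrow> complex) \<Rightarrow> complex" where
  "bohr_lift f = (SOME F. is_bohr_lift f F)"

definition H1_norm :: "(complex \<Rightarrow> complex) \<Rightarrow> real" where
  "H1_norm f = (\<integral>z. norm (bohr_lift f z) \<partial>torus_measure)"

text \<open>The half-line from \<open>s\<close> is parametrized by \<open>w = s + t\<close>. For \<open>f\<close> and \<open>g\<close> given by Dirichlet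
  series the integral converges absolutely when \<open>Re s\<close> is large; the value for other \<open>s\<close> is
  irrelevant.\<close>

definition volterra :: "(complex \<Rightarrow> complex) \<Rightarrow> (complex \<Rightarrow> complex) \<Rightarrow> complex \<Rightarrow> complex" where
  "volterra g f s = - (LBINT t:{0..}. f (s + complex_of_real t) * deriv g (s + complex_of_real t))"

definition acts_boundedly_on_H1 :: "((complex \<Rightarrow> complex) \<Rightarrow> complex \<Rightarrow> complex) \<Rightarrow> bool" where
  "acts_boundedly_on_H1 T \<longleftrightarrow>
     (\<forall>f\<in>H1. T f \<in> H1) \<and> (\<exists>C. \<forall>f\<in>H1. H1_norm (T f) \<le> C * H1_norm f)"

definition bounded_functional_on_H1 :: "((complex \<Rightarrow> complex) \<Rightarrow> complex) \<Rightarrow> bool" where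
  "bounded_functional_on_H1 \<Lambda> \<longleftrightarrow>
     (\<forall>f\<in>H1. \<forall>h\<in>H1. \<Lambda> (\<lambda>s. f s + h s) = \<Lambda> f + \<Lambda> h) \<and>
     (\<forall>c. \<forall>f\<in>H1. \<Lambda> (\<lambda>s. c * f s) = c * \<Lambda> f) \<and>
     (\<exists>C. \<forall>f\<in>H1. norm (\<Lambda> f) \<le> C * H1_norm f)"

definition in_H1_dual :: "(complex \<Rightarrow> complex) \<Rightarrow> bool" where
  "in_H1_dual g \<longleftrightarrow>
     (\<exists>b \<Lambda>. has_dirichlet_series g b \<and> bounded_functional_on_H1 \<Lambda> \<and>
        (\<forall>a N. \<Lambda> (\<lambda>s. \<Sum>n=1..N. a n * of_nat n powr (- s)) = (\<Sum>n=1..N. a n * cnj (b n))))"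

end

(*
  Let M bound the norm of T_g on H^1 and write f, h for Dirichlet polynomials, |.|_1 for the norm of
  H^1, and mu for the measure s ds dm(z) on the product of a half-line and the torus.

  Averaging the twists g(s) -> sum b_n chi(n) n^(-s) against a positive trigonometric kernel replaces g
  by a Dirichlet polynomial without increasing the norm of T_g, so g may be taken to be one.
  Since the torus measure is invariant under the vertical flow, integrating the Laplacian of (a
  smoothing of) |f| gives the Hardy-Stein inequality  int |f'|^2 / |f| dmu <= |f|_1.
  For h = T_g f, so that h' = f g', the Cauchy-Schwarz inequality yields
    (int |f| |g'|^2 dmu)^2 <= (int |h'|^2 / |h| dmu) (int |h| |g'|^2 dmu) <= M |f|_1 (int |h| |g'|^2 dmu),
  and the best constant K in  int |f| |g'|^2 dmu <= K |f|_1,  being finite for polynomial g, satisfies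
  K^2 <= M^2 K, hence K <= M^2. A second use of Cauchy-Schwarz in the Littlewood-Paley identity
    <f, g> = a_1 conj(b_1) + 4 int f' conj(g') dmu
  bounds |<f, g>| by (|b_1| + 4 M) |f|_1. No factorization of H^1 is needed.
*)

theory Submission
  imports Defs "HOL-Real_Asymp.Real_Asymp"
begin

section \<open>Monomials on the torus\<close>

text \<open>Two obstacles shape the argument. A priori \<open>g\<close> has no boundary values: its
  series is known to converge only for large real part. So everything is done with coefficients, and
  the self-improving inequality, which needs a finite constant to start from, is reached by damping
  the coefficients of \<open>g\<close> by \<open>folner K\<close>. The kernel behind this is a Fejer
  kernel for infinitely many variables: boxes of multi-indices become the sets of divisors of
  \<open>K\<close>. Second, the image of a polynomial under \<open>volterra g\<close> is only some
  element of the Hardy space. An independent damping \<open>folner N\<close> makes it a polynomial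
  as well; \<open>N\<close> is sent to infinity first, with \<open>K\<close> fixed, and
  \<open>K\<close> only after the duality bound, whose constant does not depend on \<open>K\<close>.
  The weight \<open>t\<close> arises because \<open>t * Q' - Q\<close> is a primitive of
  \<open>t * Q''\<close>. The factor 4 is the reciprocal of the integral of
  \<open>t * L\<^sup>2 * exp (- 2 * t * L)\<close> over the half-line, which is 1/4 for every
  \<open>L > 0\<close>.\<close>

lemma prime_nth_prime [simp]: "prime (nth_prime j)"
  using enumerate_in_set[OF primes_infinite, of j] by (simp add: nth_prime_def)

lemma inj_nth_prime: "inj nth_prime"
  unfolding nth_prime_def using strict_mono_enumerate[OF primes_infinite] strict_mono_imp_inj_on by blast

lemma ex_nth_prime: "prime p \<Longrightarrow> \<exists>j. nth_prime j = p"
  using range_enumerate[OF primes_infinite] unfolding nth_prime_def by (metis imageE mem_Collect_eq)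

lemma finite_kappa_support:
  assumes "n > 0"
  shows "finite {j. kappa n j \<noteq> 0}"
proof (rule finite_subset)
  show "{j. kappa n j \<noteq> 0} \<subseteq> nth_prime -` prime_factors n"
    using assms by (auto simp: kappa_def prime_factors_multiplicity)
  show "finite (nth_prime -` prime_factors n)"
    by (rule finite_vimageI[OF _ inj_nth_prime]) simp
qed

lemma kappa_mult: "m > 0 \<Longrightarrow> n > 0 \<Longrightarrow> kappa (m * n) j = kappa m j + kappa n j"
  by (simp add: kappa_def prime_elem_multiplicity_mult_distrib)

text \<open>Half of the bijection between positive integers and finitely supported multi-indices;
  the other half, \<open>inj_on_kappa\<close>, comes later out of orthogonality.\<close>

lemma ex_kappa_eq:
  assumes "finite {j. \<kappa> j \<noteq> 0}"
  shows "\<exists>n>0. kappa n = \<kappa>"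
proof -
  let ?S = "{j. \<kappa> j \<noteq> 0}"
  let ?n = "\<Prod>p\<in>nth_prime ` ?S. p ^ \<kappa> (inv nth_prime p)"
  have "kappa ?n j = \<kappa> j" for j
    unfolding kappa_def using assms inj_nth_prime
    by (subst multiplicity_prod_prime_powers) (auto simp: inj_image_mem_iff)
  moreover have "?n > 0"
    by (intro prod_pos) (auto simp: prime_gt_0_nat)
  ultimately show ?thesis by blast
qed

lemma monomial_superset:
  "finite A \<Longrightarrow> {j. \<kappa> j \<noteq> 0} \<subseteq> A \<Longrightarrow> monomial \<kappa> z = (\<Prod>j\<in>A. z j ^ \<kappa> j)"
  unfolding monomial_def by (rule prod.mono_neutral_left) auto

text \<open>Indexing monomials by integers turns products of polynomials into Dirichlet
  convolutions. As \<open>kappa 0\<close> vanishes, \<open>mon 0\<close> coincides with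
  \<open>mon 1\<close>; hence the recurring condition \<open>0 \<notin> S\<close>.\<close>

definition mon :: "nat \<Rightarrow> (nat \<Rightarrow> complex) \<Rightarrow> complex" where
  "mon n = monomial (kappa n)"

lemma mon_1 [simp]: "mon (Suc 0) z = 1"
  by (simp add: mon_def monomial_def kappa_def)

lemma mon_mult:
  assumes "m > 0" "n > 0"
  shows "mon (m * n) z = mon m z * mon n z"
proof -
  let ?A = "{j. kappa m j \<noteq> 0} \<union> {j. kappa n j \<noteq> 0}"
  have A: "finite ?A" using assms by (simp add: finite_kappa_support del: neq0_conv)
  show ?thesis
    unfolding mon_def
    by (subst (1 2 3) monomial_superset[OF A]) (use assms in \<open>auto simp: kappa_mult power_add prod.distrib\<close>)
qed

lemma mon_nth_prime [simp]: "mon (nth_prime j) z = z j"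
proof -
  have "kappa (nth_prime j) i = (if i = j then 1 else 0)" for i
    using inj_nth_prime by (auto simp: kappa_def prime_multiplicity_other inj_eq)
  then show ?thesis
    unfolding mon_def by (subst monomial_superset[of "{j}"]) auto
qed

lemma mon_times: "mon n (\<lambda>j. z j * w j) = mon n z * mon n w"
  unfolding mon_def monomial_def by (simp add: power_mult_distrib prod.distrib)

lemma mon_cnj: "mon n (\<lambda>j. cnj (z j)) = cnj (mon n z)"
  unfolding mon_def monomial_def by simp

lemma norm_mon: "(\<And>j. norm (z j) = 1) \<Longrightarrow> norm (mon n z) = 1"
  unfolding mon_def monomial_def by (simp add: prod_norm[symmetric] norm_power)

lemma of_nat_powr_mult:
  "of_nat (m * n) powr s = (of_nat m powr s * of_nat n powr s :: complex)"
  by (simp add: powr_times_real)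

text \<open>Bohr's correspondence: both sides are multiplicative in \<open>n\<close> and agree at
  primes. It supplies the rotations used for orthogonality and for the vertical flow.\<close>

lemma mon_powr:
  assumes "n > 0"
  shows "mon n (\<lambda>j. of_nat (nth_prime j) powr s) = of_nat n powr s"
  using assms
proof (induction n rule: prime_divisors_induct)
  case (factor p n)
  then have pos: "p > 0" "n > 0" by (auto simp: prime_gt_0_nat)
  obtain j where "p = nth_prime j" using ex_nth_prime factor by blast
  then show ?case
    using factor pos by (simp add: mon_mult of_nat_powr_mult flip: of_nat_mult)
qed auto

section \<open>Rotation invariance of the torus measure\<close>

lemma space_circle: "space circle_measure = sphere 0 1"
  by (simp add: circle_measure_def)

lemma sets_circle: "sets circle_measure = sets (restrict_space borel (sphere 0 1))"
  by (simp add: circle_measure_def)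

lemma prob_space_unit_interval: "prob_space (uniform_measure lborel {0..1::real})"
  by (rule prob_space_uniform_measure) auto

lemma cis_measurable: "(\<lambda>t. cis (2 * pi * (t + \<theta>))) \<in> uniform_measure lborel {0..1::real} \<rightarrow>\<^sub>M restrict_space borel (sphere 0 1)"
  by (rule measurable_restrict_space2)
    (auto simp: measurable_cong_sets[OF sets_uniform_measure refl] intro!: borel_measurable_continuous_onI continuous_intros)

lemma prob_space_circle: "prob_space circle_measure"
  unfolding circle_measure_def
  using prob_space.prob_space_distr[OF prob_space_unit_interval cis_measurable[of 0]] by simp

text \<open>The window shifted by \<open>\<theta>\<close> is cut at 1, and periodicity moves the
  part beyond 1 back to the start of the unit interval.\<close>

lemma emeasure_periodic_shift:
  fixes B :: "real set"
  assumes [measurable]: "B \<in> sets borel" and per: "\<And>t. t + 1 \<in> B \<longleftrightarrow> t \<in> B" and \<theta>: "0 \<le> \<theta>" "\<theta> < 1"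
  shows "emeasure lborel ({0..1} \<inter> {t. t + \<theta> \<in> B}) = emeasure lborel ({0..1} \<inter> B)"
proof -
  have shift: "emeasure lborel {t. t + c \<in> A} = emeasure lborel A" if [measurable]: "A \<in> sets borel" for c and A :: "real set"
  proof -
    have "emeasure lborel A = emeasure (distr lborel borel ((+) c)) A"
      by (simp add: lborel_distr_plus)
    also have "\<dots> = emeasure lborel {t. t + c \<in> A}"
      by (subst emeasure_distr) (auto simp: vimage_def add.commute)
    finally show ?thesis by simp
  qed
  have "emeasure lborel ({0..1} \<inter> {t. t + \<theta> \<in> B}) = emeasure lborel {t. t + \<theta> \<in> {\<theta>..1+\<theta>} \<inter> B}"
    by (rule arg_cong[where f = "emeasure lborel"]) auto
  also have "\<dots> = emeasure lborel ({\<theta>..1+\<theta>} \<inter> B)"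
    by (rule shift) measurable
  also have "\<dots> = emeasure lborel ({\<theta>..1} \<inter> B \<union> {1<..1+\<theta>} \<inter> B)"
    using \<theta> by (intro arg_cong[where f = "emeasure lborel"]) auto
  also have "\<dots> = emeasure lborel ({\<theta>..1} \<inter> B) + emeasure lborel ({1<..1+\<theta>} \<inter> B)"
    by (rule plus_emeasure[symmetric]) auto
  also have "emeasure lborel ({1<..1+\<theta>} \<inter> B) = emeasure lborel {t. t + 1 \<in> {1<..1+\<theta>} \<inter> B}"
    by (rule shift[symmetric]) measurable
  also have "{t. t + 1 \<in> {1<..1+\<theta>} \<inter> B} = {0<..\<theta>} \<inter> B"
    using per by auto
  \<comment> \<open>Translation by 1 leaves this piece closed at the wrong end; the two endpoints
    form a null set.\<close>
  also have "emeasure lborel ({0<..\<theta>} \<inter> B) = emeasure lborel ({0..<\<theta>} \<inter> B)"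
  proof (rule emeasure_eq_AE)
    show "AE x in lborel. (x \<in> {0<..\<theta>} \<inter> B) = (x \<in> {0..<\<theta>} \<inter> B)"
      using AE_lborel_singleton[of 0] AE_lborel_singleton[of \<theta>] by eventually_elim auto
  qed auto
  also have "emeasure lborel ({\<theta>..1} \<inter> B) + emeasure lborel ({0..<\<theta>} \<inter> B) = emeasure lborel ({\<theta>..1} \<inter> B \<union> {0..<\<theta>} \<inter> B)"
    by (rule plus_emeasure) auto
  also have "{\<theta>..1} \<inter> B \<union> {0..<\<theta>} \<inter> B = {0..1} \<inter> B"
    using \<theta> by auto
  finally show ?thesis .
qed

lemma ex_cis_fraction:
  assumes "norm (c::complex) = 1"
  shows "\<exists>\<theta>\<ge>0. \<theta> < 1 \<and> c = cis (2 * pi * \<theta>)"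
proof -
  have "c = cis (Arg2pi c)"
    using Arg2pi[of c] assms by (simp add: cis_conv_exp is_Arg_def)
  moreover have "2 * pi * (Arg2pi c / (2 * pi)) = Arg2pi c" by simp
  moreover have "0 \<le> Arg2pi c / (2 * pi)" "Arg2pi c / (2 * pi) < 1"
    using Arg2pi[of c] by (auto simp: field_simps)
  ultimately show ?thesis by metis
qed

lemma mult_measurable_circle:
  "norm (c::complex) = 1 \<Longrightarrow> (\<lambda>z. z * c) \<in> circle_measure \<rightarrow>\<^sub>M circle_measure"
  unfolding measurable_cong_sets[OF sets_circle sets_circle]
  by (rule measurable_restrict_space3) (auto simp: norm_mult)

lemma distr_circle_rotate:
  assumes c: "norm (c::complex) = 1"
  shows "distr circle_measure circle_measure (\<lambda>z. z * c) = circle_measure"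
proof (rule measure_eqI)
  show "sets (distr circle_measure circle_measure (\<lambda>z. z * c)) = sets circle_measure" by simp
next
  fix A assume "A \<in> sets (distr circle_measure circle_measure (\<lambda>z. z * c))"
  then have A: "A \<in> sets circle_measure" by simp
  obtain \<theta> where \<theta>: "0 \<le> \<theta>" "\<theta> < 1" "c = cis (2 * pi * \<theta>)"
    using ex_cis_fraction[OF c] by blast
  let ?U = "uniform_measure lborel {0..1::real}" and ?R = "restrict_space borel (sphere 0 1) :: complex measure"
  \<comment> \<open>In the angle parameter a rotation is a translation, and the preimage of
    \<open>A\<close> is 1-periodic.\<close>
  define B where "B = {t::real. cis (2 * pi * t) \<in> A}"
  have AR: "A \<in> sets ?R" using A by (simp add: sets_circle)
  have AB: "A \<in> sets borel"
    using AR by (auto simp: sets_restrict_space)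
  have [measurable]: "(\<lambda>t. cis (2 * pi * t)) \<in> borel_measurable borel"
    by (intro borel_measurable_continuous_onI continuous_intros)
  have B: "B \<in> sets borel"
    using measurable_sets_borel[OF \<open>(\<lambda>t. cis (2 * pi * t)) \<in> borel_measurable borel\<close> AB]
    by (simp add: B_def vimage_def)
  have per: "t + 1 \<in> B \<longleftrightarrow> t \<in> B" for t
  proof -
    have "cis (2 * pi * (t + 1)) = cis (2 * pi * t)"
      by (simp add: distrib_left flip: cis_mult)
    then show ?thesis by (simp add: B_def)
  qed
  have gen: "emeasure (distr ?U ?R (\<lambda>t. cis (2 * pi * (t + \<eta>)))) A = emeasure lborel ({0..1} \<inter> {t. t + \<eta> \<in> B})" for \<eta>
  proof -
    have "{t. t + \<eta> \<in> B} \<in> sets borel"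
      using B by measurable
    then show ?thesis
      using AR by (subst emeasure_distr[OF cis_measurable]) (auto simp: B_def vimage_def emeasure_uniform_measure divide_ennreal_def)
  qed
  have *: "distr circle_measure circle_measure (\<lambda>z. z * c) = distr ?U ?R (\<lambda>t. cis (2 * pi * (t + \<theta>)))"
  proof -
    have "distr circle_measure circle_measure (\<lambda>z. z * c) = distr circle_measure ?R (\<lambda>z. z * c)"
      by (rule distr_cong) (simp_all add: sets_circle)
    also have "\<dots> = distr ?U ?R ((\<lambda>z. z * c) \<circ> (\<lambda>t. cis (2 * pi * t)))"
      unfolding circle_measure_def
    proof (rule distr_distr)
      show "(\<lambda>z. z * c) \<in> ?R \<rightarrow>\<^sub>M ?R"
        by (rule measurable_restrict_space3) (auto simp: norm_mult c)
      show "(\<lambda>t. cis (2 * pi * t)) \<in> ?U \<rightarrow>\<^sub>M ?R"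
        using cis_measurable[of 0] by simp
    qed
    also have "(\<lambda>z. z * c) \<circ> (\<lambda>t. cis (2 * pi * t)) = (\<lambda>t. cis (2 * pi * (t + \<theta>)))"
      by (auto simp: \<theta> cis_mult distrib_left)
    finally show ?thesis .
  qed
  have "emeasure (distr circle_measure circle_measure (\<lambda>z. z * c)) A = emeasure lborel ({0..1} \<inter> B)"
    unfolding * gen by (rule emeasure_periodic_shift[OF B per \<theta>(1,2)])
  also have "\<dots> = emeasure circle_measure A"
    using gen[of 0] by (simp add: circle_measure_def)
  finally show "emeasure (distr circle_measure circle_measure (\<lambda>z. z * c)) A = emeasure circle_measure A" .
qed

interpretation torus_prod: product_prob_space "\<lambda>_::nat. circle_measure" UNIV
  by (rule product_prob_spaceI) (rule prob_space_circle)

interpretation torus: prob_space torus_measure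
  unfolding torus_measure_def by (rule prob_space_PiM) (rule prob_space_circle)

lemma space_torus: "space torus_measure = {z. \<forall>j. norm (z j) = 1}"
  by (auto simp: torus_measure_def space_PiM space_circle PiE_iff)

lemma measurable_coordinate: "(\<lambda>z. z j) \<in> borel_measurable torus_measure"
proof -
  have "(\<lambda>z. z j) \<in> torus_measure \<rightarrow>\<^sub>M circle_measure"
    unfolding torus_measure_def by (rule measurable_component_singleton) simp
  moreover have "(\<lambda>x. x) \<in> circle_measure \<rightarrow>\<^sub>M borel"
    unfolding measurable_cong_sets[OF sets_circle refl] by (rule measurable_restrict_space1) simp
  ultimately show ?thesis
    using measurable_compose by fast
qed

lemma measurable_mon [measurable]: "mon n \<in> borel_measurable torus_measure"
  unfolding mon_def monomial_def[abs_def]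
  by (intro borel_measurable_prod borel_measurable_power measurable_coordinate)

lemma borel_measurable_cnj [measurable (raw)]:
  "f \<in> borel_measurable M \<Longrightarrow> (\<lambda>x. cnj (f x)) \<in> borel_measurable M"
  by (erule measurable_compose) (intro borel_measurable_continuous_onI continuous_intros)

lemma measurable_torus_rotate:
  assumes "\<And>j. norm (\<omega> j) = 1"
  shows "(\<lambda>z j. z j * \<omega> j) \<in> torus_measure \<rightarrow>\<^sub>M torus_measure"
proof -
  have "(\<lambda>z. z j * \<omega> j) \<in> Pi\<^sub>M UNIV (\<lambda>_. circle_measure) \<rightarrow>\<^sub>M circle_measure" for j
    using measurable_compose[where f = "\<lambda>z. z j" and g = "\<lambda>z. z * \<omega> j",
        OF measurable_component_singleton mult_measurable_circle[OF assms]] by simp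
  then show ?thesis
    unfolding torus_measure_def
    by (intro measurable_PiM_single') (auto simp: space_PiM space_circle PiE_iff norm_mult assms)
qed

text \<open>A product measure is determined by its finite-dimensional cylinders, and the preimage of
  a cylinder under a rotation is a cylinder whose factors are rotated separately.\<close>

lemma distr_torus_rotate:
  assumes \<omega>: "\<And>j. norm (\<omega> j) = 1"
  shows "distr torus_measure torus_measure (\<lambda>z j. z j * \<omega> j) = torus_measure"
proof -
  let ?P = "Pi\<^sub>M UNIV (\<lambda>_::nat. circle_measure)" and ?rot = "\<lambda>z j. z j * \<omega> j"
  have rot: "?rot \<in> ?P \<rightarrow>\<^sub>M ?P"
    using measurable_torus_rotate[OF \<omega>] by (simp add: torus_measure_def)
  have "distr ?P ?P ?rot = ?P"
  proof (rule torus_prod.PiM_eq)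
    fix J :: "nat set" and F
    assume J: "finite J" "J \<subseteq> UNIV" and F: "\<And>j. j \<in> J \<Longrightarrow> F j \<in> sets circle_measure"
    let ?G = "\<lambda>j. (\<lambda>z. z * \<omega> j) -` F j \<inter> space circle_measure"
    have G: "?G j \<in> sets circle_measure" if "j \<in> J" for j
      using measurable_sets[OF mult_measurable_circle[OF \<omega>] F[OF that]] .
    have eq: "?rot -` prod_emb UNIV (\<lambda>_. circle_measure) J (Pi\<^sub>E J F) \<inter> space ?P
        = prod_emb UNIV (\<lambda>_. circle_measure) J (Pi\<^sub>E J ?G)"
      using \<omega> by (auto simp: prod_emb_def space_PiM space_circle PiE_iff norm_mult)
    have "emeasure (distr ?P ?P ?rot) (prod_emb UNIV (\<lambda>_. circle_measure) J (Pi\<^sub>E J F))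
        = emeasure ?P (prod_emb UNIV (\<lambda>_. circle_measure) J (Pi\<^sub>E J ?G))"
      by (subst emeasure_distr[OF rot]) (use J F in \<open>auto simp: eq intro!: sets_PiM_I\<close>)
    also have "\<dots> = (\<Prod>j\<in>J. emeasure circle_measure (?G j))"
      using J G by (intro torus_prod.emeasure_PiM_emb) auto
    also have "\<dots> = (\<Prod>j\<in>J. emeasure circle_measure (F j))"
    proof (rule prod.cong)
      fix j assume "j \<in> J"
      show "emeasure circle_measure (?G j) = emeasure circle_measure (F j)"
        using emeasure_distr[OF mult_measurable_circle[OF \<omega>] F[OF \<open>j \<in> J\<close>]]
        by (simp add: distr_circle_rotate[OF \<omega>])
    qed simp
    finally show "emeasure (distr ?P ?P ?rot) (prod_emb UNIV (\<lambda>_. circle_measure) J (Pi\<^sub>E J F))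
        = (\<Prod>j\<in>J. emeasure circle_measure (F j))" .
  qed simp
  then show ?thesis by (simp add: torus_measure_def)
qed

lemma integral_torus_rotate:
  fixes F :: "(nat \<Rightarrow> complex) \<Rightarrow> 'a::{banach, second_countable_topology}"
  assumes "\<And>j. norm (\<omega> j) = 1" "F \<in> borel_measurable torus_measure"
  shows "(\<integral>z. F (\<lambda>j. z j * \<omega> j) \<partial>torus_measure) = (\<integral>z. F z \<partial>torus_measure)"
  using integral_distr[OF measurable_torus_rotate[OF assms(1)] assms(2)]
  by (simp add: distr_torus_rotate[OF assms(1)])

text \<open>For distinct indices a suitable rotation changes the sign of the integrand while the
  integral is invariant, so it vanishes. No integration over single coordinates is involved.\<close>

lemma integral_mon_cnj_mon:
  assumes "m > 0" "n > 0"
  shows "(\<integral>z. mon m z * cnj (mon n z) \<partial>torus_measure) = (if m = n then 1 else 0)"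
proof (cases "m = n")
  case True
  have "(\<integral>z. mon m z * cnj (mon n z) \<partial>torus_measure) = (\<integral>z. 1 \<partial>torus_measure)"
    using True by (intro Bochner_Integration.integral_cong)
      (auto simp: space_torus norm_mon complex_norm_square[symmetric])
  then show ?thesis using True by (simp add: torus.prob_space)
next
  case False
  \<comment> \<open>Chosen so that the rotation multiplies the integrand by \<open>cis pi\<close>,
    that is by -1; distinct positive integers have distinct logarithms.\<close>
  define t where "t = pi / (ln m - ln n)"
  define \<omega> where "\<omega> = (\<lambda>j. of_nat (nth_prime j) powr (\<i> * t) :: complex)"
  have d: "ln (real m) - ln (real n) \<noteq> 0"
    using assms False by simp
  have \<omega>: "norm (\<omega> j) = 1" for j
    unfolding \<omega>_def by (subst norm_powr_real_powr) (auto simp: prime_gt_0_nat)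
  have "mon m \<omega> * cnj (mon n \<omega>) = cis (t * (ln m - ln n))"
    using assms unfolding \<omega>_def mon_powr[OF assms(1)] mon_powr[OF assms(2)]
    by (simp add: powr_def cis_conv_exp exp_cnj algebra_simps Ln_of_nat flip: exp_add)
  also have "t * (ln m - ln n) = pi"
    using d by (simp add: t_def)
  finally have *: "mon m \<omega> * cnj (mon n \<omega>) = -1"
    by simp
  have "(\<integral>z. mon m z * cnj (mon n z) \<partial>torus_measure)
      = (\<integral>z. mon m (\<lambda>j. z j * \<omega> j) * cnj (mon n (\<lambda>j. z j * \<omega> j)) \<partial>torus_measure)"
    by (rule integral_torus_rotate[OF \<omega>, symmetric]) measurable
  also have "\<dots> = (\<integral>z. - (mon m z * cnj (mon n z)) \<partial>torus_measure)"
  proof (rule Bochner_Integration.integral_cong)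
    fix z
    have "mon m (\<lambda>j. z j * \<omega> j) * cnj (mon n (\<lambda>j. z j * \<omega> j))
        = mon m z * cnj (mon n z) * (mon m \<omega> * cnj (mon n \<omega>))"
      using assms by (simp add: mon_times)
    then show "mon m (\<lambda>j. z j * \<omega> j) * cnj (mon n (\<lambda>j. z j * \<omega> j)) = - (mon m z * cnj (mon n z))"
      by (simp add: *)
  qed simp
  finally show ?thesis using False by simp
qed

section \<open>Polynomials on the torus\<close>

definition l1 :: "((nat \<Rightarrow> complex) \<Rightarrow> complex) \<Rightarrow> real" where
  "l1 F = (\<integral>z. norm (F z) \<partial>torus_measure)"

definition tpoly :: "nat set \<Rightarrow> (nat \<Rightarrow> complex) \<Rightarrow> (nat \<Rightarrow> complex) \<Rightarrow> complex" where
  "tpoly S a z = (\<Sum>n\<in>S. a n * mon n z)"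

lemma measurable_tpoly [measurable]: "tpoly S a \<in> borel_measurable torus_measure"
  unfolding tpoly_def by measurable

lemma norm_mon_torus: "z \<in> space torus_measure \<Longrightarrow> norm (mon n z) = 1"
  by (simp add: space_torus norm_mon)

lemma norm_tpoly_le: "z \<in> space torus_measure \<Longrightarrow> norm (tpoly S a z) \<le> (\<Sum>n\<in>S. norm (a n))"
  unfolding tpoly_def by (rule sum_norm_le) (simp add: norm_mult norm_mon_torus)

lemma integrable_torus_bounded:
  fixes F :: "(nat \<Rightarrow> complex) \<Rightarrow> 'a::{banach, second_countable_topology}"
  assumes "F \<in> borel_measurable torus_measure" "\<And>z. z \<in> space torus_measure \<Longrightarrow> norm (F z) \<le> B"
  shows "integrable torus_measure F"
  using assms by (intro torus.integrable_const_bound[where B = B]) auto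

lemma integrable_tpoly: "integrable torus_measure (tpoly S a)"
  by (rule integrable_torus_bounded[OF _ norm_tpoly_le]) measurable

lemma tpoly_rotate: "tpoly S a (\<lambda>j. z j * w j) = tpoly S (\<lambda>n. a n * mon n w) z"
  unfolding tpoly_def by (intro sum.cong) (auto simp: mon_times)

lemma l1_nonneg: "l1 F \<ge> 0"
  by (simp add: l1_def)

lemma l1_rotate:
  assumes "\<And>j. norm (\<omega> j) = 1" "F \<in> borel_measurable torus_measure"
  shows "l1 (\<lambda>z. F (\<lambda>j. z j * \<omega> j)) = l1 F"
  unfolding l1_def using integral_torus_rotate[OF assms(1), of "\<lambda>z. norm (F z)"] assms(2) by simp

lemma l1_triangle:
  "integrable torus_measure F \<Longrightarrow> integrable torus_measure G \<Longrightarrow> l1 (\<lambda>z. F z + G z) \<le> l1 F + l1 G"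
  unfolding l1_def
  by (subst Bochner_Integration.integral_add[symmetric]; (intro integral_mono integrable_norm
      Bochner_Integration.integrable_add norm_triangle_ineq)?) auto

lemma l1_diff_comm: "l1 (\<lambda>z. F z - G z) = l1 (\<lambda>z. G z - F z)"
  unfolding l1_def by (simp add: norm_minus_commute)

lemma l1_scale: "l1 (\<lambda>z. c * F z) = norm c * l1 F"
  unfolding l1_def by (simp add: norm_mult)

lemma l1_le_add_diff:
  "integrable torus_measure F \<Longrightarrow> integrable torus_measure G \<Longrightarrow> l1 F \<le> l1 G + l1 (\<lambda>z. F z - G z)"
  using l1_triangle[of G "\<lambda>z. F z - G z"] by simp

lemma l1_tpoly_le: "l1 (tpoly S a) \<le> (\<Sum>n\<in>S. norm (a n))"
proof -
  have "l1 (tpoly S a) \<le> (\<integral>z. (\<Sum>n\<in>S. norm (a n)) \<partial>torus_measure)"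
    unfolding l1_def using integrable_tpoly by (intro integral_mono) (auto intro: norm_tpoly_le)
  then show ?thesis by (simp add: torus.prob_space)
qed

lemma integrable_mon_cnj_mon: "integrable torus_measure (\<lambda>z. mon m z * cnj (mon n z))"
  by (rule integrable_torus_bounded[where B = 1]) (auto simp: norm_mult norm_mon_torus)

lemma fourier_coeff_tpoly:
  assumes "finite S" "0 \<notin> S" "n > 0"
  shows "fourier_coeff (tpoly S a) (kappa n) = (if n \<in> S then a n else 0)"
proof -
  have "fourier_coeff (tpoly S a) (kappa n) = (\<integral>z. (\<Sum>m\<in>S. a m * (mon m z * cnj (mon n z))) \<partial>torus_measure)"
    by (simp add: fourier_coeff_def tpoly_def sum_distrib_right mult.assoc flip: mon_def)
  also have "\<dots> = (\<Sum>m\<in>S. a m * (\<integral>z. mon m z * cnj (mon n z) \<partial>torus_measure))"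
    by (simp add: Bochner_Integration.integral_sum integrable_mon_cnj_mon)
  also have "\<dots> = (\<Sum>m\<in>S. if m = n then a m else 0)"
  proof (rule sum.cong)
    fix m assume "m \<in> S"
    then have "m > 0" using assms(2) by (auto intro: gr0I)
    then show "a m * (\<integral>z. mon m z * cnj (mon n z) \<partial>torus_measure) = (if m = n then a m else 0)"
      using assms(3) by (simp add: integral_mon_cnj_mon)
  qed simp
  finally show ?thesis
    using assms by simp
qed

text \<open>The coefficient of \<open>mon m\<close> at the common multi-index is read off in two
  ways, so orthogonality yields injectivity.\<close>

lemma inj_on_kappa: "inj_on kappa {0<..}"
proof (rule inj_onI)
  fix m n :: nat assume *: "m \<in> {0<..}" "n \<in> {0<..}" "kappa m = kappa n"
  then have "fourier_coeff (tpoly {m} (\<lambda>_. 1)) (kappa n) = 1"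
    by (subst *(3)[symmetric], subst fourier_coeff_tpoly) auto
  then show "m = n"
    using * by (subst (asm) fourier_coeff_tpoly) (auto split: if_splits)
qed

lemma analytic_polynomials_iff:
  "P \<in> analytic_polynomials \<longleftrightarrow> (\<exists>S a. finite S \<and> 0 \<notin> S \<and> P = tpoly S a)"
proof
  assume "P \<in> analytic_polynomials"
  then obtain K c where K: "finite K" "\<forall>\<kappa>\<in>K. finite {j. \<kappa> j \<noteq> 0}" "P = (\<lambda>z. \<Sum>\<kappa>\<in>K. c \<kappa> * monomial \<kappa> z)"
    unfolding analytic_polynomials_def by blast
  obtain \<nu> where \<nu>: "\<And>\<kappa>. \<kappa> \<in> K \<Longrightarrow> \<nu> \<kappa> > 0 \<and> kappa (\<nu> \<kappa>) = \<kappa>"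
    using ex_kappa_eq K(2) by metis
  have inj: "inj_on \<nu> K" using \<nu> by (metis inj_onI)
  have "P = tpoly (\<nu> ` K) (\<lambda>n. c (kappa n))"
    using \<nu> unfolding K(3) tpoly_def mon_def by (simp add: sum.reindex[OF inj])
  moreover have "0 \<notin> \<nu> ` K" using \<nu> by fastforce
  ultimately show "\<exists>S a. finite S \<and> 0 \<notin> S \<and> P = tpoly S a" using K(1) by blast
next
  assume "\<exists>S a. finite S \<and> 0 \<notin> S \<and> P = tpoly S a"
  then obtain S a where S: "finite S" "0 \<notin> S" "P = tpoly S a" by blast
  have inj: "inj_on kappa S"
    using inj_on_kappa by (rule inj_on_subset) (use S(2) in \<open>auto intro: gr0I\<close>)
  have "P = (\<lambda>z. \<Sum>\<kappa>\<in>kappa ` S. a (the_inv_into S kappa \<kappa>) * monomial \<kappa> z)"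
    unfolding S(3) tpoly_def mon_def by (simp add: fun_eq_iff sum.reindex[OF inj] the_inv_into_f_f[OF inj])
  moreover have "\<forall>\<kappa>\<in>kappa ` S. finite {j. \<kappa> j \<noteq> 0}"
    using S(2) finite_kappa_support by (metis gr0I imageE)
  ultimately show "P \<in> analytic_polynomials"
    unfolding analytic_polynomials_def using S(1)
    by (intro CollectI exI[of _ "kappa ` S"] exI[of _ "\<lambda>\<kappa>. a (the_inv_into S kappa \<kappa>)"]) simp
qed

section \<open>Positive multipliers with finite support\<close>

text \<open>The divisors of \<open>N\<close> serve as Folner sets in the multiplicative semigroup of positive integers;
  \<open>folner N n\<close> is the Fourier coefficient at \<open>n\<close> of a positive kernel of mean 1 on the torus.\<close>

definition folner :: "nat \<Rightarrow> nat \<Rightarrow> real" where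
  "folner N n = card {d. d dvd N \<and> d * n dvd N} / card {d. d dvd N}"

text \<open>As for the Fejer kernel, the squared modulus gives positivity, and dividing by the
  number of divisors makes the mean 1 by orthogonality.\<close>

definition folner_kernel :: "nat \<Rightarrow> (nat \<Rightarrow> complex) \<Rightarrow> real" where
  "folner_kernel N \<omega> = (norm (\<Sum>d | d dvd N. mon d \<omega>))\<^sup>2 / card {d. d dvd N}"

text \<open>The finite support is what turns a damped symbol, or a damped function of the Hardy
  space, into a polynomial.\<close>

lemma folner_eq_0: "\<not> n dvd N \<Longrightarrow> folner N n = 0"
proof -
  assume "\<not> n dvd N"
  then have "{d. d dvd N \<and> d * n dvd N} = {}" using dvd_mult_right by blast
  then show ?thesis unfolding folner_def by (simp only:) simp
qed

lemma folner_nonneg: "0 \<le> folner N n"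
  by (simp add: folner_def)

lemma card_divisors_pos: "N > 0 \<Longrightarrow> card {d. d dvd (N::nat)} > 0"
  using finite_divisors_nat[of N] by (subst card_gt_0_iff) (blast intro: dvd_refl)

lemma folner_le_1: "N > 0 \<Longrightarrow> folner N n \<le> 1"
  unfolding folner_def using card_divisors_pos[of N] finite_divisors_nat[of N]
  by (subst divide_le_eq_1_pos) (auto intro!: card_mono)

lemma folner_1: "N > 0 \<Longrightarrow> folner N (Suc 0) = 1"
  using card_divisors_pos[of N] by (auto simp: folner_def intro: dvd_refl)

lemma measurable_folner_kernel [measurable]: "folner_kernel N \<in> borel_measurable torus_measure"
  unfolding folner_kernel_def by measurable

lemma folner_kernel_nonneg: "folner_kernel N \<omega> \<ge> 0"
  by (simp add: folner_kernel_def)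

lemma folner_kernel_le:
  assumes "\<omega> \<in> space torus_measure"
  shows "folner_kernel N \<omega> \<le> card {d. d dvd N}"
proof -
  let ?t = "real (card {d. d dvd N})"
  have "norm (\<Sum>d | d dvd N. mon d \<omega>) \<le> (\<Sum>d | d dvd N. 1)"
    by (rule sum_norm_le) (simp add: norm_mon_torus assms)
  then have "(norm (\<Sum>d | d dvd N. mon d \<omega>))\<^sup>2 \<le> ?t\<^sup>2"
    by (intro power_mono) auto
  then have "folner_kernel N \<omega> \<le> ?t\<^sup>2 / ?t"
    unfolding folner_kernel_def by (rule divide_right_mono) simp
  then show ?thesis by (simp add: power2_eq_square split: if_splits)
qed

lemma integrable_folner_kernel_mon:
  "integrable torus_measure (\<lambda>\<omega>. of_real (folner_kernel N \<omega>) * mon n \<omega>)"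
  by (rule integrable_torus_bounded[where B = "card {d. d dvd N}"])
    (auto simp: norm_mult norm_mon_torus folner_kernel_nonneg folner_kernel_le)

text \<open>After expanding the square only the pairs of divisors with \<open>d * n = d'\<close>
  survive, and these correspond to the \<open>d\<close> with \<open>d * n dvd N\<close>.\<close>

lemma integral_folner_kernel_mon:
  assumes "N > 0" "n > 0"
  shows "(\<integral>\<omega>. of_real (folner_kernel N \<omega>) * mon n \<omega> \<partial>torus_measure) = complex_of_real (folner N n)"
proof -
  let ?D = "{d. d dvd N}" and ?t = "complex_of_nat (card {d. d dvd N})"
  have D: "finite ?D" using finite_divisors_nat assms(1) by blast
  have Dpos: "d > 0" if "d \<in> ?D" for d using that assms(1) by (auto intro: gr0I)
  have "of_real (folner_kernel N \<omega>) * mon n \<omega>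
      = (\<Sum>d\<in>?D. \<Sum>d'\<in>?D. mon (d * n) \<omega> * cnj (mon d' \<omega>)) / ?t" for \<omega>
  proof -
    have "of_real (folner_kernel N \<omega>) * mon n \<omega> = (\<Sum>d\<in>?D. mon d \<omega>) * cnj (\<Sum>d\<in>?D. mon d \<omega>) * mon n \<omega> / ?t"
      unfolding folner_kernel_def complex_norm_square[symmetric] by simp
    also have "(\<Sum>d\<in>?D. mon d \<omega>) * cnj (\<Sum>d\<in>?D. mon d \<omega>) * mon n \<omega>
        = (\<Sum>d\<in>?D. \<Sum>d'\<in>?D. mon d \<omega> * mon n \<omega> * cnj (mon d' \<omega>))"
      unfolding cnj_sum sum_product unfolding sum_distrib_right by (simp only: mult_ac)
    also have "\<dots> = (\<Sum>d\<in>?D. \<Sum>d'\<in>?D. mon (d * n) \<omega> * cnj (mon d' \<omega>))"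
      using Dpos assms(2) by (intro sum.cong refl) (auto simp: mon_mult)
    finally show ?thesis .
  qed
  then have "(\<integral>\<omega>. of_real (folner_kernel N \<omega>) * mon n \<omega> \<partial>torus_measure)
      = (\<Sum>d\<in>?D. \<Sum>d'\<in>?D. (\<integral>\<omega>. mon (d * n) \<omega> * cnj (mon d' \<omega>) \<partial>torus_measure)) / ?t"
    by (simp add: Bochner_Integration.integral_sum integrable_mon_cnj_mon)
  also have "(\<Sum>d\<in>?D. \<Sum>d'\<in>?D. (\<integral>\<omega>. mon (d * n) \<omega> * cnj (mon d' \<omega>) \<partial>torus_measure))
      = (\<Sum>d\<in>?D. \<Sum>d'\<in>?D. if d * n = d' then 1 else 0)"
    using Dpos assms(2) by (intro sum.cong refl integral_mon_cnj_mon) auto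
  also have "\<dots> = (\<Sum>d\<in>?D. if d * n dvd N then 1 else 0)"
    using D by (intro sum.cong refl) simp
  also have "\<dots> = of_nat (card {d. d dvd N \<and> d * n dvd N})"
    using D by (simp add: sum.If_cases Collect_conj_eq)
  finally show ?thesis by (simp add: folner_def)
qed

lemma integral_folner_kernel:
  assumes "N > 0"
  shows "(\<integral>\<omega>. folner_kernel N \<omega> \<partial>torus_measure) = 1"
proof -
  have "complex_of_real (\<integral>\<omega>. folner_kernel N \<omega> \<partial>torus_measure) = 1"
    using integral_folner_kernel_mon[OF assms, of "Suc 0"] folner_1[OF assms] by simp
  then show ?thesis using of_real_eq_1_iff by blast
qed

interpretation torus2: pair_prob_space torus_measure torus_measure ..

lemma integrable_torus2_bounded:
  fixes F :: "(nat \<Rightarrow> complex) \<times> (nat \<Rightarrow> complex) \<Rightarrow> 'a::{banach, second_countable_topology}"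
  assumes "F \<in> borel_measurable (torus_measure \<Otimes>\<^sub>M torus_measure)"
    and "\<And>z w. z \<in> space torus_measure \<Longrightarrow> w \<in> space torus_measure \<Longrightarrow> norm (F (z, w)) \<le> B"
  shows "integrable (torus_measure \<Otimes>\<^sub>M torus_measure) F"
  using assms by (intro torus2.integrable_const_bound[where B = B]) (auto simp: space_pair_measure)

text \<open>The damped sum is an average, against a probability density, of the twisted sums in the
  hypothesis, and \<open>l1\<close> is convex. The exponent \<open>\<phi> i\<close> of the twist is
  kept apart from \<open>\<psi> i\<close> because the lemma serves both for functions, where they
  agree, and for symbols, where the twist sees only the factor coming from \<open>g\<close>.\<close>

lemma l1_folner_average:
  assumes "N > 0" and I: "finite I" "\<And>i. i \<in> I \<Longrightarrow> \<phi> i > 0"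
    and B: "\<And>\<omega>. \<omega> \<in> space torus_measure \<Longrightarrow> l1 (\<lambda>z. \<Sum>i\<in>I. c i * mon (\<phi> i) \<omega> * mon (\<psi> i) z) \<le> B"
  shows "l1 (\<lambda>z. \<Sum>i\<in>I. c i * folner N (\<phi> i) * mon (\<psi> i) z) \<le> B"
proof -
  let ?M = torus_measure and ?k = "folner_kernel N" and ?t = "real (card {d. d dvd N})"
  define H where "H = (\<lambda>\<omega> z. \<Sum>i\<in>I. c i * mon (\<phi> i) \<omega> * mon (\<psi> i) z)"
  define C where "C = (\<Sum>i\<in>I. norm (c i))"
  have H_le: "norm (H \<omega> z) \<le> C" if "\<omega> \<in> space ?M" "z \<in> space ?M" for \<omega> z
    unfolding H_def C_def using that by (intro sum_norm_le) (simp add: norm_mult norm_mon_torus)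
  have C0: "C \<ge> 0" by (simp add: C_def sum_nonneg)
  have [measurable]: "(\<lambda>x. H (fst x) (snd x)) \<in> borel_measurable (?M \<Otimes>\<^sub>M ?M)"
    unfolding H_def by measurable
  have [measurable]: "H \<omega> \<in> borel_measurable ?M" "(\<lambda>\<omega>. H \<omega> z) \<in> borel_measurable ?M" for \<omega> z
    unfolding H_def by measurable
  have bd: "norm (?k \<omega> * norm (H \<omega> z)) \<le> ?t * C" if "\<omega> \<in> space ?M" "z \<in> space ?M" for \<omega> z
    using mult_mono[OF folner_kernel_le H_le, of \<omega> \<omega> z N] that C0
    by (simp add: folner_kernel_nonneg)
  have int_kH: "integrable ?M (\<lambda>\<omega>. ?k \<omega> * norm (H \<omega> z))" if "z \<in> space ?M" for z
    using bd that by (intro integrable_torus_bounded[where B = "?t * C"]) auto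
  have int2: "integrable (?M \<Otimes>\<^sub>M ?M) (\<lambda>(\<omega>, z). ?k \<omega> * norm (H \<omega> z))"
  proof (rule integrable_torus2_bounded[where B = "?t * C"])
    show "(\<lambda>(\<omega>, z). ?k \<omega> * norm (H \<omega> z)) \<in> borel_measurable (?M \<Otimes>\<^sub>M ?M)"
      unfolding case_prod_beta by measurable
  qed (use bd in auto)
  have eq: "(\<Sum>i\<in>I. c i * folner N (\<phi> i) * mon (\<psi> i) z) = (\<integral>\<omega>. of_real (?k \<omega>) * H \<omega> z \<partial>?M)"
    if z: "z \<in> space ?M" for z
  proof -
    have "(\<integral>\<omega>. of_real (?k \<omega>) * H \<omega> z \<partial>?M)
        = (\<integral>\<omega>. (\<Sum>i\<in>I. (c i * mon (\<psi> i) z) * (of_real (?k \<omega>) * mon (\<phi> i) \<omega>)) \<partial>?M)"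
      unfolding H_def by (simp add: sum_distrib_left mult_ac)
    also have "\<dots> = (\<Sum>i\<in>I. (c i * mon (\<psi> i) z) * (\<integral>\<omega>. of_real (?k \<omega>) * mon (\<phi> i) \<omega> \<partial>?M))"
      by (simp add: Bochner_Integration.integral_sum integrable_folner_kernel_mon)
    finally show ?thesis
      using I by (simp add: integral_folner_kernel_mon[OF assms(1)] mult.assoc mult.commute[of "mon _ z"])
  qed
  have "l1 (\<lambda>z. \<Sum>i\<in>I. c i * folner N (\<phi> i) * mon (\<psi> i) z) \<le> (\<integral>z. (\<integral>\<omega>. ?k \<omega> * norm (H \<omega> z) \<partial>?M) \<partial>?M)"
    unfolding l1_def
  proof (rule integral_mono)
    show "integrable ?M (\<lambda>z. norm (\<Sum>i\<in>I. c i * folner N (\<phi> i) * mon (\<psi> i) z))"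
    proof (rule integrable_torus_bounded)
      show "norm (norm (\<Sum>i\<in>I. c i * folner N (\<phi> i) * mon (\<psi> i) z)) \<le> (\<Sum>i\<in>I. norm (c i * folner N (\<phi> i)))"
        if "z \<in> space ?M" for z
        unfolding real_norm_def abs_norm_cancel using that
        by (intro sum_norm_le) (simp add: norm_mult norm_mon_torus)
    qed measurable
    show "integrable ?M (\<lambda>z. \<integral>\<omega>. ?k \<omega> * norm (H \<omega> z) \<partial>?M)"
      using torus2.integrable_snd[OF int2] by simp
    fix z assume z: "z \<in> space ?M"
    have "norm (\<integral>\<omega>. of_real (?k \<omega>) * H \<omega> z \<partial>?M) \<le> (\<integral>\<omega>. norm (of_real (?k \<omega>) * H \<omega> z) \<partial>?M)"
      by (rule integral_norm_bound)
    then show "norm (\<Sum>i\<in>I. c i * folner N (\<phi> i) * mon (\<psi> i) z) \<le> (\<integral>\<omega>. ?k \<omega> * norm (H \<omega> z) \<partial>?M)"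
      unfolding eq[OF z] by (simp add: norm_mult folner_kernel_nonneg)
  qed
  \<comment> \<open>Exchanging the integrals puts the twist outside, where the hypothesis bounds
    each inner integral.\<close>
  also have "\<dots> = (\<integral>\<omega>. (\<integral>z. ?k \<omega> * norm (H \<omega> z) \<partial>?M) \<partial>?M)"
    by (rule torus2.Fubini_integral[OF int2])
  also have "\<dots> \<le> (\<integral>\<omega>. ?k \<omega> * B \<partial>?M)"
  proof (rule integral_mono)
    show "integrable ?M (\<lambda>\<omega>. \<integral>z. ?k \<omega> * norm (H \<omega> z) \<partial>?M)"
      using torus2.integrable_fst[OF int2] by simp
    show "integrable ?M (\<lambda>\<omega>. ?k \<omega> * B)"
      by (intro integrable_mult_left integrable_torus_bounded[where B = ?t])
        (auto simp: folner_kernel_nonneg folner_kernel_le)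
    fix \<omega> assume "\<omega> \<in> space ?M"
    then show "(\<integral>z. ?k \<omega> * norm (H \<omega> z) \<partial>?M) \<le> ?k \<omega> * B"
      using B[of \<omega>] by (simp add: l1_def H_def mult_left_mono folner_kernel_nonneg)
  qed
  also have "\<dots> = B"
    by (simp add: integral_folner_kernel assms(1))
  finally show ?thesis .
qed

text \<open>Twisting by a torus point is a rotation, so all the functions averaged have one and the
  same norm.\<close>

lemma l1_folner_tpoly_le:
  assumes "N > 0" "finite S" "0 \<notin> S"
  shows "l1 (tpoly S (\<lambda>n. a n * of_real (folner N n))) \<le> l1 (tpoly S a)"
proof -
  have "l1 (\<lambda>z. \<Sum>n\<in>S. a n * of_real (folner N n) * mon n z) \<le> l1 (tpoly S a)"
  proof (rule l1_folner_average[OF assms(1,2)])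
    fix n assume "n \<in> S" then show "n > 0" using assms(3) by (auto intro: gr0I)
  next
    fix \<omega> assume "\<omega> \<in> space torus_measure"
    then have "l1 (\<lambda>z. tpoly S a (\<lambda>j. z j * \<omega> j)) = l1 (tpoly S a)"
      by (intro l1_rotate) (auto simp: space_torus)
    then show "l1 (\<lambda>z. \<Sum>n\<in>S. a n * mon n \<omega> * mon n z) \<le> l1 (tpoly S a)"
      by (simp add: tpoly_rotate) (simp add: tpoly_def[abs_def])
  qed
  then show ?thesis by (simp add: tpoly_def[abs_def])
qed

text \<open>The defect \<open>1 - folner N n\<close> is the proportion of divisors that
  multiplication by \<open>n\<close> throws out of the set. A divisor that survives \<open>m\<close>
  but not \<open>m * n\<close> is carried by \<open>m\<close> to one that \<open>n\<close> throws
  out, and multiplication by \<open>m\<close> is injective.\<close>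

lemma folner_mult_ge:
  assumes "N > 0" "m > 0"
  shows "1 - folner N (m * n) \<le> (1 - folner N m) + (1 - folner N n)"
proof -
  let ?D = "{d. d dvd N}" and ?G = "\<lambda>n. {d. d dvd N \<and> d * n dvd N}"
  have D: "finite ?D" using finite_divisors_nat assms(1) by blast
  have fin: "finite (?G k)" for k by (rule finite_subset[OF _ D]) auto
  let ?B = "{d \<in> ?G m. \<not> d * (m * n) dvd N}"
  have "card ?B \<le> card (?D - ?G n)"
  proof (rule card_inj_on_le)
    show "inj_on (\<lambda>d. d * m) ?B" using assms(2) by (auto intro!: inj_onI)
    show "(\<lambda>d. d * m) ` ?B \<subseteq> ?D - ?G n" by (auto simp: mult.assoc)
  qed (use D in auto)
  moreover have "?G m = ?G (m * n) \<union> ?B" by (auto intro: dvd_mult_left simp: mult.assoc[symmetric])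
  then have "card (?G m) \<le> card (?G (m * n)) + card ?B" by (metis (no_types, lifting) card_Un_le)
  moreover have "card (?D - ?G n) + card (?G n) = card ?D"
    by (subst card_Diff_subset[OF fin]) (auto intro!: le_add_diff_inverse2 card_mono D)
  ultimately have "card (?G m) + card (?G n) \<le> card (?G (m * n)) + card ?D" by linarith
  then have "real (card (?G m) + card (?G n)) \<le> real (card (?G (m * n)) + card ?D)"
    by (rule of_nat_mono)
  then have "real (card (?G m)) + card (?G n) \<le> real (card (?G (m * n))) + card ?D"
    unfolding of_nat_add .
  then have "(real (card (?G m)) + card (?G n)) / card ?D \<le> (real (card (?G (m * n))) + card ?D) / card ?D"
    by (rule divide_right_mono) simp
  then show ?thesis
    using card_divisors_pos[OF assms(1)] unfolding folner_def by (simp add: add_divide_distrib)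
qed

text \<open>The divisors thrown out by \<open>p\<close> contain the full power of \<open>p\<close>
  in \<open>N\<close>. Dividing each of them by \<open>p ^ i\<close>, for every \<open>i\<close> up
  to that exponent, produces pairwise different divisors.\<close>

lemma folner_prime_ge:
  assumes N: "N > 0" and p: "prime p"
  shows "1 - folner N p \<le> 1 / (multiplicity p N + 1)"
proof -
  let ?D = "{d. d dvd N}" and ?G = "{d. d dvd N \<and> d * p dvd N}" and ?E = "multiplicity p N"
  have D: "finite ?D" using finite_divisors_nat N by blast
  have fin: "finite ?G" by (rule finite_subset[OF _ D]) auto
  have p0: "p > 0" using p by (simp add: prime_gt_0_nat)
  have mul: "multiplicity p d = ?E" if "d \<in> ?D - ?G" for d
  proof -
    from that obtain k where k: "N = d * k" by auto
    with N have "d \<noteq> 0" "k \<noteq> 0" by auto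
    then have "?E = multiplicity p d + multiplicity p k"
      unfolding k using p by (intro prime_elem_multiplicity_mult_distrib) auto
    moreover have "\<not> p dvd k" using that k by auto
    ultimately show ?thesis by (simp add: not_dvd_imp_multiplicity_0)
  qed
  have pw: "p ^ i dvd d" "multiplicity p (d div p ^ i) = ?E - i" if "d \<in> ?D - ?G" "i \<le> ?E" for d i
  proof -
    show *: "p ^ i dvd d" using mul[OF that(1)] that(2) by (intro multiplicity_dvd') simp
    then obtain k where k: "d = p ^ i * k" by blast
    have "d \<noteq> 0" using that(1) N by auto
    then have "multiplicity p d = i + multiplicity p k"
      using k p by (simp add: prime_elem_multiplicity_mult_distrib)
    then show "multiplicity p (d div p ^ i) = ?E - i"
      using k p0 mul[OF that(1)] by simp
  qed
  have "card ((?D - ?G) \<times> {..?E}) \<le> card ?D"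
  proof (rule card_inj_on_le)
    \<comment> \<open>The exponent of \<open>p\<close> in the quotient determines \<open>i\<close>,
      and then the quotient determines \<open>d\<close>.\<close>
    show "inj_on (\<lambda>(d, i). d div p ^ i) ((?D - ?G) \<times> {..?E})"
    proof (rule inj_onI)
      fix x y
      assume "x \<in> (?D - ?G) \<times> {..?E}" "y \<in> (?D - ?G) \<times> {..?E}"
        and "(case x of (d, i) \<Rightarrow> d div p ^ i) = (case y of (d, i) \<Rightarrow> d div p ^ i)"
      then obtain d i d' i' where xy: "x = (d, i)" "y = (d', i')"
        and d: "d \<in> ?D - ?G" "i \<le> ?E" and d': "d' \<in> ?D - ?G" "i' \<le> ?E"
        and eq: "d div p ^ i = d' div p ^ i'"
        by (cases x; cases y) auto
      have "?E - i = ?E - i'" using pw(2)[OF d] pw(2)[OF d'] eq by argo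
      then have "i = i'" using d d' by simp
      moreover from this have "d = d'"
        using pw(1)[OF d] pw(1)[OF d'] eq \<open>i = i'\<close> by (metis dvd_mult_div_cancel)
      ultimately show "x = y" by (simp add: xy)
    qed
    show "(\<lambda>(d, i). d div p ^ i) ` ((?D - ?G) \<times> {..?E}) \<subseteq> ?D"
    proof
      fix x assume "x \<in> (\<lambda>(d, i). d div p ^ i) ` ((?D - ?G) \<times> {..?E})"
      then obtain d i where di: "x = d div p ^ i" "d \<in> ?D - ?G" "i \<le> ?E" by auto
      then have "x * p ^ i = d" using pw(1)[OF di(2,3)] by simp
      then show "x \<in> ?D" using di(2) by (metis DiffD1 dvd_mult_left mem_Collect_eq)
    qed
  qed (use D in auto)
  then have "real (card (?D - ?G) * (?E + 1)) \<le> real (card ?D)"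
    unfolding of_nat_le_iff by (simp add: card_cartesian_product)
  moreover have "real (card (?D - ?G)) = real (card ?D) - real (card ?G)"
  proof -
    have "?G \<subseteq> ?D" by auto
    from card_Diff_subset[OF fin this] card_mono[OF D this] show ?thesis by linarith
  qed
  ultimately have *: "(real (card ?D) - real (card ?G)) * (real ?E + 1) \<le> real (card ?D)"
    by (simp only: of_nat_mult of_nat_add of_nat_1)
  have "(real (card ?D) - real (card ?G)) / real (card ?D) * (real ?E + 1) \<le> 1"
    using divide_right_mono[OF *, of "real (card ?D)"] card_divisors_pos[OF N] by (simp only: times_divide_eq_left) simp
  then have "(real (card ?D) - real (card ?G)) / real (card ?D) \<le> 1 / (real ?E + 1)"
    by (subst pos_le_divide_eq) (simp_all only: of_nat_0_le_iff add_nonneg_pos zero_less_one)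
  moreover have "(real (card ?D) - real (card ?G)) / real (card ?D) = 1 - folner N p"
    using card_divisors_pos[OF N] unfolding folner_def diff_divide_distrib by simp
  ultimately show ?thesis by (simp only: of_nat_add of_nat_1)
qed

text \<open>Every prime \<open>p \<le> m\<close> divides this number at least \<open>m\<close>
  times, so the exponent of each fixed prime tends to infinity.\<close>

definition folner_seq :: "nat \<Rightarrow> nat" where
  "folner_seq m = fact m ^ m"

lemma folner_seq_pos: "folner_seq m > 0"
  by (simp add: folner_seq_def)

text \<open>Defects are subadditive along the prime factorization, and the defect of a prime
  \<open>p\<close> is at most \<open>1 / Suc m\<close> once \<open>m \<ge> p\<close>.\<close>

lemma folner_tendsto_1:
  assumes "n > 0"
  shows "(\<lambda>m. folner (folner_seq m) n) \<longlonglongrightarrow> 1"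
  using assms
proof (induction n rule: prime_divisors_induct)
  case (unit n)
  then show ?case by (simp add: folner_1 folner_seq_pos)
next
  case (factor p n)
  have p: "p > 0" "prime p" using factor by (auto simp: prime_gt_0_nat)
  have n: "(\<lambda>m. folner (folner_seq m) n) \<longlonglongrightarrow> 1" using factor by simp
  have lower: "eventually (\<lambda>m. 1 - 1 / real (Suc m) - (1 - folner (folner_seq m) n) \<le> folner (folner_seq m) (p * n)) sequentially"
    using eventually_ge_at_top[of p]
  proof eventually_elim
    case (elim m)
    have "p ^ m dvd folner_seq m"
      unfolding folner_seq_def using p elim by (intro dvd_power_same dvd_fact) auto
    then have "m \<le> multiplicity p (folner_seq m)"
      using p folner_seq_pos[of m] by (intro multiplicity_geI) auto
    then have "1 / real (multiplicity p (folner_seq m) + 1) \<le> 1 / real (Suc m)"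
      by (intro divide_left_mono) auto
    then have "1 - folner (folner_seq m) p \<le> 1 / real (Suc m)"
      using folner_prime_ge[OF folner_seq_pos p(2), of m] by simp
    then show ?case using folner_mult_ge[OF folner_seq_pos p(1), of m n] by simp
  qed
  have "(\<lambda>m. 1 / real (Suc m)) \<longlonglongrightarrow> 0"
    by (rule LIMSEQ_Suc[OF lim_1_over_n])
  from tendsto_diff[OF tendsto_diff[OF tendsto_const[of 1] this] tendsto_diff[OF tendsto_const[of 1] n]]
  have lim: "(\<lambda>m. 1 - 1 / real (Suc m) - (1 - folner (folner_seq m) n)) \<longlonglongrightarrow> 1"
    by (simp only: diff_0_right diff_self)
  show ?case
    by (rule real_tendsto_sandwich[OF lower _ lim tendsto_const[of 1]])
      (simp add: folner_le_1[OF folner_seq_pos])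
qed simp

section \<open>The Hardy space of the torus\<close>

lemma integrable_mult_cnj_mon:
  assumes "integrable torus_measure F"
  shows "integrable torus_measure (\<lambda>z. F z * cnj (mon n z))"
proof (rule Bochner_Integration.integrable_bound[OF assms])
  show "(\<lambda>z. F z * cnj (mon n z)) \<in> borel_measurable torus_measure"
    using borel_measurable_integrable[OF assms] by measurable
qed (auto simp: norm_mult norm_mon_torus)

lemma fourier_coeff_diff:
  assumes "integrable torus_measure F" "integrable torus_measure G"
  shows "fourier_coeff (\<lambda>z. F z - G z) (kappa n) = fourier_coeff F (kappa n) - fourier_coeff G (kappa n)"
  using assms[THEN integrable_mult_cnj_mon]
  by (simp add: fourier_coeff_def left_diff_distrib Bochner_Integration.integral_diff flip: mon_def)

lemma norm_fourier_coeff_le: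
  assumes "integrable torus_measure F"
  shows "norm (fourier_coeff F (kappa n)) \<le> l1 F"
proof -
  have "norm (fourier_coeff F (kappa n)) \<le> (\<integral>z. norm (F z * cnj (mon n z)) \<partial>torus_measure)"
    unfolding fourier_coeff_def mon_def by (rule integral_norm_bound)
  also have "\<dots> = l1 F"
    unfolding l1_def by (rule Bochner_Integration.integral_cong) (auto simp: norm_mult norm_mon_torus)
  finally show ?thesis .
qed

lemma H1_torus_integrable: "F \<in> H1_torus \<Longrightarrow> integrable torus_measure F"
  by (simp add: H1_torus_def)

lemma H1_torus_approx:
  assumes "F \<in> H1_torus" "\<epsilon> > 0"
  obtains S a where "finite S" "0 \<notin> S" "l1 (\<lambda>z. F z - tpoly S a z) < \<epsilon>"
  using assms unfolding H1_torus_def l1_def Bex_def analytic_polynomials_iff by blast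

lemma H1_torusI:
  assumes "integrable torus_measure F"
    and "\<And>\<epsilon>. \<epsilon> > 0 \<Longrightarrow> \<exists>S a. finite S \<and> 0 \<notin> S \<and> l1 (\<lambda>z. F z - tpoly S a z) < \<epsilon>"
  shows "F \<in> H1_torus"
  using assms unfolding H1_torus_def l1_def Bex_def analytic_polynomials_iff by blast

lemma tpoly_in_H1_torus: "finite S \<Longrightarrow> 0 \<notin> S \<Longrightarrow> tpoly S a \<in> H1_torus"
  by (rule H1_torusI[OF integrable_tpoly], rule exI[of _ S], rule exI[of _ a]) (simp add: l1_def)

lemma tpoly_superset:
  assumes "finite T" "S \<subseteq> T"
  shows "tpoly S a z = tpoly T (\<lambda>n. if n \<in> S then a n else 0) z"
  unfolding tpoly_def by (rule sum.mono_neutral_cong_left) (use assms in auto)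

lemma H1_torus_add:
  assumes F: "F \<in> H1_torus" and G: "G \<in> H1_torus"
  shows "(\<lambda>z. F z + G z) \<in> H1_torus"
proof (rule H1_torusI)
  have int: "integrable torus_measure F" "integrable torus_measure G"
    using assms by (auto intro: H1_torus_integrable)
  then show "integrable torus_measure (\<lambda>z. F z + G z)" by simp
  fix \<epsilon> :: real assume "\<epsilon> > 0"
  then have e: "\<epsilon> / 2 > 0" by simp
  obtain S a where S: "finite S" "0 \<notin> S" "l1 (\<lambda>z. F z - tpoly S a z) < \<epsilon> / 2"
    using H1_torus_approx[OF F e] .
  obtain T b where T: "finite T" "0 \<notin> T" "l1 (\<lambda>z. G z - tpoly T b z) < \<epsilon> / 2"
    using H1_torus_approx[OF G e] .
  define c where "c = (\<lambda>n. (if n \<in> S then a n else 0) + (if n \<in> T then b n else 0))"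
  have "tpoly (S \<union> T) c z = tpoly S a z + tpoly T b z" for z
    using tpoly_superset[of "S \<union> T" S a z] tpoly_superset[of "S \<union> T" T b z] S(1) T(1)
    by (simp add: tpoly_def c_def distrib_right sum.distrib)
  then have "(\<lambda>z. F z + G z - tpoly (S \<union> T) c z) = (\<lambda>z. (F z - tpoly S a z) + (G z - tpoly T b z))"
    by (simp add: fun_eq_iff algebra_simps)
  then have "l1 (\<lambda>z. F z + G z - tpoly (S \<union> T) c z)
      \<le> l1 (\<lambda>z. F z - tpoly S a z) + l1 (\<lambda>z. G z - tpoly T b z)"
    using l1_triangle[of "\<lambda>z. F z - tpoly S a z" "\<lambda>z. G z - tpoly T b z"] int integrable_tpoly by simp
  then have "l1 (\<lambda>z. F z + G z - tpoly (S \<union> T) c z) < \<epsilon>" using S(3) T(3) by simp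
  then show "\<exists>S a. finite S \<and> 0 \<notin> S \<and> l1 (\<lambda>z. F z + G z - tpoly S a z) < \<epsilon>"
    using S T by (intro exI[of _ "S \<union> T"] exI[of _ c]) auto
qed

lemma H1_torus_scale:
  assumes F: "F \<in> H1_torus"
  shows "(\<lambda>z. c * F z) \<in> H1_torus"
proof (rule H1_torusI)
  show "integrable torus_measure (\<lambda>z. c * F z)"
    using H1_torus_integrable[OF F] by simp
  fix \<epsilon> :: real assume "\<epsilon> > 0"
  then have "\<epsilon> / (norm c + 1) > 0" by (intro divide_pos_pos) (auto intro: add_nonneg_pos)
  then obtain S a where S: "finite S" "0 \<notin> S" "l1 (\<lambda>z. F z - tpoly S a z) < \<epsilon> / (norm c + 1)"
    using H1_torus_approx[OF F] by metis
  have "(\<lambda>z. c * F z - tpoly S (\<lambda>n. c * a n) z) = (\<lambda>z. c * (F z - tpoly S a z))"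
    by (simp add: fun_eq_iff tpoly_def sum_distrib_left algebra_simps)
  then have "l1 (\<lambda>z. c * F z - tpoly S (\<lambda>n. c * a n) z) = norm c * l1 (\<lambda>z. F z - tpoly S a z)"
    by (simp add: l1_scale)
  also have "\<dots> \<le> (norm c + 1) * l1 (\<lambda>z. F z - tpoly S a z)"
    by (intro mult_right_mono l1_nonneg) simp
  also have "\<dots> < \<epsilon>"
    using S(3) by (simp add: pos_less_divide_eq add_nonneg_pos mult.commute)
  finally show "\<exists>S a. finite S \<and> 0 \<notin> S \<and> l1 (\<lambda>z. c * F z - tpoly S a z) < \<epsilon>"
    using S by blast
qed

lemma H1_torus_diff:
  assumes "F \<in> H1_torus" "G \<in> H1_torus"
  shows "(\<lambda>z. F z - G z) \<in> H1_torus"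
  using H1_torus_add[OF assms(1) H1_torus_scale[OF assms(2), of "-1"]] by simp

text \<open>Convolution with the kernel, written on the Fourier side: it uses only the coefficients
  at the divisors of \<open>N\<close> and is a polynomial by construction.\<close>

definition folner_mean :: "nat \<Rightarrow> ((nat \<Rightarrow> complex) \<Rightarrow> complex) \<Rightarrow> (nat \<Rightarrow> complex) \<Rightarrow> complex" where
  "folner_mean N F = tpoly {d. d dvd N} (\<lambda>n. fourier_coeff F (kappa n) * of_real (folner N n))"

lemma folner_mean_tpoly:
  assumes "N > 0" "finite S" "0 \<notin> S"
  shows "folner_mean N (tpoly S a) = tpoly S (\<lambda>n. a n * of_real (folner N n))"
proof
  fix z
  let ?D = "{d. d dvd N}"
  have D: "finite ?D" using finite_divisors_nat assms(1) by blast
  have "folner_mean N (tpoly S a) z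
      = (\<Sum>n\<in>?D. (if n \<in> S then a n else 0) * of_real (folner N n) * mon n z)"
    unfolding folner_mean_def tpoly_def[of ?D]
  proof (intro sum.cong refl)
    fix n assume "n \<in> ?D"
    then have "n > 0" using assms(1) by (auto intro: gr0I)
    then show "fourier_coeff (tpoly S a) (kappa n) * of_real (folner N n) * mon n z
        = (if n \<in> S then a n else 0) * of_real (folner N n) * mon n z"
      using fourier_coeff_tpoly[OF assms(2,3)] by simp
  qed
  also have "\<dots> = (\<Sum>n\<in>?D \<inter> S. a n * of_real (folner N n) * mon n z)"
    by (rule sum.mono_neutral_cong_right) (use D in auto)
  also have "\<dots> = tpoly S (\<lambda>n. a n * of_real (folner N n)) z"
    unfolding tpoly_def by (rule sum.mono_neutral_left) (use assms folner_eq_0 in auto)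
  finally show "folner_mean N (tpoly S a) z = tpoly S (\<lambda>n. a n * of_real (folner N n)) z" .
qed

lemma folner_mean_diff:
  assumes "integrable torus_measure F" "integrable torus_measure G"
  shows "folner_mean N (\<lambda>z. F z - G z) z = folner_mean N F z - folner_mean N G z"
  by (simp add: folner_mean_def tpoly_def fourier_coeff_diff[OF assms] left_diff_distrib sum_subtractf)

lemma integrable_folner_mean: "integrable torus_measure (folner_mean N F)"
  unfolding folner_mean_def by (rule integrable_tpoly)

text \<open>A crude bound growing with \<open>N\<close>. It makes the mean continuous in
  \<open>F\<close>, so that the contraction property passes from polynomials to their
  closure.\<close>

lemma l1_folner_mean_le_card:
  assumes "N > 0" "integrable torus_measure F"
  shows "l1 (folner_mean N F) \<le> card {d. d dvd N} * l1 F"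
proof -
  have "l1 (folner_mean N F) \<le> (\<Sum>n | n dvd N. norm (fourier_coeff F (kappa n) * of_real (folner N n)))"
    unfolding folner_mean_def by (rule l1_tpoly_le)
  also have "\<dots> \<le> (\<Sum>n | n dvd N. l1 F * 1)"
    unfolding norm_mult using assms
    by (intro sum_mono mult_mono norm_fourier_coeff_le) (auto simp: folner_nonneg folner_le_1 l1_nonneg)
  finally show ?thesis by simp
qed

lemma l1_folner_mean_le:
  assumes "N > 0" and F: "F \<in> H1_torus"
  shows "l1 (folner_mean N F) \<le> l1 F"
proof (rule field_le_epsilon)
  fix \<epsilon> :: real assume e: "\<epsilon> > 0"
  let ?t = "real (card {d. d dvd N})"
  have t: "?t + 1 > 0" by (intro add_nonneg_pos) auto
  then have "\<epsilon> / (?t + 1) > 0" using e by simp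
  then obtain S a where S: "finite S" "0 \<notin> S" "l1 (\<lambda>z. F z - tpoly S a z) < \<epsilon> / (?t + 1)"
    using H1_torus_approx[OF F] by metis
  let ?P = "tpoly S a" and ?d = "l1 (\<lambda>z. F z - tpoly S a z)"
  have int: "integrable torus_measure F" "integrable torus_measure ?P"
    using H1_torus_integrable[OF F] integrable_tpoly by auto
  have "l1 (folner_mean N F) \<le> l1 (folner_mean N ?P) + l1 (\<lambda>z. folner_mean N F z - folner_mean N ?P z)"
    by (intro l1_le_add_diff integrable_folner_mean)
  also have "l1 (folner_mean N ?P) \<le> l1 ?P"
    using S by (simp add: folner_mean_tpoly[OF assms(1)] l1_folner_tpoly_le[OF assms(1)])
  also have "l1 (\<lambda>z. folner_mean N F z - folner_mean N ?P z) \<le> ?t * ?d"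
    unfolding folner_mean_diff[OF int, symmetric]
    by (rule l1_folner_mean_le_card[OF assms(1) Bochner_Integration.integrable_diff[OF int]])
  also have "l1 ?P \<le> l1 F + ?d"
    using l1_le_add_diff[OF int(2,1)] by (simp add: l1_diff_comm)
  \<comment> \<open>The approximation error enters twice: with factor \<open>?t\<close> through the
    crude bound, and once more in comparing the norms of \<open>?P\<close> and
    \<open>F\<close>.\<close>
  finally have "l1 (folner_mean N F) \<le> l1 F + (?t + 1) * ?d" by (simp add: algebra_simps)
  also have "(?t + 1) * ?d \<le> \<epsilon>"
    using S(3) t by (simp add: pos_less_divide_eq mult.commute)
  finally show "l1 (folner_mean N F) \<le> l1 F + \<epsilon>" by simp
qed

lemma folner_mean_tpoly_tendsto:
  assumes "finite S" "0 \<notin> S"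
  shows "(\<lambda>m. l1 (\<lambda>z. tpoly S a z - folner_mean (folner_seq m) (tpoly S a) z)) \<longlonglongrightarrow> 0"
proof (rule real_tendsto_sandwich[OF _ _ tendsto_const])
  let ?s = "\<lambda>m. \<Sum>n\<in>S. norm (a n * of_real (1 - folner (folner_seq m) n))"
  have "tpoly S a z - folner_mean (folner_seq m) (tpoly S a) z = tpoly S (\<lambda>n. a n * of_real (1 - folner (folner_seq m) n)) z" for m z
    using folner_mean_tpoly[OF folner_seq_pos assms]
    by (simp add: tpoly_def ring_distribs sum_subtractf)
  then show "eventually (\<lambda>m. l1 (\<lambda>z. tpoly S a z - folner_mean (folner_seq m) (tpoly S a) z) \<le> ?s m) sequentially"
    using l1_tpoly_le by simp
  have "?s \<longlonglongrightarrow> (\<Sum>n\<in>S. norm (a n * of_real (1 - 1)))"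
  proof (intro tendsto_intros folner_tendsto_1)
    fix n assume "n \<in> S" then show "n > 0" using assms(2) by (auto intro: gr0I)
  qed
  then show "?s \<longlonglongrightarrow> 0" by simp
qed (simp add: l1_nonneg)

text \<open>The means are contractions, uniformly in \<open>m\<close>, and converge on the dense set
  of polynomials.\<close>

lemma folner_mean_tendsto:
  assumes F: "F \<in> H1_torus"
  shows "(\<lambda>m. l1 (\<lambda>z. F z - folner_mean (folner_seq m) F z)) \<longlonglongrightarrow> 0"
proof (rule LIMSEQ_I)
  fix r :: real assume "r > 0"
  then have "r / 3 > 0" by simp
  then obtain S a where S: "finite S" "0 \<notin> S" "l1 (\<lambda>z. F z - tpoly S a z) < r / 3"
    using H1_torus_approx[OF F] by metis
  let ?P = "tpoly S a" and ?m = "\<lambda>m. folner_mean (folner_seq m)"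
  have FP: "(\<lambda>z. F z - ?P z) \<in> H1_torus"
    using H1_torus_diff[OF F tpoly_in_H1_torus[OF S(1,2)]] .
  have int: "integrable torus_measure F" "integrable torus_measure ?P"
    using H1_torus_integrable[OF F] integrable_tpoly by auto
  obtain M where M: "\<And>m. m \<ge> M \<Longrightarrow> l1 (\<lambda>z. ?P z - ?m m ?P z) < r / 3"
    using LIMSEQ_D[OF folner_mean_tpoly_tendsto[OF S(1,2)] \<open>r / 3 > 0\<close>] l1_nonneg by fastforce
  have "l1 (\<lambda>z. F z - ?m m F z) < r" if "m \<ge> M" for m
  proof -
    have "(\<lambda>z. F z - ?m m F z) = (\<lambda>z. ((F z - ?P z) + (?P z - ?m m ?P z)) + - 1 * ?m m (\<lambda>z. F z - ?P z) z)"
      by (simp add: fun_eq_iff folner_mean_diff[OF int])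
    then have "l1 (\<lambda>z. F z - ?m m F z)
        \<le> l1 (\<lambda>z. (F z - ?P z) + (?P z - ?m m ?P z)) + l1 (\<lambda>z. - 1 * ?m m (\<lambda>z. F z - ?P z) z)"
      by (simp only:) (intro l1_triangle Bochner_Integration.integrable_add Bochner_Integration.integrable_diff
          integrable_mult_right int integrable_folner_mean)
    also have "l1 (\<lambda>z. (F z - ?P z) + (?P z - ?m m ?P z)) \<le> l1 (\<lambda>z. F z - ?P z) + l1 (\<lambda>z. ?P z - ?m m ?P z)"
      by (intro l1_triangle Bochner_Integration.integrable_diff int integrable_folner_mean)
    also have "l1 (\<lambda>z. - 1 * ?m m (\<lambda>z. F z - ?P z) z) \<le> l1 (\<lambda>z. F z - ?P z)"
      unfolding l1_scale using l1_folner_mean_le[OF folner_seq_pos FP] by simp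
    finally show ?thesis using S(3) M[OF that] by simp
  qed
  then show "\<exists>no. \<forall>m\<ge>no. norm (l1 (\<lambda>z. F z - ?m m F z) - 0) < r"
    using l1_nonneg by (intro exI[of _ M]) simp
qed

text \<open>Both functions have the same Folner means; these approximate \<open>F\<close> and are
  dominated by \<open>G\<close>, and conversely. Equality of norms makes \<open>H1_norm\<close>
  independent of the chosen lift.\<close>

lemma l1_eq_fourier_coeff_eq:
  assumes F: "F \<in> H1_torus" and G: "G \<in> H1_torus"
    and eq: "\<And>n. n > 0 \<Longrightarrow> fourier_coeff F (kappa n) = fourier_coeff G (kappa n)"
  shows "l1 F = l1 G"
proof -
  have le: "l1 F \<le> l1 G" if F: "F \<in> H1_torus" and G: "G \<in> H1_torus"
    and eq: "\<And>n. n > 0 \<Longrightarrow> fourier_coeff F (kappa n) = fourier_coeff G (kappa n)" for F G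
  proof -
    have "folner_mean (folner_seq m) F = folner_mean (folner_seq m) G" for m
      unfolding folner_mean_def tpoly_def fun_eq_iff
      using eq folner_seq_pos[of m] by (auto intro!: sum.cong intro: gr0I)
    then have "l1 F \<le> l1 G + l1 (\<lambda>z. F z - folner_mean (folner_seq m) F z)" for m
      using l1_le_add_diff[OF H1_torus_integrable[OF F] integrable_folner_mean[of "folner_seq m" F]]
        l1_folner_mean_le[OF folner_seq_pos[of m] G] by simp
    moreover have "(\<lambda>m. l1 G + l1 (\<lambda>z. F z - folner_mean (folner_seq m) F z)) \<longlonglongrightarrow> l1 G + 0"
      by (intro tendsto_intros folner_mean_tendsto F)
    ultimately show ?thesis
      by (intro LIMSEQ_le_const[of _ "l1 G"]) auto
  qed
  show ?thesis using le[OF F G eq] le[OF G F eq[symmetric]] by simp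
qed

section \<open>A Hardy--Stein inequality\<close>

text \<open>\<open>qs \<epsilon>\<close> smooths the modulus; \<open>qs1\<close> and \<open>qs2\<close> are its first and second derivatives along a curve
  through \<open>w\<close> with velocity \<open>v\<close> and acceleration \<open>u\<close>.\<close>

definition qs :: "real \<Rightarrow> complex \<Rightarrow> real" where
  "qs \<epsilon> w = sqrt ((norm w)\<^sup>2 + \<epsilon>)"

definition qs1 :: "real \<Rightarrow> complex \<Rightarrow> complex \<Rightarrow> real" where
  "qs1 \<epsilon> w v = inner w v / qs \<epsilon> w"

definition qs2 :: "real \<Rightarrow> complex \<Rightarrow> complex \<Rightarrow> complex \<Rightarrow> real" where
  "qs2 \<epsilon> w v u = ((norm v)\<^sup>2 + inner w u) / qs \<epsilon> w - (inner w v)\<^sup>2 / qs \<epsilon> w ^ 3"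

lemma qs_pos: "\<epsilon> > 0 \<Longrightarrow> qs \<epsilon> w > 0"
  by (simp add: qs_def add_nonneg_pos)

lemma norm_le_qs: "\<epsilon> > 0 \<Longrightarrow> norm w \<le> qs \<epsilon> w"
  unfolding qs_def by (rule real_le_rsqrt) simp

lemma sqrt_le_qs: "\<epsilon> > 0 \<Longrightarrow> sqrt \<epsilon> \<le> qs \<epsilon> w"
  unfolding qs_def by simp

lemma qs_le: "\<epsilon> > 0 \<Longrightarrow> qs \<epsilon> w \<le> norm w + sqrt \<epsilon>"
  unfolding qs_def using sqrt_add_le_add_sqrt[of "(norm w)\<^sup>2" \<epsilon>] by simp

lemma DERIV_qs:
  assumes "\<epsilon> > 0" "(p has_vector_derivative p1) (at x)"
  shows "((\<lambda>x. qs \<epsilon> (p x)) has_real_derivative qs1 \<epsilon> (p x) p1) (at x)"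
proof -
  have "((\<lambda>x. inner (p x) (p x)) has_derivative (\<lambda>h. inner (p x) (h *\<^sub>R p1) + inner (h *\<^sub>R p1) (p x))) (at x)"
    using assms(2) unfolding has_vector_derivative_def by (intro has_derivative_inner)
  then have "((\<lambda>x. inner (p x) (p x)) has_real_derivative 2 * inner (p x) p1) (at x)"
    by (rule has_derivative_imp_has_field_derivative) (simp add: inner_commute)
  then have "((\<lambda>x. inner (p x) (p x) + \<epsilon>) has_real_derivative 2 * inner (p x) p1) (at x)"
    by (auto intro!: derivative_eq_intros)
  moreover have pos: "inner (p x) (p x) + \<epsilon> > 0" using assms(1) by (simp add: add_nonneg_pos)
  ultimately have "((\<lambda>x. sqrt (inner (p x) (p x) + \<epsilon>)) has_real_derivative
      (inverse (sqrt (inner (p x) (p x) + \<epsilon>)) / 2) * (2 * inner (p x) p1)) (at x)"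
    by (intro DERIV_chain2[OF DERIV_real_sqrt])
  then show ?thesis
    by (simp add: qs_def qs1_def power2_norm_eq_inner field_simps)
qed

lemma DERIV_qs1:
  assumes \<epsilon>: "\<epsilon> > 0" and p: "(p has_vector_derivative p1 x) (at x)" and p1: "(p1 has_vector_derivative p2) (at x)"
  shows "((\<lambda>x. qs1 \<epsilon> (p x) (p1 x)) has_real_derivative qs2 \<epsilon> (p x) (p1 x) p2) (at x)"
proof -
  have "((\<lambda>x. inner (p x) (p1 x)) has_derivative (\<lambda>h. inner (p x) (h *\<^sub>R p2) + inner (h *\<^sub>R p1 x) (p1 x))) (at x)"
    using p p1 unfolding has_vector_derivative_def by (intro has_derivative_inner)
  then have "((\<lambda>x. inner (p x) (p1 x)) has_real_derivative ((norm (p1 x))\<^sup>2 + inner (p x) p2)) (at x)"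
    by (rule has_derivative_imp_has_field_derivative) (simp add: power2_norm_eq_inner algebra_simps)
  from DERIV_divide[OF this DERIV_qs[OF \<epsilon> p]] qs_pos[OF \<epsilon>, of "p x"]
  have "((\<lambda>x. inner (p x) (p1 x) / qs \<epsilon> (p x)) has_real_derivative
    (((norm (p1 x))\<^sup>2 + inner (p x) p2) * qs \<epsilon> (p x) - inner (p x) (p1 x) * qs1 \<epsilon> (p x) (p1 x)) / (qs \<epsilon> (p x) * qs \<epsilon> (p x))) (at x)"
    by simp
  moreover have "(((norm (p1 x))\<^sup>2 + inner (p x) p2) * qs \<epsilon> (p x) - inner (p x) (p1 x) * qs1 \<epsilon> (p x) (p1 x)) / (qs \<epsilon> (p x) * qs \<epsilon> (p x))
     = qs2 \<epsilon> (p x) (p1 x) p2"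
    using qs_pos[OF \<epsilon>, of "p x"] unfolding qs2_def qs1_def
    by (simp add: diff_divide_distrib power2_eq_square power3_eq_cube)
  ultimately show ?thesis by (simp add: qs1_def)
qed

text \<open>By the Cauchy-Riemann equations the vertical direction has velocity
  \<open>\<i> * v\<close> and acceleration \<open>- u\<close>, so the right-hand side is the
  Laplacian along a holomorphic curve, and \<open>u\<close> cancels. Pythagoras for the projections
  of \<open>w\<close> on \<open>v\<close> and \<open>\<i> * v\<close> leaves
  \<open>2 / q - (norm w)\<^sup>2 / q ^ 3\<close> times \<open>(norm v)\<^sup>2\<close>, where
  \<open>q = qs \<epsilon> w\<close> is at least \<open>norm w\<close>.\<close>

lemma laplacian_qs_ge:
  assumes \<epsilon>: "\<epsilon> > 0"
  shows "(norm v)\<^sup>2 / qs \<epsilon> w \<le> qs2 \<epsilon> w v u + qs2 \<epsilon> w (\<i> * v) (- u)"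
proof -
  let ?q = "qs \<epsilon> w"
  have q: "?q > 0" using qs_pos[OF \<epsilon>] .
  have *: "(inner w v)\<^sup>2 + (inner w (\<i> * v))\<^sup>2 = (norm w)\<^sup>2 * (norm v)\<^sup>2"
    by (simp add: inner_complex_def cmod_power2) algebra
  have "qs2 \<epsilon> w v u + qs2 \<epsilon> w (\<i> * v) (- u) = 2 * (norm v)\<^sup>2 / ?q - (norm w)\<^sup>2 * (norm v)\<^sup>2 / ?q ^ 3"
    unfolding qs2_def *[symmetric] by (simp add: norm_mult add_divide_distrib diff_divide_distrib)
  moreover have "(norm w)\<^sup>2 * (norm v)\<^sup>2 / ?q ^ 3 \<le> ?q\<^sup>2 * (norm v)\<^sup>2 / ?q ^ 3"
    using q \<epsilon> by (intro divide_right_mono mult_right_mono power_mono norm_le_qs) auto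
  moreover have "?q\<^sup>2 * (norm v)\<^sup>2 / ?q ^ 3 = (norm v)\<^sup>2 / ?q"
    using q by (simp add: power2_eq_square power3_eq_cube)
  ultimately show ?thesis by simp
qed

lemma abs_qs1_le:
  assumes "\<epsilon> > 0"
  shows "\<bar>qs1 \<epsilon> w v\<bar> \<le> norm v"
proof -
  have "\<bar>inner w v\<bar> \<le> qs \<epsilon> w * norm v"
    using Cauchy_Schwarz_ineq2[of w v] mult_right_mono[OF norm_le_qs[OF assms, of w], of "norm v"] by simp
  then show ?thesis
    using qs_pos[OF assms, of w] by (simp add: qs1_def pos_divide_le_eq mult.commute)
qed

text \<open>The bound degenerates as \<open>\<epsilon>\<close> tends to 0, but it serves for
  integrability and enters no final estimate.\<close>

lemma abs_qs2_le:
  assumes \<epsilon>: "\<epsilon> > 0"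
  shows "\<bar>qs2 \<epsilon> w v u\<bar> \<le> 2 * (norm v)\<^sup>2 / sqrt \<epsilon> + norm u"
proof -
  let ?q = "qs \<epsilon> w"
  have q: "?q > 0" using qs_pos[OF \<epsilon>] .
  have 1: "(norm v)\<^sup>2 / ?q \<le> (norm v)\<^sup>2 / sqrt \<epsilon>"
    using \<epsilon> sqrt_le_qs[OF \<epsilon>, of w] q by (intro divide_left_mono) auto
  have 2: "\<bar>inner w u / ?q\<bar> \<le> norm u" using abs_qs1_le[OF \<epsilon>] unfolding qs1_def .
  have "(inner w v)\<^sup>2 / ?q ^ 3 = (inner w v / ?q)\<^sup>2 / ?q"
    by (simp add: power_divide power2_eq_square power3_eq_cube)
  also have "\<dots> \<le> (norm v)\<^sup>2 / ?q"
    using abs_qs1_le[OF \<epsilon>, of w v] q unfolding qs1_def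
    by (intro divide_right_mono) (auto simp: abs_le_square_iff[symmetric])
  finally have 3: "(inner w v)\<^sup>2 / ?q ^ 3 \<le> (norm v)\<^sup>2 / sqrt \<epsilon>" using 1 by simp
  have 4: "(inner w v)\<^sup>2 / ?q ^ 3 \<ge> 0" using q by simp
  have 5: "(norm v)\<^sup>2 / ?q \<ge> 0" using q by simp
  have 6: "2 * (norm v)\<^sup>2 / sqrt \<epsilon> = (norm v)\<^sup>2 / sqrt \<epsilon> + (norm v)\<^sup>2 / sqrt \<epsilon>"
    by simp
  have "\<bar>((norm v)\<^sup>2 / ?q + inner w u / ?q) - (inner w v)\<^sup>2 / ?q ^ 3\<bar> \<le> 2 * (norm v)\<^sup>2 / sqrt \<epsilon> + norm u"
    unfolding 6 using 1 2 3 4 5 by linarith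
  then show ?thesis unfolding qs2_def add_divide_distrib .
qed

lemma measurable_qs [measurable (raw)]:
  assumes [measurable]: "f \<in> borel_measurable M"
  shows "(\<lambda>x. qs \<epsilon> (f x)) \<in> borel_measurable M"
  unfolding qs_def by measurable

lemma measurable_qs1 [measurable (raw)]:
  assumes [measurable]: "f \<in> borel_measurable M" "g \<in> borel_measurable M"
  shows "(\<lambda>x. qs1 \<epsilon> (f x) (g x)) \<in> borel_measurable M"
  unfolding qs1_def by measurable

lemma measurable_qs2 [measurable (raw)]:
  assumes [measurable]: "f \<in> borel_measurable M" "g \<in> borel_measurable M" "h \<in> borel_measurable M"
  shows "(\<lambda>x. qs2 \<epsilon> (f x) (g x) (h x)) \<in> borel_measurable M"
  unfolding qs2_def by measurable

section \<open>Dirichlet polynomials twisted by a torus point, and their vertical flow\<close>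

definition dpoly :: "nat set \<Rightarrow> (nat \<Rightarrow> complex) \<Rightarrow> (nat \<Rightarrow> complex) \<Rightarrow> complex \<Rightarrow> complex" where
  "dpoly S a z s = (\<Sum>n\<in>S. a n * mon n z * exp (- s * of_real (ln (real n))))"

definition deriv_coeffs :: "(nat \<Rightarrow> complex) \<Rightarrow> nat \<Rightarrow> complex" where
  "deriv_coeffs a n = - of_real (ln (real n)) * a n"

lemma dpoly_0: "dpoly S a z 0 = tpoly S a z"
  by (simp add: dpoly_def tpoly_def)

lemma norm_exp_ln_le: "Re s \<ge> 0 \<Longrightarrow> norm (exp (- s * of_real (ln (real n)))) \<le> 1"
  by (cases "n = 0") simp_all

lemma norm_dpoly_le:
  assumes "z \<in> space torus_measure" "Re s \<ge> 0"
  shows "norm (dpoly S a z s) \<le> (\<Sum>n\<in>S. norm (a n))"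
  unfolding dpoly_def
proof (rule sum_norm_le)
  fix n
  show "norm (a n * mon n z * exp (- s * of_real (ln (real n)))) \<le> norm (a n)"
    using mult_left_mono[OF norm_exp_ln_le[OF assms(2), of n], of "norm (a n)"]
    by (simp add: norm_mult norm_mon_torus[OF assms(1)])
qed

lemma DERIV_dpoly: "(dpoly S a z has_field_derivative dpoly S (deriv_coeffs a) z s) (at s)"
  unfolding dpoly_def[abs_def] deriv_coeffs_def
  by (auto intro!: derivative_eq_intros sum.cong simp: algebra_simps)

lemma continuous_on_dpoly: "continuous_on UNIV (dpoly S a z)"
  using DERIV_dpoly by (intro continuous_at_imp_continuous_on ballI) (rule DERIV_isCont)

lemma dpoly_vector_derivative_Re:
  "((\<lambda>t. dpoly S a z (of_real t)) has_vector_derivative dpoly S (deriv_coeffs a) z (of_real t)) (at t)"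
  using field_vector_diff_chain_at[OF bounded_linear.has_vector_derivative[OF bounded_linear_of_real has_vector_derivative_id] DERIV_dpoly]
  by (simp add: o_def)

lemma dpoly_vector_derivative_Im:
  "((\<lambda>t. dpoly S a z (s + \<i> * of_real t)) has_vector_derivative \<i> * dpoly S (deriv_coeffs a) z (s + \<i> * of_real t)) (at t)"
  using field_vector_diff_chain_at[OF has_vector_derivative_add[OF has_vector_derivative_const[of s]
      has_vector_derivative_mult_right[OF bounded_linear.has_vector_derivative[OF bounded_linear_of_real
        has_vector_derivative_id], of \<i>]] DERIV_dpoly]
  by (simp add: o_def)

definition flow :: "real \<Rightarrow> nat \<Rightarrow> complex" where
  "flow t j = of_nat (nth_prime j) powr (- (\<i> * of_real t))"

lemma norm_flow: "norm (flow t j) = 1"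
  unfolding flow_def by (subst norm_powr_real_powr) (auto simp: prime_gt_0_nat)

text \<open>The rotation by \<open>flow t\<close> multiplies the \<open>n\<close>-th term by the
  factor that a vertical translation of \<open>s\<close> produces. Torus averages are therefore
  constant along vertical lines.\<close>

lemma dpoly_flow:
  assumes "0 \<notin> S"
  shows "dpoly S a (\<lambda>j. z j * flow t j) s = dpoly S a z (s + \<i> * of_real t)"
  unfolding dpoly_def
proof (intro sum.cong refl)
  fix n assume "n \<in> S"
  then have n: "n > 0" using assms by (auto intro: gr0I)
  have "mon n (flow t) = exp (- (\<i> * of_real t) * of_real (ln (real n)))"
    unfolding flow_def[abs_def] mon_powr[OF n] using n by (simp add: powr_def Ln_of_nat)
  then show "a n * mon n (\<lambda>j. z j * flow t j) * exp (- s * of_real (ln (real n)))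
      = a n * mon n z * exp (- (s + \<i> * of_real t) * of_real (ln (real n)))"
    using n by (simp add: mon_times algebra_simps exp_add exp_diff flip: exp_add)
qed

text \<open>A bounded interval makes the product with the torus a finite measure, so bounded
  measurable integrands are integrable and Fubini applies freely. The half-line is reached only in
  the explicit formula for the pairing, as the upper end tends to infinity.\<close>

definition ivl :: "real \<Rightarrow> real \<Rightarrow> real measure" where
  "ivl a b = restrict_space lborel {a..b}"

lemma space_ivl: "space (ivl a b) = {a..b}"
  by (simp add: ivl_def)

lemma finite_measure_ivl: "finite_measure (ivl a b)"
  by (rule finite_measureI) (simp add: ivl_def emeasure_restrict_space emeasure_lborel_Icc_eq)

interpretation ivl: finite_measure "ivl a b" for a b
  by (rule finite_measure_ivl)

lemma measurable_ident_ivl [measurable]: "(\<lambda>t. t) \<in> borel_measurable (ivl a b)"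
  unfolding ivl_def by (rule measurable_restrict_space1) simp

lemma measurable_fst_ivl [measurable]: "fst \<in> borel_measurable (ivl a b \<Otimes>\<^sub>M M)"
  by (rule measurable_compose[OF measurable_fst measurable_ident_ivl])

lemma integral_ivl: "(\<integral>t. f t \<partial>ivl a b) = (\<integral>t. f t * indicator {a..b} t \<partial>lborel)" for f :: "real \<Rightarrow> real"
  unfolding ivl_def by (subst integral_restrict_space) (auto simp: mult.commute)

lemma integral_ivl_FTC:
  fixes f :: "real \<Rightarrow> real"
  assumes "a \<le> b" "\<And>x. (F has_real_derivative f x) (at x)" "continuous_on UNIV f"
  shows "(\<integral>t. f t \<partial>ivl a b) = F b - F a"
  unfolding integral_ivl using assms
  by (intro integral_FTC_Icc_real) (auto simp: continuous_on_eq_continuous_at)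

interpretation ivlT: pair_sigma_finite "ivl a b" torus_measure for a b ..

lemma finite_measure_ivlT: "finite_measure (ivl a b \<Otimes>\<^sub>M torus_measure)"
  by (rule finite_measure_pair_measure) unfold_locales

lemma integrable_ivlT:
  fixes F :: "real \<Rightarrow> (nat \<Rightarrow> complex) \<Rightarrow> 'a::{banach, second_countable_topology}"
  assumes "(\<lambda>x. F (fst x) (snd x)) \<in> borel_measurable (ivl a b \<Otimes>\<^sub>M torus_measure)"
    and "\<And>t z. a \<le> t \<Longrightarrow> t \<le> b \<Longrightarrow> z \<in> space torus_measure \<Longrightarrow> norm (F t z) \<le> B"
  shows "integrable (ivl a b \<Otimes>\<^sub>M torus_measure) (\<lambda>(t, z). F t z)"
  using assms by (intro finite_measure.integrable_const_bound[OF finite_measure_ivlT, where B = B])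
    (auto simp: space_pair_measure space_ivl case_prod_beta)

lemma measurable_dpoly [measurable (raw)]:
  assumes "f \<in> M \<rightarrow>\<^sub>M torus_measure" "g \<in> borel_measurable M"
  shows "(\<lambda>x. dpoly S a (f x) (g x)) \<in> borel_measurable M"
proof -
  have [measurable]: "(\<lambda>x. mon n (f x)) \<in> borel_measurable M" for n
    by (rule measurable_compose[OF assms(1) measurable_mon])
  show ?thesis unfolding dpoly_def using assms(2) by measurable
qed

lemma integral_flow:
  fixes F :: "(nat \<Rightarrow> complex) \<Rightarrow> real"
  assumes "F \<in> borel_measurable torus_measure"
  shows "(\<integral>z. F (\<lambda>j. z j * flow t j) \<partial>torus_measure) = (\<integral>z. F z \<partial>torus_measure)"
  by (rule integral_torus_rotate[OF norm_flow assms])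

lemma continuous_on_qs [continuous_intros]: "continuous_on A f \<Longrightarrow> continuous_on A (\<lambda>x. qs \<epsilon> (f x))"
  unfolding qs_def by (intro continuous_intros)

lemma continuous_on_qs2:
  assumes "\<epsilon> > 0" "continuous_on A f" "continuous_on A g" "continuous_on A h"
  shows "continuous_on A (\<lambda>x. qs2 \<epsilon> (f x) (g x) (h x))"
  unfolding qs2_def using assms(2-4)
  by (intro continuous_intros) (use qs_pos[OF assms(1)] in \<open>auto simp: less_le\<close>)

lemma continuous_dpoly_compose: "continuous_on A f \<Longrightarrow> continuous_on A (\<lambda>x. dpoly S a z (f x))"
  by (rule continuous_on_compose2[OF continuous_on_dpoly]) auto

text \<open>The torus means of the first derivative \<open>X t\<close> and of the second derivative
  \<open>B t\<close> do not depend on \<open>t\<close>. Integrating \<open>B\<close> over a unit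
  length of the flow therefore gives the mean of \<open>B 0\<close> on the one hand and the
  difference of two equal means on the other.\<close>

lemma integral_vertical_second_derivative:
  assumes \<epsilon>: "\<epsilon> > 0" and S: "0 \<notin> S" and \<sigma>: "\<sigma> \<ge> 0"
  shows "(\<integral>z. qs2 \<epsilon> (dpoly S a z (of_real \<sigma>)) (\<i> * dpoly S (deriv_coeffs a) z (of_real \<sigma>)) (- dpoly S (deriv_coeffs (deriv_coeffs a)) z (of_real \<sigma>)) \<partial>torus_measure) = 0"
proof -
  let ?M = torus_measure
  define s where "s = (\<lambda>t::real. of_real \<sigma> + \<i> * of_real t :: complex)"
  define B where "B = (\<lambda>t z. qs2 \<epsilon> (dpoly S a z (s t)) (\<i> * dpoly S (deriv_coeffs a) z (s t)) (- dpoly S (deriv_coeffs (deriv_coeffs a)) z (s t)))"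
  define X where "X = (\<lambda>t z. qs1 \<epsilon> (dpoly S a z (s t)) (\<i> * dpoly S (deriv_coeffs a) z (s t)))"
  have s_meas [measurable]: "s \<in> borel_measurable borel" unfolding s_def by measurable
  have [measurable]: "B t \<in> borel_measurable ?M" "X t \<in> borel_measurable ?M" for t
    unfolding B_def X_def by measurable
  have Bz: "(\<integral>z. B t z \<partial>?M) = (\<integral>z. B 0 z \<partial>?M)" for t
    using integral_flow[of "B 0" t] by (simp add: B_def dpoly_flow[OF S] s_def)
  have Xz: "(\<integral>z. X t z \<partial>?M) = (\<integral>z. X 0 z \<partial>?M)" for t
    using integral_flow[of "X 0" t] by (simp add: X_def dpoly_flow[OF S] s_def)
  let ?n1 = "\<Sum>n\<in>S. norm (deriv_coeffs a n)" and ?n2 = "\<Sum>n\<in>S. norm (deriv_coeffs (deriv_coeffs a) n)"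
  have Re_s: "Re (s t) \<ge> 0" for t using \<sigma> by (simp add: s_def)
  have B_le: "norm (B t z) \<le> 2 * ?n1\<^sup>2 / sqrt \<epsilon> + ?n2" if "z \<in> space ?M" for t z
  proof -
    have "norm (B t z) \<le> 2 * (norm (dpoly S (deriv_coeffs a) z (s t)))\<^sup>2 / sqrt \<epsilon> + norm (dpoly S (deriv_coeffs (deriv_coeffs a)) z (s t))"
      using abs_qs2_le[OF \<epsilon>, of "dpoly S a z (s t)" "\<i> * dpoly S (deriv_coeffs a) z (s t)" "- dpoly S (deriv_coeffs (deriv_coeffs a)) z (s t)"]
      by (simp add: B_def norm_mult)
    also have "\<dots> \<le> 2 * ?n1\<^sup>2 / sqrt \<epsilon> + ?n2"
      using \<epsilon> by (intro add_mono divide_right_mono mult_left_mono power_mono norm_dpoly_le that Re_s) auto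
    finally show ?thesis .
  qed
  have X_le: "norm (X t z) \<le> ?n1" if "z \<in> space ?M" for t z
    using abs_qs1_le[OF \<epsilon>, of "dpoly S a z (s t)" "\<i> * dpoly S (deriv_coeffs a) z (s t)"] norm_dpoly_le[OF that Re_s, of S "deriv_coeffs a" t]
    by (simp add: X_def norm_mult)
  have intX: "integrable ?M (X t)" for t
    by (rule integrable_torus_bounded[OF _ X_le]) measurable
  have intB: "integrable (ivl 0 1 \<Otimes>\<^sub>M ?M) (\<lambda>(t, z). B t z)"
    by (rule integrable_ivlT[OF _ B_le]) (simp_all add: B_def s_def)
  have inner: "(\<integral>t. B t z \<partial>ivl 0 1) = X 1 z - X 0 z" for z
  proof (rule integral_ivl_FTC)
    fix t
    have "((\<lambda>t. \<i> * dpoly S (deriv_coeffs a) z (s t)) has_vector_derivative \<i> * (\<i> * dpoly S (deriv_coeffs (deriv_coeffs a)) z (s t))) (at t)"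
      unfolding s_def by (intro has_vector_derivative_mult_right dpoly_vector_derivative_Im)
    then have d2: "((\<lambda>t. \<i> * dpoly S (deriv_coeffs a) z (s t)) has_vector_derivative - dpoly S (deriv_coeffs (deriv_coeffs a)) z (s t)) (at t)"
      by simp
    have d1: "((\<lambda>t. dpoly S a z (s t)) has_vector_derivative \<i> * dpoly S (deriv_coeffs a) z (s t)) (at t)"
      unfolding s_def by (rule dpoly_vector_derivative_Im)
    show "((\<lambda>t. X t z) has_real_derivative B t z) (at t)"
      unfolding X_def B_def by (rule DERIV_qs1[OF \<epsilon> d1 d2])
  next
    show "continuous_on UNIV (\<lambda>t. B t z)"
      unfolding B_def s_def by (intro continuous_on_qs2[OF \<epsilon>] continuous_intros continuous_dpoly_compose)
  qed simp
  have "(\<integral>z. (\<integral>t. B t z \<partial>ivl 0 1) \<partial>?M) = (\<integral>t. (\<integral>z. B t z \<partial>?M) \<partial>ivl 0 1)"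
    by (rule ivlT.Fubini_integral[OF intB])
  also have "\<dots> = (\<integral>t. (\<integral>z. B 0 z \<partial>?M) \<partial>ivl 0 1)"
    by (rule Bochner_Integration.integral_cong[OF refl Bz])
  also have "\<dots> = (\<integral>z. B 0 z \<partial>?M)"
    by (subst integral_ivl_FTC[where F = "\<lambda>t. t * (\<integral>z. B 0 z \<partial>?M)"]) (auto intro!: derivative_eq_intros)
  finally have "(\<integral>z. B 0 z \<partial>?M) = (\<integral>z. X 1 z - X 0 z \<partial>?M)"
    by (simp only: inner)
  also have "\<dots> = 0"
    using Xz[of 1] intX by (simp add: Bochner_Integration.integral_diff)
  finally show ?thesis by (simp add: B_def s_def)
qed

text \<open>Only the horizontal part of the Laplacian remains on the right, because the vertical
  part has mean 0 at every height. The inequality is applied with weight 1, for monotonicity, and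
  with weight \<open>t\<close>, for the square function.\<close>

lemma hardy_stein_weighted:
  assumes \<epsilon>: "\<epsilon> > 0" and S: "0 \<notin> S" and c: "0 \<le> c"
    and w: "continuous_on UNIV w" "\<And>t. c \<le> t \<Longrightarrow> t \<le> d \<Longrightarrow> 0 \<le> w t \<and> w t \<le> W"
  shows "(\<integral>(t, z). w t * ((norm (dpoly S (deriv_coeffs a) z (of_real t)))\<^sup>2 / qs \<epsilon> (dpoly S a z (of_real t))) \<partial>(ivl c d \<Otimes>\<^sub>M torus_measure))
    \<le> (\<integral>z. (\<integral>t. w t * qs2 \<epsilon> (dpoly S a z (of_real t)) (dpoly S (deriv_coeffs a) z (of_real t)) (dpoly S (deriv_coeffs (deriv_coeffs a)) z (of_real t)) \<partial>ivl c d) \<partial>torus_measure)"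
proof -
  let ?M = torus_measure and ?P = "ivl c d \<Otimes>\<^sub>M torus_measure"
  define D where "D = (\<lambda>t z. w t * ((norm (dpoly S (deriv_coeffs a) z (of_real t)))\<^sup>2 / qs \<epsilon> (dpoly S a z (of_real t))))"
  define H where "H = (\<lambda>t z. w t * qs2 \<epsilon> (dpoly S a z (of_real t)) (dpoly S (deriv_coeffs a) z (of_real t)) (dpoly S (deriv_coeffs (deriv_coeffs a)) z (of_real t)))"
  define V where "V = (\<lambda>t z. w t * qs2 \<epsilon> (dpoly S a z (of_real t)) (\<i> * dpoly S (deriv_coeffs a) z (of_real t)) (- dpoly S (deriv_coeffs (deriv_coeffs a)) z (of_real t)))"
  let ?n1 = "\<Sum>n\<in>S. norm (deriv_coeffs a n)" and ?n2 = "\<Sum>n\<in>S. norm (deriv_coeffs (deriv_coeffs a) n)"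
  let ?B = "2 * ?n1\<^sup>2 / sqrt \<epsilon> + ?n2"
  have [measurable]: "w \<in> borel_measurable borel"
    using w(1) by (rule borel_measurable_continuous_onI)
  have n1: "norm (dpoly S (deriv_coeffs a) z (of_real t)) \<le> ?n1" and n2: "norm (dpoly S (deriv_coeffs (deriv_coeffs a)) z (of_real t)) \<le> ?n2"
    if "c \<le> t" "z \<in> space ?M" for t z
    using that c by (auto intro!: norm_dpoly_le)
  have bound: "2 * x\<^sup>2 / sqrt \<epsilon> + y \<le> ?B" if "0 \<le> x" "x \<le> ?n1" "y \<le> ?n2" for x y
    using that \<epsilon> by (intro add_mono divide_right_mono mult_left_mono power_mono) auto
  have wB: "norm (w t * x) \<le> W * ?B" if "c \<le> t" "t \<le> d" "\<bar>x\<bar> \<le> ?B" for t x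
    unfolding norm_mult using w(2)[OF that(1,2)] that(3)
    by (intro mult_mono) auto
  have intD: "integrable ?P (\<lambda>(t, z). D t z)"
  proof (rule integrable_ivlT[where B = "W * ?B"])
    show "(\<lambda>x. D (fst x) (snd x)) \<in> borel_measurable ?P" unfolding D_def by measurable
    fix t z assume *: "c \<le> t" "t \<le> d" "z \<in> space ?M"
    let ?u = "dpoly S (deriv_coeffs a) z (of_real t)" and ?q = "qs \<epsilon> (dpoly S a z (of_real t))"
    have "(norm ?u)\<^sup>2 / ?q \<le> (norm ?u)\<^sup>2 / sqrt \<epsilon>"
      using \<epsilon> sqrt_le_qs[OF \<epsilon>] qs_pos[OF \<epsilon>] by (intro divide_left_mono) auto
    also have "\<dots> \<le> 2 * (norm ?u)\<^sup>2 / sqrt \<epsilon> + 0"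
      using \<epsilon> by (simp add: divide_right_mono)
    also have "\<dots> \<le> ?B"
      using n1[OF *(1,3)] by (intro bound) (auto intro: sum_nonneg)
    finally show "norm (D t z) \<le> W * ?B"
      unfolding D_def using * qs_pos[OF \<epsilon>, of "dpoly S a z (of_real t)"] by (intro wB) auto
  qed
  have intH: "integrable ?P (\<lambda>(t, z). H t z)"
  proof (rule integrable_ivlT[where B = "W * ?B"])
    show "(\<lambda>x. H (fst x) (snd x)) \<in> borel_measurable ?P" unfolding H_def by measurable
    fix t z assume *: "c \<le> t" "t \<le> d" "z \<in> space ?M"
    show "norm (H t z) \<le> W * ?B"
      unfolding H_def using * n1 n2 by (intro wB order_trans[OF abs_qs2_le[OF \<epsilon>] bound]) auto
  qed
  have intV: "integrable ?P (\<lambda>(t, z). V t z)"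
  proof (rule integrable_ivlT[where B = "W * ?B"])
    show "(\<lambda>x. V (fst x) (snd x)) \<in> borel_measurable ?P" unfolding V_def by measurable
    fix t z assume *: "c \<le> t" "t \<le> d" "z \<in> space ?M"
    show "norm (V t z) \<le> W * ?B"
      unfolding V_def using * n1 n2 by (intro wB order_trans[OF abs_qs2_le[OF \<epsilon>] bound]) (auto simp: norm_mult)
  qed
  have "(\<integral>(t, z). V t z \<partial>?P) = (\<integral>t. (\<integral>z. V t z \<partial>?M) \<partial>ivl c d)"
    using ivlT.integral_fst'[OF intV] by simp
  also have "\<dots> = (\<integral>t. 0 \<partial>ivl c d)"
    using c by (intro Bochner_Integration.integral_cong refl)
      (simp add: V_def space_ivl integral_vertical_second_derivative[OF \<epsilon> S])
  finally have V0: "(\<integral>(t, z). V t z \<partial>?P) = 0" by simp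
  have "(\<integral>(t, z). D t z \<partial>?P) \<le> (\<integral>x. (case x of (t, z) \<Rightarrow> H t z) + (case x of (t, z) \<Rightarrow> V t z) \<partial>?P)"
  proof (rule integral_mono[OF intD Bochner_Integration.integrable_add[OF intH intV]])
    fix x assume "x \<in> space ?P"
    then obtain t z where x: "x = (t, z)" "c \<le> t" "t \<le> d"
      by (auto simp: space_pair_measure space_ivl)
    show "(case x of (t, z) \<Rightarrow> D t z) \<le> (case x of (t, z) \<Rightarrow> H t z) + (case x of (t, z) \<Rightarrow> V t z)"
      using mult_left_mono[OF laplacian_qs_ge[OF \<epsilon>], of "w t"] w(2)[OF x(2,3)]
      unfolding x D_def H_def V_def by (simp add: distrib_left)
  qed
  also have "\<dots> = (\<integral>(t, z). H t z \<partial>?P)"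
    using Bochner_Integration.integral_add[OF intH intV] V0 by simp
  also have "\<dots> = (\<integral>z. (\<integral>t. H t z \<partial>ivl c d) \<partial>?M)"
    using ivlT.integral_snd[OF intH] by simp
  finally show ?thesis unfolding D_def H_def .
qed

lemma integrable_qs1_dpoly:
  assumes "\<epsilon> > 0" "t \<ge> 0"
  shows "integrable torus_measure (\<lambda>z. qs1 \<epsilon> (dpoly S a z (of_real t)) (dpoly S (deriv_coeffs a) z (of_real t)))"
proof (rule integrable_torus_bounded)
  fix z assume "z \<in> space torus_measure"
  then show "norm (qs1 \<epsilon> (dpoly S a z (of_real t)) (dpoly S (deriv_coeffs a) z (of_real t))) \<le> (\<Sum>n\<in>S. norm (deriv_coeffs a n))"
    using order_trans[OF abs_qs1_le[OF assms(1)] norm_dpoly_le] assms(2) by simp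
qed measurable

lemma integrable_qs_dpoly:
  assumes "\<epsilon> > 0" "t \<ge> 0"
  shows "integrable torus_measure (\<lambda>z. qs \<epsilon> (dpoly S a z (of_real t)))"
proof (rule integrable_torus_bounded)
  fix z assume "z \<in> space torus_measure"
  then show "norm (qs \<epsilon> (dpoly S a z (of_real t))) \<le> (\<Sum>n\<in>S. norm (a n)) + sqrt \<epsilon>"
    using qs_le[OF assms(1), of "dpoly S a z (of_real t)"] norm_dpoly_le[of z "of_real t" S a] assms(2) qs_pos[OF assms(1), of "dpoly S a z (of_real t)"]
    by simp
qed measurable

text \<open>With weight 1 the preceding inequality makes the mean of the horizontal derivative
  nondecreasing in the height; it is dominated by a null sequence far out, so it is nowhere
  positive.\<close>

lemma integral_qs1_nonpos:
  assumes \<epsilon>: "\<epsilon> > 0" and S: "finite S" "0 \<notin> S" and b: "b \<ge> 0"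
  shows "(\<integral>z. qs1 \<epsilon> (dpoly S a z (of_real b)) (dpoly S (deriv_coeffs a) z (of_real b)) \<partial>torus_measure) \<le> 0"
proof (rule LIMSEQ_le_const)
  let ?M = torus_measure
  define X where "X = (\<lambda>t z. qs1 \<epsilon> (dpoly S a z (of_real t)) (dpoly S (deriv_coeffs a) z (of_real t)))"
  \<comment> \<open>Majorises the derivative at height \<open>b + k\<close>; the term
    \<open>n = 1\<close>, whose exponential does not decay, carries the factor
    \<open>ln 1 = 0\<close>.\<close>
  define r where "r = (\<lambda>k::nat. \<Sum>n\<in>S. norm (a n) * (ln (real n) * exp (- (b + real k) * ln (real n))))"
  have E: "ln (real n) * exp (- (b + real k) * ln (real n)) = ln (real n) * (exp (- b * ln (real n)) * exp (- ln (real n)) ^ k)" for n k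
  proof -
    have "exp (- (b + real k) * L) = exp (- b * L) * exp (- L) ^ k" for L
      by (simp add: algebra_simps flip: exp_of_nat_mult exp_add)
    then show ?thesis by simp
  qed
  have "(\<lambda>k. ln (real n) * (exp (- b * ln (real n)) * exp (- ln (real n)) ^ k)) \<longlonglongrightarrow> 0" if "n \<in> S" for n
  proof (cases "n = 1")
    case False
    then have "ln (real n) > 0" using that S(2) by (metis One_nat_def gr0I ln_gt_zero nat_neq_iff less_one of_nat_1 of_nat_less_iff)
    then have "(\<lambda>k. exp (- ln (real n)) ^ k) \<longlonglongrightarrow> 0" by (intro LIMSEQ_realpow_zero) auto
    then show ?thesis by (intro tendsto_mult_right_zero)
  qed simp
  then show "r \<longlonglongrightarrow> 0"
    unfolding r_def E by (rule tendsto_null_sum[OF tendsto_mult_right_zero])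
  have le: "(\<integral>z. X b z \<partial>?M) \<le> r k" for k
  proof -
    define d where "d = b + real k"
    have bd: "b \<le> d" "0 \<le> d" using b by (auto simp: d_def)
    have inner: "(\<integral>t. 1 * qs2 \<epsilon> (dpoly S a z (of_real t)) (dpoly S (deriv_coeffs a) z (of_real t)) (dpoly S (deriv_coeffs (deriv_coeffs a)) z (of_real t)) \<partial>ivl b d)
        = X d z - X b z" for z
    proof (rule integral_ivl_FTC[OF bd(1)])
      show "((\<lambda>t. X t z) has_real_derivative 1 * qs2 \<epsilon> (dpoly S a z (of_real t)) (dpoly S (deriv_coeffs a) z (of_real t)) (dpoly S (deriv_coeffs (deriv_coeffs a)) z (of_real t))) (at t)" for t
        unfolding X_def mult_1
        by (rule DERIV_qs1[where ?p1.0 = "\<lambda>t. dpoly S (deriv_coeffs a) z (of_real t)", OF \<epsilon>]) (rule dpoly_vector_derivative_Re)+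
      show "continuous_on UNIV (\<lambda>t. 1 * qs2 \<epsilon> (dpoly S a z (of_real t)) (dpoly S (deriv_coeffs a) z (of_real t)) (dpoly S (deriv_coeffs (deriv_coeffs a)) z (of_real t)))"
        by (intro continuous_intros continuous_on_qs2[OF \<epsilon>] continuous_dpoly_compose)
    qed
    have "0 \<le> (\<integral>(t, z). 1 * ((norm (dpoly S (deriv_coeffs a) z (of_real t)))\<^sup>2 / qs \<epsilon> (dpoly S a z (of_real t))) \<partial>(ivl b d \<Otimes>\<^sub>M ?M))"
      using qs_pos[OF \<epsilon>] by (intro Bochner_Integration.integral_nonneg) (auto simp: case_prod_beta less_imp_le)
    also have "\<dots> \<le> (\<integral>z. X d z - X b z \<partial>?M)"
      using hardy_stein_weighted[OF \<epsilon> S(2) b, of "\<lambda>_. 1" d 1 a] unfolding inner by simp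
    also have "\<dots> = (\<integral>z. X d z \<partial>?M) - (\<integral>z. X b z \<partial>?M)"
      unfolding X_def by (intro Bochner_Integration.integral_diff integrable_qs1_dpoly \<epsilon> b bd)
    finally have "(\<integral>z. X b z \<partial>?M) \<le> (\<integral>z. X d z \<partial>?M)" by simp
    also have "\<dots> \<le> (\<integral>z. r k \<partial>?M)"
    proof (rule integral_mono)
      fix z assume z: "z \<in> space ?M"
      have "X d z \<le> norm (dpoly S (deriv_coeffs a) z (of_real d))"
        using abs_qs1_le[OF \<epsilon>] unfolding X_def by (meson abs_le_D1)
      also have "\<dots> \<le> r k"
        unfolding dpoly_def r_def deriv_coeffs_def
      proof (rule sum_norm_le)
        fix n assume "n \<in> S"
        then have "ln (real n) \<ge> 0" using S(2) by (cases n) auto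
        then show "norm (- of_real (ln (real n)) * a n * mon n z * exp (- of_real d * of_real (ln (real n))))
            \<le> norm (a n) * (ln (real n) * exp (- (b + real k) * ln (real n)))"
          by (simp add: norm_mult norm_mon_torus[OF z] d_def)
      qed
      finally show "X d z \<le> r k" .
    qed (auto simp: X_def intro!: integrable_qs1_dpoly \<epsilon> bd)
    finally show ?thesis by (simp add: torus.prob_space)
  qed
  then show "\<exists>N. \<forall>k\<ge>N. (\<integral>z. qs1 \<epsilon> (dpoly S a z (of_real b)) (dpoly S (deriv_coeffs a) z (of_real b)) \<partial>?M) \<le> r k"
    unfolding X_def by blast
qed

text \<open>With weight \<open>t\<close>, integration by parts leaves \<open>b * X b - Q b\<close>
  from the upper end and \<open>Q 0\<close> from the lower one; the mean of \<open>b * X b\<close>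
  has the right sign to be dropped.\<close>

lemma hardy_stein:
  assumes \<epsilon>: "\<epsilon> > 0" and S: "finite S" "0 \<notin> S" and b: "b \<ge> 0"
  shows "(\<integral>(t, z). t * ((norm (dpoly S (deriv_coeffs a) z (of_real t)))\<^sup>2 / qs \<epsilon> (dpoly S a z (of_real t))) \<partial>(ivl 0 b \<Otimes>\<^sub>M torus_measure))
    + (\<integral>z. qs \<epsilon> (dpoly S a z (of_real b)) \<partial>torus_measure) \<le> (\<integral>z. qs \<epsilon> (tpoly S a z) \<partial>torus_measure)"
proof -
  let ?M = torus_measure
  define Q where "Q = (\<lambda>t z. qs \<epsilon> (dpoly S a z (of_real t)))"
  define X where "X = (\<lambda>t z. qs1 \<epsilon> (dpoly S a z (of_real t)) (dpoly S (deriv_coeffs a) z (of_real t)))"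
  let ?q2 = "\<lambda>t z. qs2 \<epsilon> (dpoly S a z (of_real t)) (dpoly S (deriv_coeffs a) z (of_real t)) (dpoly S (deriv_coeffs (deriv_coeffs a)) z (of_real t))"
  have inner: "(\<integral>t. t * ?q2 t z \<partial>ivl 0 b) = (b * X b z - Q b z) - (0 * X 0 z - Q 0 z)" for z
  proof (rule integral_ivl_FTC[OF b])
    fix t
    have "((\<lambda>t. X t z) has_real_derivative ?q2 t z) (at t)"
      unfolding X_def
      by (rule DERIV_qs1[where ?p1.0 = "\<lambda>t. dpoly S (deriv_coeffs a) z (of_real t)", OF \<epsilon>]) (rule dpoly_vector_derivative_Re)+
    moreover have "((\<lambda>t. Q t z) has_real_derivative X t z) (at t)"
      unfolding X_def Q_def by (rule DERIV_qs[OF \<epsilon> dpoly_vector_derivative_Re])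
    ultimately show "((\<lambda>t. t * X t z - Q t z) has_real_derivative t * ?q2 t z) (at t)"
      by (auto intro!: derivative_eq_intros)
  next
    show "continuous_on UNIV (\<lambda>t. t * ?q2 t z)"
      by (intro continuous_intros continuous_on_qs2[OF \<epsilon>] continuous_dpoly_compose)
  qed
  have intX: "integrable ?M (X b)" and intQ: "integrable ?M (Q b)" "integrable ?M (Q 0)"
    unfolding X_def Q_def using integrable_qs1_dpoly[OF \<epsilon> b] integrable_qs_dpoly[OF \<epsilon> b] integrable_qs_dpoly[OF \<epsilon>, of 0] by auto
  have "(\<integral>(t, z). t * ((norm (dpoly S (deriv_coeffs a) z (of_real t)))\<^sup>2 / qs \<epsilon> (dpoly S a z (of_real t))) \<partial>(ivl 0 b \<Otimes>\<^sub>M ?M))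
      \<le> (\<integral>z. b * X b z - Q b z + Q 0 z \<partial>?M)"
    using hardy_stein_weighted[OF \<epsilon> S(2) order_refl, of "\<lambda>t. t" b b a] unfolding inner by simp
  also have "\<dots> = b * (\<integral>z. X b z \<partial>?M) - (\<integral>z. Q b z \<partial>?M) + (\<integral>z. Q 0 z \<partial>?M)"
    using intX intQ by simp
  also have "\<dots> \<le> 0 - (\<integral>z. Q b z \<partial>?M) + (\<integral>z. Q 0 z \<partial>?M)"
    using integral_qs1_nonpos[OF \<epsilon> S b, of a] b by (simp add: X_def mult_nonneg_nonpos)
  finally show ?thesis by (simp add: Q_def dpoly_0)
qed

lemma integrable_norm_dpoly: "t \<ge> 0 \<Longrightarrow> integrable torus_measure (\<lambda>z. norm (dpoly S a z (of_real t)))"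
  by (rule integrable_torus_bounded[where B = "\<Sum>n\<in>S. norm (a n)"]) (auto intro: norm_dpoly_le)

lemma integral_qs_tpoly_le:
  assumes "\<epsilon> > 0"
  shows "(\<integral>z. qs \<epsilon> (tpoly S a z) \<partial>torus_measure) \<le> l1 (tpoly S a) + sqrt \<epsilon>"
proof -
  have "(\<integral>z. qs \<epsilon> (tpoly S a z) \<partial>torus_measure) \<le> (\<integral>z. norm (tpoly S a z) + sqrt \<epsilon> \<partial>torus_measure)"
    using integrable_qs_dpoly[OF assms, of 0 S a] integrable_tpoly
    by (intro integral_mono) (auto simp: dpoly_0 qs_le[OF assms])
  also have "\<dots> = l1 (tpoly S a) + sqrt \<epsilon>"
    using integrable_tpoly by (simp add: l1_def torus.prob_space)
  finally show ?thesis .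
qed

lemma square_function_le:
  assumes \<epsilon>: "\<epsilon> > 0" and S: "finite S" "0 \<notin> S" and b: "b \<ge> 0"
  shows "(\<integral>(t, z). t * ((norm (dpoly S (deriv_coeffs a) z (of_real t)))\<^sup>2 / qs \<epsilon> (dpoly S a z (of_real t))) \<partial>(ivl 0 b \<Otimes>\<^sub>M torus_measure))
    \<le> l1 (tpoly S a) + sqrt \<epsilon>"
proof -
  have "(\<integral>z. qs \<epsilon> (dpoly S a z (of_real b)) \<partial>torus_measure) \<ge> 0"
    using qs_pos[OF \<epsilon>] by (intro Bochner_Integration.integral_nonneg) (auto simp: less_imp_le)
  then show ?thesis
    using hardy_stein[OF assms, of a] integral_qs_tpoly_le[OF \<epsilon>, of S a] by linarith
qed

text \<open>The same inequality with the square function dropped in place of the boundary term;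
  smoothing by \<open>\<delta>\<^sup>2\<close> costs only \<open>\<delta>\<close>.\<close>

lemma l1_dpoly_le:
  assumes S: "finite S" "0 \<notin> S" and b: "b \<ge> 0"
  shows "(\<integral>z. norm (dpoly S a z (of_real b)) \<partial>torus_measure) \<le> l1 (tpoly S a)"
proof (rule field_le_epsilon)
  fix \<delta> :: real assume "\<delta> > 0"
  then have \<epsilon>: "\<delta>\<^sup>2 > 0" and sq: "sqrt (\<delta>\<^sup>2) = \<delta>" by auto
  have "(\<integral>z. norm (dpoly S a z (of_real b)) \<partial>torus_measure) \<le> (\<integral>z. qs (\<delta>\<^sup>2) (dpoly S a z (of_real b)) \<partial>torus_measure)"
    by (intro integral_mono integrable_norm_dpoly b integrable_qs_dpoly \<epsilon> norm_le_qs)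
  moreover have "0 \<le> (\<integral>(t, z). t * ((norm (dpoly S (deriv_coeffs a) z (of_real t)))\<^sup>2 / qs (\<delta>\<^sup>2) (dpoly S a z (of_real t))) \<partial>(ivl 0 b \<Otimes>\<^sub>M torus_measure))"
    using qs_pos[OF \<epsilon>] by (intro Bochner_Integration.integral_nonneg)
      (auto simp: less_imp_le space_pair_measure space_ivl intro!: mult_nonneg_nonneg divide_nonneg_nonneg)
  ultimately show "(\<integral>z. norm (dpoly S a z (of_real b)) \<partial>torus_measure) \<le> l1 (tpoly S a) + \<delta>"
    using hardy_stein[OF \<epsilon> S b, of a] integral_qs_tpoly_le[OF \<epsilon>, of S a] unfolding sq by linarith
qed

section \<open>The Carleson measure estimate\<close>

text \<open>The integral of |f| against the candidate Carleson measure with density t |g'|^2, cut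
  off at height \<open>b\<close>. The bound finally proved for it does not depend on
  \<open>b\<close>.\<close>

definition carleson :: "nat set \<Rightarrow> (nat \<Rightarrow> complex) \<Rightarrow> real \<Rightarrow> nat set \<Rightarrow> (nat \<Rightarrow> complex) \<Rightarrow> real" where
  "carleson T \<beta> b S a = (\<integral>(t, z). t * (norm (dpoly S a z (of_real t)) * (norm (dpoly T (deriv_coeffs \<beta>) z (of_real t)))\<^sup>2) \<partial>(ivl 0 b \<Otimes>\<^sub>M torus_measure))"

lemma integrable_carleson:
  "integrable (ivl 0 b \<Otimes>\<^sub>M torus_measure)
    (\<lambda>(t, z). t * (norm (dpoly S a z (of_real t)) * (norm (dpoly T (deriv_coeffs \<beta>) z (of_real t)))\<^sup>2))"
proof (rule integrable_ivlT)
  fix t z assume *: "0 \<le> t" "t \<le> b" "z \<in> space torus_measure"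
  then show "norm (t * (norm (dpoly S a z (of_real t)) * (norm (dpoly T (deriv_coeffs \<beta>) z (of_real t)))\<^sup>2))
      \<le> b * ((\<Sum>n\<in>S. norm (a n)) * (\<Sum>n\<in>T. norm (deriv_coeffs \<beta> n))\<^sup>2)"
    unfolding real_norm_def abs_mult abs_norm_cancel abs_power2
    by (intro mult_mono power_mono norm_dpoly_le) (auto intro!: mult_nonneg_nonneg sum_nonneg)
qed measurable

lemma integrable_energy:
  "integrable (ivl 0 b \<Otimes>\<^sub>M torus_measure) (\<lambda>(t, z). t * (norm (dpoly T (deriv_coeffs \<beta>) z (of_real t)))\<^sup>2)"
proof (rule integrable_ivlT)
  fix t z assume *: "0 \<le> t" "t \<le> b" "z \<in> space torus_measure"
  then show "norm (t * (norm (dpoly T (deriv_coeffs \<beta>) z (of_real t)))\<^sup>2) \<le> b * (\<Sum>n\<in>T. norm (deriv_coeffs \<beta> n))\<^sup>2"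
    unfolding real_norm_def abs_mult abs_norm_cancel abs_power2
    by (intro mult_mono power_mono norm_dpoly_le) auto
qed measurable

lemma integrable_square_function:
  assumes \<epsilon>: "\<epsilon> > 0"
  shows "integrable (ivl 0 b \<Otimes>\<^sub>M torus_measure)
    (\<lambda>(t, z). t * ((norm (dpoly S (deriv_coeffs a) z (of_real t)))\<^sup>2 / qs \<epsilon> (dpoly S a z (of_real t))))"
proof (rule integrable_ivlT)
  fix t z assume *: "0 \<le> t" "t \<le> b" "z \<in> space torus_measure"
  have "(norm (dpoly S (deriv_coeffs a) z (of_real t)))\<^sup>2 / qs \<epsilon> (dpoly S a z (of_real t)) \<le> (\<Sum>n\<in>S. norm (deriv_coeffs a n))\<^sup>2 / sqrt \<epsilon>"
    using * \<epsilon> sqrt_le_qs[OF \<epsilon>] by (intro frac_le power_mono norm_dpoly_le) (auto intro!: sum_nonneg)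
  moreover have "(norm (dpoly S (deriv_coeffs a) z (of_real t)))\<^sup>2 / qs \<epsilon> (dpoly S a z (of_real t)) \<ge> 0"
    using qs_pos[OF \<epsilon>] by (simp add: less_imp_le)
  ultimately show "norm (t * ((norm (dpoly S (deriv_coeffs a) z (of_real t)))\<^sup>2 / qs \<epsilon> (dpoly S a z (of_real t))))
      \<le> b * ((\<Sum>n\<in>S. norm (deriv_coeffs a n))\<^sup>2 / sqrt \<epsilon>)"
    using * by (subst real_norm_def, subst abs_of_nonneg) (auto intro!: mult_mono mult_nonneg_nonneg simp del: times_divide_eq_right)
qed measurable

lemma arith_geo_weighted:
  fixes x y q l :: real
  assumes "q > 0" "l > 0"
  shows "x * y \<le> (l * (x\<^sup>2 / q) + q * y\<^sup>2 / l) / 2"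
proof -
  have "0 \<le> (l * x - q * y)\<^sup>2 / (l * q)" using assms by simp
  also have "\<dots> = l * (x\<^sup>2 / q) + q * y\<^sup>2 / l - 2 * (x * y)"
    using assms by (simp add: power2_eq_square field_simps)
  finally show ?thesis by simp
qed

text \<open>Cauchy--Schwarz, linearised by the parameter \<open>l\<close>.\<close>

lemma integral_le_square_function_carleson:
  assumes S: "finite S" "0 \<notin> S" and b: "b \<ge> 0" and l: "l > 0"
  shows "(\<integral>(t, z). t * (norm (dpoly S (deriv_coeffs a) z (of_real t)) * norm (dpoly T (deriv_coeffs \<beta>) z (of_real t))) \<partial>(ivl 0 b \<Otimes>\<^sub>M torus_measure))
    \<le> (l * l1 (tpoly S a) + carleson T \<beta> b S a / l) / 2"
proof -
  let ?P = "ivl 0 b \<Otimes>\<^sub>M torus_measure"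
  define G where "G = (\<integral>(t, z). t * (norm (dpoly T (deriv_coeffs \<beta>) z (of_real t)))\<^sup>2 \<partial>?P)"
  let ?f = "\<lambda>z t. norm (dpoly S a z (of_real t))" and ?f' = "\<lambda>z t. norm (dpoly S (deriv_coeffs a) z (of_real t))"
    and ?g' = "\<lambda>z t. norm (dpoly T (deriv_coeffs \<beta>) z (of_real t))"
  let ?I = "\<integral>(t, z). t * (?f' z t * ?g' z t) \<partial>?P"
  let ?J = "carleson T \<beta> b S a"
  have intI: "integrable ?P (\<lambda>(t, z). t * (?f' z t * ?g' z t))"
  proof (rule integrable_ivlT)
    fix t z assume *: "0 \<le> t" "t \<le> b" "z \<in> space torus_measure"
    then show "norm (t * (?f' z t * ?g' z t)) \<le> b * ((\<Sum>n\<in>S. norm (deriv_coeffs a n)) * (\<Sum>n\<in>T. norm (deriv_coeffs \<beta> n)))"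
      unfolding real_norm_def abs_mult abs_norm_cancel
      by (intro mult_mono norm_dpoly_le) (auto intro!: mult_nonneg_nonneg sum_nonneg)
  qed measurable
  \<comment> \<open>Smoothing with \<open>\<delta>\<^sup>2\<close> replaces |f| by at most |f| +
    \<open>\<delta>\<close>. The surplus is \<open>\<delta>\<close> times a fixed quantity involving
    the energy \<open>G\<close> and disappears in the limit.\<close>
  have *: "?I \<le> (l * l1 (tpoly S a) + ?J / l) / 2 + \<delta> * ((l + G / l) / 2)" if \<delta>: "\<delta> > 0" for \<delta>
  proof -
    have \<epsilon>: "\<delta>\<^sup>2 > 0" and sq: "sqrt (\<delta>\<^sup>2) = \<delta>" using \<delta> by auto
    let ?q = "\<lambda>z t. qs (\<delta>\<^sup>2) (dpoly S a z (of_real t))"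
    let ?A = "\<lambda>(t, z). t * ((?f' z t)\<^sup>2 / ?q z t)"
    let ?B = "\<lambda>(t, z). t * (?f z t * (?g' z t)\<^sup>2)"
    let ?C = "\<lambda>(t, z). t * (?g' z t)\<^sup>2"
    have int: "integrable ?P ?A" "integrable ?P ?B" "integrable ?P ?C"
      by (rule integrable_square_function[OF \<epsilon>] integrable_carleson integrable_energy)+
    have "?I \<le> (\<integral>x. l / 2 * ?A x + (1 / (2 * l) * ?B x + \<delta> / (2 * l) * ?C x) \<partial>?P)"
    proof (rule integral_mono[OF intI])
      show "integrable ?P (\<lambda>x. l / 2 * ?A x + (1 / (2 * l) * ?B x + \<delta> / (2 * l) * ?C x))"
        by (intro Bochner_Integration.integrable_add integrable_mult_right int)
      fix x assume "x \<in> space ?P"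
      then obtain t z where x: "x = (t, z)" "0 \<le> t"
        by (auto simp: space_pair_measure space_ivl)
      have "?f' z t * ?g' z t \<le> (l * ((?f' z t)\<^sup>2 / ?q z t) + ?q z t * (?g' z t)\<^sup>2 / l) / 2"
        by (rule arith_geo_weighted[OF qs_pos[OF \<epsilon>] l])
      also have "\<dots> \<le> (l * ((?f' z t)\<^sup>2 / ?q z t) + (?f z t + \<delta>) * (?g' z t)\<^sup>2 / l) / 2"
        using qs_le[OF \<epsilon>] l unfolding sq by (intro divide_right_mono add_left_mono mult_right_mono) auto
      finally have "t * (?f' z t * ?g' z t) \<le> t * ((l * ((?f' z t)\<^sup>2 / ?q z t) + (?f z t + \<delta>) * (?g' z t)\<^sup>2 / l) / 2)"
        using x(2) by (rule mult_left_mono)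
      also have "\<dots> = l / 2 * ?A x + (1 / (2 * l) * ?B x + \<delta> / (2 * l) * ?C x)"
        using l unfolding x by (simp add: algebra_simps add_divide_distrib)
      finally show "(case x of (t, z) \<Rightarrow> t * (?f' z t * ?g' z t)) \<le> l / 2 * ?A x + (1 / (2 * l) * ?B x + \<delta> / (2 * l) * ?C x)"
        unfolding x by simp
    qed
    also have "\<dots> = l / 2 * (\<integral>x. ?A x \<partial>?P) + (1 / (2 * l) * ?J + \<delta> / (2 * l) * G)"
      unfolding carleson_def G_def
      by (subst Bochner_Integration.integral_add | intro Bochner_Integration.integrable_add integrable_mult_right int
        | simp only: integral_mult_right_zero)+
    also have "\<dots> \<le> l / 2 * (l1 (tpoly S a) + \<delta>) + (1 / (2 * l) * ?J + \<delta> / (2 * l) * G)"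
      using square_function_le[OF \<epsilon> S b, of a] l unfolding sq by (intro add_right_mono mult_left_mono) auto
    also have "\<dots> = (l * l1 (tpoly S a) + ?J / l) / 2 + \<delta> * ((l + G / l) / 2)"
      using l by (simp add: field_simps)
    finally show ?thesis .
  qed
  have "((\<lambda>\<delta>. (l * l1 (tpoly S a) + ?J / l) / 2 + \<delta> * ((l + G / l) / 2))
      \<longlongrightarrow> (l * l1 (tpoly S a) + ?J / l) / 2 + 0 * ((l + G / l) / 2)) (at_right 0)"
    by (intro tendsto_intros)
  then have "((\<lambda>\<delta>. (l * l1 (tpoly S a) + ?J / l) / 2 + \<delta> * ((l + G / l) / 2))
      \<longlongrightarrow> (l * l1 (tpoly S a) + ?J / l) / 2) (at_right 0)" by simp
  then show ?thesis
    by (rule tendsto_lowerbound) (use * in \<open>auto simp: eventually_at_right_field intro!: exI[of _ 1]\<close>)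
qed

text \<open>The Volterra operator with the polynomial symbol \<open>(T, \<beta>)\<close> has norm at most \<open>M\<close> on polynomials. The
  image of \<open>(S, a)\<close> is described as a primitive \<open>(P, c)\<close> of \<open>f g'\<close>.\<close>

definition volterra_bounded :: "nat set \<Rightarrow> (nat \<Rightarrow> complex) \<Rightarrow> real \<Rightarrow> bool" where
  "volterra_bounded T \<beta> M \<longleftrightarrow> (\<forall>S a. finite S \<longrightarrow> 0 \<notin> S \<longrightarrow> (\<exists>P c. finite P \<and> 0 \<notin> P \<and>
     (\<forall>z s. dpoly P (deriv_coeffs c) z s = dpoly S a z s * dpoly T (deriv_coeffs \<beta>) z s) \<and> l1 (tpoly P c) \<le> M * l1 (tpoly S a)))"

text \<open>Starting value for the iteration in \<open>carleson_le\<close>: the derivative of the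
  symbol is bounded by its coefficient sum, and the means of |f| do not exceed their value at height
  0. The iteration removes the dependence on \<open>b\<close> and \<open>\<beta>\<close>.\<close>

lemma carleson_finite:
  assumes S: "finite S" "0 \<notin> S" and b: "b \<ge> 0"
  shows "carleson T \<beta> b S a \<le> b\<^sup>2 * (\<Sum>n\<in>T. norm (deriv_coeffs \<beta> n))\<^sup>2 * l1 (tpoly S a)"
proof -
  let ?M = torus_measure and ?n = "\<Sum>n\<in>T. norm (deriv_coeffs \<beta> n)"
  let ?F = "\<lambda>(t, z). t * (norm (dpoly S a z (of_real t)) * (norm (dpoly T (deriv_coeffs \<beta>) z (of_real t)))\<^sup>2)"
  have "carleson T \<beta> b S a = (\<integral>t. (\<integral>z. ?F (t, z) \<partial>?M) \<partial>ivl 0 b)"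
    unfolding carleson_def using ivlT.integral_fst'[OF integrable_carleson] by simp
  also have "\<dots> \<le> (\<integral>t. b * ?n\<^sup>2 * l1 (tpoly S a) \<partial>ivl 0 b)"
  proof (rule integral_mono)
    show "integrable (ivl 0 b) (\<lambda>t. \<integral>z. ?F (t, z) \<partial>?M)"
      using ivlT.integrable_fst'[OF integrable_carleson] by simp
    fix t assume "t \<in> space (ivl 0 b)"
    then have t: "0 \<le> t" "t \<le> b" by (auto simp: space_ivl)
    have "(\<integral>z. ?F (t, z) \<partial>?M) \<le> (\<integral>z. b * ?n\<^sup>2 * norm (dpoly S a z (of_real t)) \<partial>?M)"
    proof (rule integral_mono)
      show "integrable ?M (\<lambda>z. ?F (t, z))"
      proof (rule integrable_torus_bounded)
        fix z assume z: "z \<in> space ?M"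
        show "norm (?F (t, z)) \<le> b * ((\<Sum>n\<in>S. norm (a n)) * ?n\<^sup>2)"
          unfolding prod.case real_norm_def abs_mult abs_norm_cancel abs_power2 using t z
          by (intro mult_mono power_mono norm_dpoly_le) (auto intro!: mult_nonneg_nonneg sum_nonneg)
      qed (simp add: case_prod_beta)
      show "integrable ?M (\<lambda>z. b * ?n\<^sup>2 * norm (dpoly S a z (of_real t)))"
        by (intro integrable_mult_right integrable_norm_dpoly t)
      fix z assume z: "z \<in> space ?M"
      have "t * (norm (dpoly S a z (of_real t)) * (norm (dpoly T (deriv_coeffs \<beta>) z (of_real t)))\<^sup>2)
          \<le> b * (norm (dpoly S a z (of_real t)) * ?n\<^sup>2)"
        using t z by (intro mult_mono power_mono norm_dpoly_le) auto
      then show "?F (t, z) \<le> b * ?n\<^sup>2 * norm (dpoly S a z (of_real t))" by (simp add: mult_ac)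
    qed
    also have "\<dots> = b * ?n\<^sup>2 * (\<integral>z. norm (dpoly S a z (of_real t)) \<partial>?M)" by simp
    also have "\<dots> \<le> b * ?n\<^sup>2 * l1 (tpoly S a)"
      using l1_dpoly_le[OF S t(1)] b by (intro mult_left_mono) auto
    finally show "(\<integral>z. ?F (t, z) \<partial>?M) \<le> b * ?n\<^sup>2 * l1 (tpoly S a)" .
  qed simp
  also have "\<dots> = b\<^sup>2 * ?n\<^sup>2 * l1 (tpoly S a)"
    using b by (subst integral_ivl_FTC[where F = "\<lambda>t. t * (b * ?n\<^sup>2 * l1 (tpoly S a))"])
      (auto intro!: derivative_eq_intros simp: power2_eq_square)
  finally show ?thesis .
qed

text \<open>An iteration takes the place of the best constant: each Cauchy-Schwarz step with
  parameter \<open>M\<close> halves the excess of the constant over \<open>M\<^sup>2\<close>. The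
  induction is over all polynomials at once because the step passes from \<open>f\<close> to its
  image.\<close>

lemma carleson_le:
  assumes vb: "volterra_bounded T \<beta> M" and M: "M > 0" and b: "b \<ge> 0" and S: "finite S" "0 \<notin> S"
  shows "carleson T \<beta> b S a \<le> M\<^sup>2 * l1 (tpoly S a)"
proof -
  define K where "K = b\<^sup>2 * (\<Sum>n\<in>T. norm (deriv_coeffs \<beta> n))\<^sup>2"
  have step: "carleson T \<beta> b S a \<le> (M\<^sup>2 + K / 2 ^ k) * l1 (tpoly S a)" if "finite S" "0 \<notin> S" for k S a
    using that
  proof (induction k arbitrary: S a)
    case 0
    have "K * l1 (tpoly S a) \<le> (M\<^sup>2 + K / 2 ^ 0) * l1 (tpoly S a)"
      by (intro mult_right_mono l1_nonneg) simp
    then show ?case using carleson_finite[OF 0 b, of T \<beta> a] unfolding K_def by linarith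
  next
    case (Suc k)
    obtain P c where P: "finite P" "0 \<notin> P" and P': "\<And>z s. dpoly P (deriv_coeffs c) z s = dpoly S a z s * dpoly T (deriv_coeffs \<beta>) z s"
      and le: "l1 (tpoly P c) \<le> M * l1 (tpoly S a)"
      using vb Suc.prems unfolding volterra_bounded_def by meson
    let ?k = "M\<^sup>2 + K / 2 ^ k"
    have k: "?k \<ge> 0" by (simp add: K_def)
    \<comment> \<open>With h for the image of f this is |f| |g'|^2 = |h'| |g'|.\<close>
    have "carleson T \<beta> b S a = (\<integral>(t, z). t * (norm (dpoly P (deriv_coeffs c) z (of_real t)) * norm (dpoly T (deriv_coeffs \<beta>) z (of_real t))) \<partial>(ivl 0 b \<Otimes>\<^sub>M torus_measure))"
      unfolding carleson_def P' norm_mult by (simp add: power2_eq_square mult.assoc)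
    also have "\<dots> \<le> (M * l1 (tpoly P c) + carleson T \<beta> b P c / M) / 2"
      by (rule integral_le_square_function_carleson[OF P b M])
    also have "\<dots> \<le> (M * l1 (tpoly P c) + ?k * l1 (tpoly P c) / M) / 2"
      using Suc.IH[OF P] M by (intro divide_right_mono add_left_mono) auto
    also have "\<dots> = (M + ?k / M) / 2 * l1 (tpoly P c)"
      by (simp add: algebra_simps add_divide_distrib)
    also have "\<dots> \<le> (M + ?k / M) / 2 * (M * l1 (tpoly S a))"
      using le M k by (intro mult_left_mono) auto
    also have "\<dots> = (M\<^sup>2 + K / 2 ^ Suc k) * l1 (tpoly S a)"
      using M by (simp add: power2_eq_square field_simps)
    finally show ?case .
  qed
  have "carleson T \<beta> b S a \<le> (M\<^sup>2 + K * (1 / 2) ^ k) * l1 (tpoly S a)" for k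
    using step[OF S, of a k] by (simp only: power_one_over times_divide_eq_right mult_1_right)
  moreover have "(\<lambda>k. (M\<^sup>2 + K * (1 / 2) ^ k) * l1 (tpoly S a)) \<longlonglongrightarrow> (M\<^sup>2 + K * 0) * l1 (tpoly S a)"
    by (intro tendsto_intros LIMSEQ_realpow_zero) auto
  ultimately have "carleson T \<beta> b S a \<le> (M\<^sup>2 + K * 0) * l1 (tpoly S a)"
    by (intro LIMSEQ_le_const) blast+
  then show ?thesis by simp
qed

text \<open>At parameter \<open>M\<close> the square function and the Carleson integral contribute
  equal bounds, and their mean is \<open>M * l1 (tpoly S a)\<close>.\<close>

lemma integral_pairing_le:
  assumes vb: "volterra_bounded T \<beta> M" and M: "M > 0" and b: "b \<ge> 0" and S: "finite S" "0 \<notin> S"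
  shows "norm (\<integral>(t, z). of_real t * (dpoly S (deriv_coeffs a) z (of_real t) * cnj (dpoly T (deriv_coeffs \<beta>) z (of_real t))) \<partial>(ivl 0 b \<Otimes>\<^sub>M torus_measure))
    \<le> M * l1 (tpoly S a)"
proof -
  let ?P = "ivl 0 b \<Otimes>\<^sub>M torus_measure"
  have "norm (\<integral>(t, z). of_real t * (dpoly S (deriv_coeffs a) z (of_real t) * cnj (dpoly T (deriv_coeffs \<beta>) z (of_real t))) \<partial>?P)
      \<le> (\<integral>x. norm (case x of (t, z) \<Rightarrow> of_real t * (dpoly S (deriv_coeffs a) z (of_real t) * cnj (dpoly T (deriv_coeffs \<beta>) z (of_real t)))) \<partial>?P)"
    by (rule integral_norm_bound)
  also have "\<dots> = (\<integral>(t, z). t * (norm (dpoly S (deriv_coeffs a) z (of_real t)) * norm (dpoly T (deriv_coeffs \<beta>) z (of_real t))) \<partial>?P)"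
    by (intro Bochner_Integration.integral_cong) (auto simp: norm_mult space_pair_measure space_ivl)
  also have "\<dots> \<le> (M * l1 (tpoly S a) + carleson T \<beta> b S a / M) / 2"
    by (rule integral_le_square_function_carleson[OF S b M])
  also have "\<dots> \<le> (M * l1 (tpoly S a) + M\<^sup>2 * l1 (tpoly S a) / M) / 2"
    using carleson_le[OF assms] M by (intro divide_right_mono add_left_mono) auto
  also have "\<dots> = M * l1 (tpoly S a)" using M by (simp add: power2_eq_square)
  finally show ?thesis .
qed

text \<open>The Littlewood-Paley identity cut off at height \<open>b\<close>. Orthogonality leaves
  the diagonal, where the integral of \<open>t * L\<^sup>2 * exp (- 2 * t * L)\<close> with
  \<open>L = ln n\<close> is elementary; index 1 drops out because differentiation kills
  constants.\<close>

lemma integral_pairing: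
  assumes b: "b \<ge> 0" and S: "finite S" "0 \<notin> S" and T: "finite T" "0 \<notin> T"
  shows "(\<integral>(t, z). of_real t * (dpoly S (deriv_coeffs a) z (of_real t) * cnj (dpoly T (deriv_coeffs \<beta>) z (of_real t))) \<partial>(ivl 0 b \<Otimes>\<^sub>M torus_measure))
    = (\<Sum>n\<in>S \<inter> T - {1}. a n * cnj (\<beta> n) * of_real (1 / 4 - (b * ln (real n) / 2 + 1 / 4) * exp (- 2 * b * ln (real n))))"
proof -
  let ?P = "ivl 0 b \<Otimes>\<^sub>M torus_measure" and ?M = torus_measure
  let ?F = "\<lambda>(t, z). of_real t * (dpoly S (deriv_coeffs a) z (of_real t) * cnj (dpoly T (deriv_coeffs \<beta>) z (of_real t)))"
  let ?L = "\<lambda>n. ln (real n)"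
  have int: "integrable ?P ?F"
  proof (rule integrable_ivlT)
    fix t z assume *: "0 \<le> t" "t \<le> b" "z \<in> space torus_measure"
    then show "norm (of_real t * (dpoly S (deriv_coeffs a) z (of_real t) * cnj (dpoly T (deriv_coeffs \<beta>) z (of_real t)))) \<le> b * ((\<Sum>n\<in>S. norm (deriv_coeffs a n)) * (\<Sum>n\<in>T. norm (deriv_coeffs \<beta> n)))"
      unfolding norm_mult norm_of_real complex_mod_cnj
      by (intro mult_mono norm_dpoly_le) (auto intro!: mult_nonneg_nonneg sum_nonneg)
  qed measurable
  have inner: "(\<integral>z. ?F (t, z) \<partial>?M) = (\<Sum>n\<in>S \<inter> T. a n * cnj (\<beta> n) * of_real (t * (?L n)\<^sup>2 * exp (- 2 * t * ?L n)))" for t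
  proof -
    let ?e = "\<lambda>n. exp (- of_real t * of_real (?L n)) :: complex"
    have "?F (t, z) = (\<Sum>m\<in>S. \<Sum>n\<in>T. (of_real t * (deriv_coeffs a m * ?e m) * cnj (deriv_coeffs \<beta> n * ?e n)) * (mon m z * cnj (mon n z)))" for z
      unfolding dpoly_def prod.case cnj_sum unfolding sum_product unfolding sum_distrib_left
      by (intro sum.cong refl) (simp add: mult_ac)
    then have "(\<integral>z. ?F (t, z) \<partial>?M) = (\<Sum>m\<in>S. \<Sum>n\<in>T. (of_real t * (deriv_coeffs a m * ?e m) * cnj (deriv_coeffs \<beta> n * ?e n)) * (\<integral>z. mon m z * cnj (mon n z) \<partial>?M))"
      by (simp only:) (simp add: Bochner_Integration.integral_sum integrable_mon_cnj_mon)
    also have "\<dots> = (\<Sum>m\<in>S. \<Sum>n\<in>T. if m = n then of_real t * (deriv_coeffs a m * ?e m) * cnj (deriv_coeffs \<beta> n * ?e n) else 0)"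
    proof (intro sum.cong refl)
      fix m n assume "m \<in> S" "n \<in> T"
      then have "m > 0" "n > 0" using S T by (auto intro: gr0I)
      then show "(of_real t * (deriv_coeffs a m * ?e m) * cnj (deriv_coeffs \<beta> n * ?e n)) * (\<integral>z. mon m z * cnj (mon n z) \<partial>?M)
          = (if m = n then of_real t * (deriv_coeffs a m * ?e m) * cnj (deriv_coeffs \<beta> n * ?e n) else 0)"
        by (simp add: integral_mon_cnj_mon)
    qed
    also have "\<dots> = (\<Sum>m\<in>S. if m \<in> T then of_real t * (deriv_coeffs a m * ?e m) * cnj (deriv_coeffs \<beta> m * ?e m) else 0)"
      using T by (intro sum.cong refl) simp
    also have "\<dots> = (\<Sum>n\<in>S \<inter> T. of_real t * (deriv_coeffs a n * ?e n) * cnj (deriv_coeffs \<beta> n * ?e n))"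
      using S by (simp add: sum.If_cases)
    also have "\<dots> = (\<Sum>n\<in>S \<inter> T. a n * cnj (\<beta> n) * of_real (t * (?L n)\<^sup>2 * exp (- 2 * t * ?L n)))"
    proof (intro sum.cong refl)
      fix n
      have "cnj (?e n) = ?e n" by (simp add: exp_cnj)
      moreover have "?e n * ?e n = of_real (exp (- 2 * t * ?L n))"
        by (simp add: mult.assoc flip: exp_add exp_of_real)
      ultimately show "of_real t * (deriv_coeffs a n * ?e n) * cnj (deriv_coeffs \<beta> n * ?e n) = a n * cnj (\<beta> n) * of_real (t * (?L n)\<^sup>2 * exp (- 2 * t * ?L n))"
        unfolding deriv_coeffs_def complex_cnj_mult of_real_mult by (simp add: power2_eq_square mult_ac)
    qed
    finally show ?thesis .
  qed
  have tint: "integrable (ivl 0 b) (\<lambda>t. t * (?L n)\<^sup>2 * exp (- 2 * t * ?L n))" if "n > 0" for n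
  proof (rule ivl.integrable_const_bound[where B = "b * (?L n)\<^sup>2 * 1"])
    have "norm (t * (?L n)\<^sup>2 * exp (- 2 * t * ?L n)) \<le> b * (?L n)\<^sup>2 * 1" if "0 \<le> t" "t \<le> b" for t
      unfolding norm_mult using that \<open>n > 0\<close> b
      by (intro mult_mono) auto
    then show "AE t in ivl 0 b. norm (t * (?L n)\<^sup>2 * exp (- 2 * t * ?L n)) \<le> b * (?L n)\<^sup>2 * 1"
      by (intro AE_I2) (auto simp: space_ivl)
  qed measurable
  have tval: "(\<integral>t. t * (?L n)\<^sup>2 * exp (- 2 * t * ?L n) \<partial>ivl 0 b)
      = (if n = 1 then 0 else 1 / 4 - (b * ?L n / 2 + 1 / 4) * exp (- 2 * b * ?L n))" for n
  proof (cases "n = 1")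
    case False
    have "(\<integral>t. t * (?L n)\<^sup>2 * exp (- 2 * t * ?L n) \<partial>ivl 0 b)
        = (- (b * ?L n / 2 + 1 / 4) * exp (- 2 * b * ?L n)) - (- (0 * ?L n / 2 + 1 / 4) * exp (- 2 * 0 * ?L n))"
    proof (rule integral_ivl_FTC[OF b])
      show "((\<lambda>t. - (t * ?L n / 2 + 1 / 4) * exp (- 2 * t * ?L n)) has_real_derivative t * (?L n)\<^sup>2 * exp (- 2 * t * ?L n)) (at t)" for t
        by (auto intro!: derivative_eq_intros) (simp add: field_simps power2_eq_square)
    qed (intro continuous_intros)
    then show ?thesis using False by (simp add: algebra_simps)
  qed simp
  have "(\<integral>x. ?F x \<partial>?P) = (\<integral>t. (\<integral>z. ?F (t, z) \<partial>?M) \<partial>ivl 0 b)"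
    using ivlT.integral_fst'[OF int] by simp
  also have "\<dots> = (\<Sum>n\<in>S \<inter> T. (\<integral>t. a n * cnj (\<beta> n) * of_real (t * (?L n)\<^sup>2 * exp (- 2 * t * ?L n)) \<partial>ivl 0 b))"
    unfolding inner
  proof (rule Bochner_Integration.integral_sum)
    fix n assume "n \<in> S \<inter> T"
    then have "n > 0" using S by (auto intro: gr0I)
    then show "integrable (ivl 0 b) (\<lambda>t. a n * cnj (\<beta> n) * of_real (t * (?L n)\<^sup>2 * exp (- 2 * t * ?L n)))"
      by (intro integrable_mult_right integrable_of_real tint)
  qed
  also have "\<dots> = (\<Sum>n\<in>S \<inter> T. a n * cnj (\<beta> n) * of_real (if n = 1 then 0 else 1 / 4 - (b * ?L n / 2 + 1 / 4) * exp (- 2 * b * ?L n)))"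
    unfolding integral_mult_right_zero integral_complex_of_real tval ..
  also have "\<dots> = (\<Sum>n\<in>S \<inter> T - {1}. a n * cnj (\<beta> n) * of_real (1 / 4 - (b * ?L n / 2 + 1 / 4) * exp (- 2 * b * ?L n)))"
    by (rule sum.mono_neutral_cong_right) (use S in auto)
  finally show ?thesis .
qed

text \<open>As the cut-off tends to infinity the weights tend to 1/4 for every \<open>n > 1\<close>,
  whence the factor 4. The term at 1 is bounded separately, a Fourier coefficient being at most the
  norm.\<close>

lemma pairing_le:
  assumes vb: "volterra_bounded T \<beta> M" and M: "M > 0" and S: "finite S" "0 \<notin> S" and T: "finite T" "0 \<notin> T"
  shows "norm (\<Sum>n\<in>S \<inter> T. a n * cnj (\<beta> n)) \<le> (norm (\<beta> 1) + 4 * M) * l1 (tpoly S a)"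
proof -
  let ?w = "\<lambda>n k. 1 / 4 - (real k * ln (real n) / 2 + 1 / 4) * exp (- 2 * real k * ln (real n))"
  let ?U = "S \<inter> T - {1}"
  have lim: "(\<lambda>k. \<Sum>n\<in>?U. a n * cnj (\<beta> n) * of_real (?w n k)) \<longlonglongrightarrow> (\<Sum>n\<in>?U. a n * cnj (\<beta> n) * of_real (1 / 4))"
  proof (rule tendsto_sum, rule tendsto_mult_left, rule tendsto_of_real)
    fix n assume "n \<in> ?U"
    then have "n > 1" using S(2) by (metis DiffD1 DiffD2 IntD1 gr0I insertI1 less_one linorder_neqE_nat)
    then have "ln (real n) > 0" by simp
    then show "(\<lambda>k. ?w n k) \<longlonglongrightarrow> 1 / 4" by real_asymp
  qed
  have "norm (\<Sum>n\<in>?U. a n * cnj (\<beta> n) * of_real (?w n k)) \<le> M * l1 (tpoly S a)" for k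
    using integral_pairing_le[OF vb M _ S, of "real k" a] integral_pairing[OF _ S T, of "real k" a \<beta>] by simp
  then have "norm (\<Sum>n\<in>?U. a n * cnj (\<beta> n) * of_real (1 / 4)) \<le> M * l1 (tpoly S a)"
    by (intro LIMSEQ_le_const2[OF tendsto_norm[OF lim]]) auto
  then have "norm (\<Sum>n\<in>?U. a n * cnj (\<beta> n)) / 4 \<le> M * l1 (tpoly S a)"
    by (simp add: norm_divide flip: sum_divide_distrib)
  moreover have "norm (\<Sum>n\<in>S \<inter> T \<inter> {1}. a n * cnj (\<beta> n)) \<le> norm (\<beta> 1) * l1 (tpoly S a)"
  proof (cases "1 \<in> S \<inter> T")
    case True
    then have "norm (a 1) \<le> l1 (tpoly S a)"
      using norm_fourier_coeff_le[OF integrable_tpoly, of S a 1] fourier_coeff_tpoly[OF S, of 1 a] by simp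
    from mult_left_mono[OF this, of "norm (\<beta> 1)"] show ?thesis
      using True by (simp add: norm_mult mult_ac)
  qed (simp add: l1_nonneg)
  moreover have "(\<Sum>n\<in>S \<inter> T. a n * cnj (\<beta> n)) = (\<Sum>n\<in>S \<inter> T \<inter> {1}. a n * cnj (\<beta> n)) + (\<Sum>n\<in>?U. a n * cnj (\<beta> n))"
    using S(1) by (subst sum.union_disjoint[symmetric]) (auto intro!: sum.cong)
  ultimately show ?thesis
    using norm_triangle_ineq[of "\<Sum>n\<in>S \<inter> T \<inter> {1}. a n * cnj (\<beta> n)" "\<Sum>n\<in>?U. a n * cnj (\<beta> n)"]
    by (simp add: algebra_simps)
qed

section \<open>Dirichlet series\<close>

lemma norm_of_nat_powr: "n > 0 \<Longrightarrow> norm (of_nat n powr s :: complex) = real n powr Re s"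
  by (subst norm_powr_real_powr) auto

text \<open>Convergence at \<open>s0\<close> bounds the terms there, and moving right by more than 1
  brings in a summable power of \<open>n\<close>.\<close>

lemma dirichlet_series_abs_summable:
  assumes "has_dirichlet_series f a"
  shows "\<exists>\<theta>. \<forall>\<sigma>>\<theta>. summable (\<lambda>n. norm (a (Suc n)) * real (Suc n) powr - \<sigma>)"
proof -
  obtain \<theta> where \<theta>: "\<And>s. Re s > \<theta> \<Longrightarrow> (\<lambda>n. a (Suc n) * of_nat (Suc n) powr (- s)) sums f s"
    using assms unfolding has_dirichlet_series_def by blast
  define s0 where "s0 = \<theta> + 1"
  have "(\<lambda>n. a (Suc n) * of_nat (Suc n) powr (- of_real s0)) \<longlonglongrightarrow> 0"
    by (rule summable_LIMSEQ_zero, rule sums_summable, rule \<theta>) (simp add: s0_def)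
  then have "Bseq (\<lambda>n. a (Suc n) * of_nat (Suc n) powr (- of_real s0))"
    by (intro convergent_imp_Bseq convergentI)
  then obtain B where B: "\<And>n. norm (a (Suc n) * of_nat (Suc n) powr (- of_real s0)) \<le> B"
    unfolding Bseq_def by blast
  have "summable (\<lambda>n. norm (a (Suc n)) * real (Suc n) powr - \<sigma>)" if \<sigma>: "\<sigma> > s0 + 1" for \<sigma>
  proof (rule summable_comparison_test'[where N = 0])
    have "summable (\<lambda>n. real n powr (s0 - \<sigma>))" using \<sigma> by (simp add: summable_real_powr_iff)
    then show "summable (\<lambda>n. B * real (Suc n) powr (s0 - \<sigma>))"
      by (intro summable_mult) (subst summable_Suc_iff)
    fix n
    have "norm (a (Suc n)) * real (Suc n) powr - \<sigma>
        = norm (a (Suc n) * of_nat (Suc n) powr (- of_real s0)) * real (Suc n) powr (s0 - \<sigma>)"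
      by (simp add: norm_mult norm_of_nat_powr mult.assoc flip: powr_add del: of_nat_Suc)
    also have "\<dots> \<le> B * real (Suc n) powr (s0 - \<sigma>)"
      by (intro mult_right_mono B) simp
    finally show "norm (norm (a (Suc n)) * real (Suc n) powr - \<sigma>) \<le> B * real (Suc n) powr (s0 - \<sigma>)"
      by (simp add: abs_mult)
  qed
  then show ?thesis by blast
qed

lemma has_dirichlet_series_add:
  assumes "has_dirichlet_series f a" "has_dirichlet_series h b"
  shows "has_dirichlet_series (\<lambda>s. f s + h s) (\<lambda>n. a n + b n)"
proof -
  obtain \<theta>1 \<theta>2 where
    "\<And>s. Re s > \<theta>1 \<Longrightarrow> (\<lambda>n. a (Suc n) * of_nat (Suc n) powr (- s)) sums f s"
    "\<And>s. Re s > \<theta>2 \<Longrightarrow> (\<lambda>n. b (Suc n) * of_nat (Suc n) powr (- s)) sums h s"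
    using assms unfolding has_dirichlet_series_def by blast
  then show ?thesis unfolding has_dirichlet_series_def
    by (intro exI[of _ "max \<theta>1 \<theta>2"]) (auto simp: distrib_right intro!: sums_add)
qed

lemma has_dirichlet_series_scale:
  assumes "has_dirichlet_series f a"
  shows "has_dirichlet_series (\<lambda>s. c * f s) (\<lambda>n. c * a n)"
  using assms unfolding has_dirichlet_series_def by (auto simp: mult.assoc intro!: sums_mult)

text \<open>Letting \<open>k\<close> grow isolates the index whose ratio is 1. An index with
  \<open>u j = 0\<close> may have any ratio, which accommodates the vanishing coefficients before
  the leading one.\<close>

lemma geometric_moments_zero_imp_zero:
  fixes u :: "nat \<Rightarrow> complex" and r :: "nat \<Rightarrow> real"
  assumes u: "summable (\<lambda>j. norm (u j))" and r: "r m = 1" "\<rho> < 1"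
    and other: "\<And>j. j \<noteq> m \<Longrightarrow> u j = 0 \<or> (0 \<le> r j \<and> r j \<le> \<rho>)"
    and zero: "\<And>k::nat. (\<lambda>j. u j * of_real (r j ^ k)) sums 0"
  shows "u m = 0"
proof (cases "\<exists>j. j \<noteq> m \<and> u j \<noteq> 0")
  \<comment> \<open>Treated apart, because \<open>\<rho>\<close> is known to be nonnegative only
    when another nonzero term is present.\<close>
  case False
  then have eq: "(\<lambda>j. u j * of_real (r j ^ 0)) = (\<lambda>j. if j = m then u j else 0)"
    by (auto simp: fun_eq_iff)
  have "(\<lambda>j. u j * of_real (r j ^ 0)) sums u m"
    unfolding eq by (rule sums_single)
  then show ?thesis using zero[of 0] sums_unique2 by blast
next
  case True
  then have \<rho>: "\<rho> \<ge> 0" using other by force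
  define U where "U = (\<Sum>j. norm (u j))"
  have le: "norm (u m) \<le> \<rho> ^ k * U" for k
  proof -
    let ?v = "\<lambda>j. if j = m then 0 else u j * of_real (r j ^ k)"
    have "(\<lambda>j. u j * of_real (r j ^ k) - (if j = m then u j else 0)) sums (0 - u m)"
      by (intro sums_diff zero sums_single)
    moreover have "(\<lambda>j. u j * of_real (r j ^ k) - (if j = m then u j else 0)) = ?v"
      by (simp add: fun_eq_iff r)
    ultimately have v: "?v sums (- u m)" by simp
    have vle: "norm (?v j) \<le> \<rho> ^ k * norm (u j)" for j
    proof (cases "j = m \<or> u j = 0")
      case False
      then show ?thesis
        using other[of j] by (auto simp: norm_mult norm_power mult.commute[of "norm (u j)"] intro!: mult_right_mono power_mono)
    qed (use \<rho> in auto)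
    have sm: "summable (\<lambda>j. \<rho> ^ k * norm (u j))" using u by (rule summable_mult)
    have "norm (u m) = norm (suminf ?v)"
      unfolding sums_unique[OF v, symmetric] by simp
    also have "\<dots> \<le> (\<Sum>j. \<rho> ^ k * norm (u j))"
      by (rule norm_suminf_le[OF vle sm])
    also have "\<dots> = \<rho> ^ k * U" unfolding U_def by (rule suminf_mult[OF u])
    finally show ?thesis .
  qed
  have "(\<lambda>k. \<rho> ^ k * U) \<longlonglongrightarrow> 0 * U"
    using \<rho> r by (intro tendsto_intros LIMSEQ_realpow_zero) auto
  then have "norm (u m) \<le> 0 * U" using le by (intro LIMSEQ_le_const) blast+
  then show ?thesis by simp
qed

text \<open>The leading coefficient is isolated by evaluating at \<open>\<sigma> + k\<close> and
  rescaling by the \<open>k\<close>-th power of its index \<open>Suc m\<close>.\<close>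

lemma dirichlet_series_zero:
  assumes "has_dirichlet_series (\<lambda>s. 0) d" "n > 0"
  shows "d n = 0"
proof (rule ccontr)
  assume "d n \<noteq> 0"
  then obtain m where m: "d (Suc m) \<noteq> 0" "\<And>j. j < m \<Longrightarrow> d (Suc j) = 0"
    using exists_least_iff[of "\<lambda>m. d (Suc m) \<noteq> 0"] assms(2) by (metis gr0_conv_Suc)
  obtain \<theta>1 where \<theta>1: "\<And>s. Re s > \<theta>1 \<Longrightarrow> (\<lambda>n. d (Suc n) * of_nat (Suc n) powr (- s)) sums 0"
    using assms(1) unfolding has_dirichlet_series_def by blast
  obtain \<theta>2 where \<theta>2: "\<And>\<sigma>. \<sigma> > \<theta>2 \<Longrightarrow> summable (\<lambda>n. norm (d (Suc n)) * real (Suc n) powr - \<sigma>)"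
    using dirichlet_series_abs_summable[OF assms(1)] by blast
  define \<sigma> where "\<sigma> = max \<theta>1 \<theta>2 + 1"
  define u where "u = (\<lambda>j. d (Suc j) * of_nat (Suc j) powr (- of_real \<sigma>))"
  define r where "r = (\<lambda>j. real (Suc m) / real (Suc j))"
  have "u m = 0"
  proof (rule geometric_moments_zero_imp_zero[where r = r and \<rho> = "real (Suc m) / real (Suc (Suc m))"])
    show "summable (\<lambda>j. norm (u j))"
      using \<theta>2[of \<sigma>] by (simp add: u_def norm_mult norm_of_nat_powr \<sigma>_def del: of_nat_Suc)
    show "r m = 1" "real (Suc m) / real (Suc (Suc m)) < 1" by (simp_all add: r_def)
    show "u j = 0 \<or> (0 \<le> r j \<and> r j \<le> real (Suc m) / real (Suc (Suc m)))" if "j \<noteq> m" for j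
    proof (cases "j < m")
      case False
      then have "Suc j \<ge> Suc (Suc m)" using that by simp
      then have "r j \<le> real (Suc m) / real (Suc (Suc m))"
        unfolding r_def by (intro divide_left_mono) (auto simp del: of_nat_Suc)
      then show ?thesis by (simp add: r_def)
    qed (simp add: u_def m)
    fix k :: nat
    have "(\<lambda>j. of_nat (Suc m) ^ k * (d (Suc j) * of_nat (Suc j) powr (- of_real (\<sigma> + real k)))) sums (of_nat (Suc m) ^ k * 0)"
      by (intro sums_mult \<theta>1) (simp add: \<sigma>_def add_strict_increasing2)
    moreover have "of_nat (Suc m) ^ k * (d (Suc j) * of_nat (Suc j) powr (- of_real (\<sigma> + real k))) = u j * of_real (r j ^ k)" for j
    proof -
      have "of_nat (Suc j) powr (- of_real (\<sigma> + real k) :: complex) = of_nat (Suc j) powr (- of_real \<sigma>) * of_nat (Suc j) powr (- of_nat k)"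
        by (simp flip: powr_add)
      also have "of_nat (Suc j) powr (- of_nat k :: complex) = 1 / of_nat (Suc j) ^ k"
        by (simp add: powr_minus divide_inverse powr_nat del: of_nat_Suc)
      finally show ?thesis by (simp add: u_def r_def power_divide)
    qed
    ultimately show "(\<lambda>j. u j * of_real (r j ^ k)) sums 0" by simp
  qed
  then show False using m(1) by (simp add: u_def del: of_nat_Suc)
qed

lemma dirichlet_coeffs_unique:
  assumes "has_dirichlet_series f a" "has_dirichlet_series f b" "n > 0"
  shows "a n = b n"
  using dirichlet_series_zero[of "\<lambda>n. a n + - 1 * b n" n] assms(3)
    has_dirichlet_series_add[OF assms(1) has_dirichlet_series_scale[OF assms(2), of "- 1"]] by simp

lemma has_dirichlet_series_polynomial:
  assumes "finite S" "0 \<notin> S"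
  shows "has_dirichlet_series (\<lambda>s. \<Sum>n\<in>S. a n * of_nat n powr (- s)) (\<lambda>n. if n \<in> S then a n else 0)"
  unfolding has_dirichlet_series_def
proof (intro exI allI impI)
  fix s :: complex
  let ?g = "\<lambda>n. (if n \<in> S then a n else 0) * of_nat n powr (- s)"
  have "?g sums (\<Sum>n\<in>S. ?g n)" by (rule sums_finite[OF assms(1)]) simp
  then have "(\<lambda>n. ?g (Suc n)) sums ((\<Sum>n\<in>S. ?g n) - ?g 0)"
    by (intro sums_Suc_iff[of ?g, THEN iffD2]) simp
  then show "(\<lambda>n. ?g (Suc n)) sums (\<Sum>n\<in>S. a n * of_nat n powr (- s))"
    using assms(2) by simp
qed

lemma deriv_dirichlet_series:
  assumes "has_dirichlet_series g \<beta>"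
  shows "\<exists>\<theta>. \<forall>s. Re s > \<theta> \<longrightarrow>
    (\<lambda>n. - (of_real (ln (real (Suc n))) * \<beta> (Suc n)) * of_nat (Suc n) powr (- s)) sums deriv g s"
proof -
  obtain \<theta>1 where \<theta>1: "\<And>s. Re s > \<theta>1 \<Longrightarrow> (\<lambda>n. \<beta> (Suc n) * of_nat (Suc n) powr (- s)) sums g s"
    using assms unfolding has_dirichlet_series_def by blast
  obtain \<theta>2 where \<theta>2: "\<And>\<sigma>. \<sigma> > \<theta>2 \<Longrightarrow> summable (\<lambda>n. norm (\<beta> (Suc n)) * real (Suc n) powr - \<sigma>)"
    using dirichlet_series_abs_summable[OF assms] by blast
  \<comment> \<open>One unit is spent on bounding the logarithm by \<open>n\<close> in the termwise
    derivative; the other keeps \<open>\<theta> - 1\<close> inside the region of absolute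
    convergence.\<close>
  define \<theta> where "\<theta> = max \<theta>1 \<theta>2 + 2"
  define H where "H = {s. Re s > \<theta>}"
  let ?f = "\<lambda>n s. \<beta> (Suc n) * of_nat (Suc n) powr (- s) :: complex"
  let ?f' = "\<lambda>n s. - (of_real (ln (real (Suc n))) * \<beta> (Suc n)) * of_nat (Suc n) powr (- s) :: complex"
  have H: "open H" "convex H" unfolding H_def by (rule open_halfspace_Re_gt convex_halfspace_Re_gt)+
  have bound: "norm (?f' n s) \<le> norm (\<beta> (Suc n)) * real (Suc n) powr - (\<theta> - 1)" if "s \<in> H" for n s
  proof -
    have "norm (?f' n s) = ln (real (Suc n)) * (norm (\<beta> (Suc n)) * real (Suc n) powr - Re s)"
      by (simp add: norm_mult norm_of_nat_powr mult.assoc del: of_nat_Suc)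
    also have "\<dots> \<le> real (Suc n) powr 1 * (norm (\<beta> (Suc n)) * real (Suc n) powr - \<theta>)"
      using that ln_le_minus_one[of "real (Suc n)"]
      by (intro mult_mono mult_left_mono powr_mono) (auto simp: H_def)
    also have "\<dots> = norm (\<beta> (Suc n)) * (real (Suc n) powr 1 * real (Suc n) powr - \<theta>)"
      by (simp only: mult_ac)
    also have "real (Suc n) powr 1 * real (Suc n) powr - \<theta> = real (Suc n) powr - (\<theta> - 1)"
      by (subst powr_add[symmetric]) simp
    finally show ?thesis .
  qed
  have sm: "summable (\<lambda>n. norm (\<beta> (Suc n)) * real (Suc n) powr - (\<theta> - 1))"
    by (rule \<theta>2) (simp add: \<theta>_def)
  have "(\<lambda>n. ?f' n s) sums deriv g s" if "Re s > \<theta>" for s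
  proof -
    have s: "s \<in> H" using that by (simp add: H_def)
    have "((\<lambda>s. \<Sum>n. ?f n s) has_field_derivative (\<Sum>n. ?f' n s)) (at s)"
    proof (rule has_field_derivative_series'(2)[OF H(2)])
      show "(?f n has_field_derivative ?f' n x) (at x within H)" for n x
        by (auto intro!: derivative_eq_intros simp: powr_def Ln_of_nat simp del: of_nat_Suc)
      show "uniformly_convergent_on H (\<lambda>n x. \<Sum>i<n. ?f' i x)"
        by (rule Weierstrass_m_test'[OF bound sm])
      show "summable (\<lambda>n. ?f n s)"
        using sums_summable[OF \<theta>1[of s]] that by (simp add: \<theta>_def del: of_nat_Suc)
      show "s \<in> H" "s \<in> interior H" using s H(1) by (simp_all add: interior_open)
    qed
    then have "(g has_field_derivative (\<Sum>n. ?f' n s)) (at s)"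
    proof (rule has_field_derivative_transform_within_open[OF _ H(1) s])
      fix x assume "x \<in> H"
      then show "(\<Sum>n. ?f n x) = g x"
        using sums_unique[OF \<theta>1[of x]] by (simp add: H_def \<theta>_def)
    qed
    then have "deriv g s = (\<Sum>n. ?f' n s)" by (rule DERIV_imp_deriv)
    moreover have "summable (\<lambda>n. ?f' n s)"
      by (rule summable_comparison_test'[OF sm]) (rule bound[OF s])
    ultimately show ?thesis by (simp add: summable_sums del: of_nat_Suc)
  qed
  then show ?thesis by blast
qed

section \<open>The Volterra operator on Dirichlet polynomials, coefficient by coefficient\<close>

lemma integral_exp_neg:
  fixes c :: real
  assumes "c > 0"
  shows "has_bochner_integral lborel (\<lambda>t. indicator {0..} t *\<^sub>R exp (- (c * t))) (1 / c)"
proof (rule has_bochner_integral_nn_integral)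
  have "(\<integral>\<^sup>+t. ennreal (exp (- (c * t))) * indicator {0..} t \<partial>lborel) = ennreal (0 - - exp (- (c * 0)) / c)"
  proof (rule nn_integral_FTC_atLeast)
    show "((\<lambda>t. - exp (- (c * t)) / c) has_real_derivative exp (- (c * t))) (at t)" for t
      using assms by (auto intro!: derivative_eq_intros)
    show "((\<lambda>t. - exp (- (c * t)) / c) \<longlongrightarrow> 0) at_top" using assms by real_asymp
  qed auto
  then show "(\<integral>\<^sup>+t. ennreal (indicator {0..} t *\<^sub>R exp (- (c * t))) \<partial>lborel) = ennreal (1 / c)"
    by (simp add: ennreal_mult' mult.commute indicator_mult_ennreal)
qed (use assms in auto)

text \<open>The coefficients of f g' are minus the Dirichlet convolution of \<open>a\<close> with
  \<open>\<beta>\<close> times the logarithm, and taking the primitive that vanishes at infinity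
  divides by \<open>- ln n\<close>. At \<open>n = 1\<close> the quotient is 0 / 0 = 0, which is the
  correct constant term.\<close>

definition volterra_coeff :: "nat set \<Rightarrow> (nat \<Rightarrow> complex) \<Rightarrow> (nat \<Rightarrow> complex) \<Rightarrow> nat \<Rightarrow> complex" where
  "volterra_coeff S a \<beta> n = (\<Sum>d\<in>S. if d dvd n then a d * \<beta> (n div d) * of_real (ln (real (n div d)) / ln (real n)) else 0)"

lemma sums_multiples:
  fixes h :: "nat \<Rightarrow> complex"
  assumes "d > 0" "(\<lambda>j. h (d * Suc j)) sums x"
  shows "(\<lambda>n. if d dvd Suc n then h (Suc n) else 0) sums x"
proof -
  \<comment> \<open>The series run over \<open>Suc n\<close>, so the multiple
    \<open>d * Suc j\<close> sits at position \<open>d * Suc j - 1\<close>.\<close>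
  define q where "q = (\<lambda>j. d * Suc j - 1)"
  have q: "Suc (q j) = d * Suc j" for j using assms(1) by (simp add: q_def)
  have mono: "strict_mono q"
  proof (rule strict_monoI)
    fix i j :: nat assume "i < j"
    then have "d * Suc i < d * Suc j" using assms(1) by simp
    then show "q i < q j" using q by (metis Suc_less_eq)
  qed
  have "(\<lambda>j. if d dvd Suc (q j) then h (Suc (q j)) else 0) sums x"
    using assms(2) by (simp only: q) simp
  then show ?thesis
  proof (subst (asm) sums_mono_reindex[OF mono])
    fix n assume n: "n \<notin> range q"
    have False if "d dvd Suc n"
    proof -
      from that obtain k where k: "Suc n = d * k" by blast
      then obtain j where "k = Suc j" by (cases k) auto
      then have "n = q j" using k q[of j] by simp
      then show False using n by blast
    qed
    then show "(if d dvd Suc n then h (Suc n) else 0) = 0" by auto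
  qed
qed

text \<open>Termwise integration along the half-line, grouped by the index \<open>n\<close> of the
  symbol with the finite sum over \<open>S\<close> kept inside each term; the double sum is then
  rearranged by the value of \<open>d * n\<close>.\<close>

lemma volterra_polynomial_series:
  assumes g: "has_dirichlet_series g \<beta>" and S: "finite S" "0 \<notin> S"
  shows "has_dirichlet_series (volterra g (\<lambda>s. \<Sum>n\<in>S. a n * of_nat n powr (- s))) (volterra_coeff S a \<beta>)"
proof -
  let ?f = "\<lambda>s. \<Sum>n\<in>S. a n * of_nat n powr (- s)"
  obtain \<theta>1 where \<theta>1: "\<And>s. Re s > \<theta>1 \<Longrightarrow>
      (\<lambda>n. - (of_real (ln (real (Suc n))) * \<beta> (Suc n)) * of_nat (Suc n) powr (- s)) sums deriv g s"
    using deriv_dirichlet_series[OF g] by blast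
  obtain \<theta>2 where \<theta>2: "\<And>\<sigma>. \<sigma> > \<theta>2 \<Longrightarrow> summable (\<lambda>n. norm (\<beta> (Suc n)) * real (Suc n) powr - \<sigma>)"
    using dirichlet_series_abs_summable[OF g] by blast
  \<comment> \<open>Positivity makes \<open>real (d * n) powr - Re s\<close> at most
    \<open>real n powr - Re s\<close>; the unit margin absorbs the logarithm in the pointwise
    convergence of the integrand.\<close>
  define \<theta> where "\<theta> = max 0 (max \<theta>1 \<theta>2) + 1"
  let ?L = "\<lambda>n. ln (real n)"
  have main: "(\<lambda>n. volterra_coeff S a \<beta> (Suc n) * of_nat (Suc n) powr (- s)) sums volterra g ?f s" if s: "Re s > \<theta>" for s
  proof -
    have pos: "d > 0" if "d \<in> S" for d using that S(2) by (auto intro: gr0I)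
    define A where "A = (\<Sum>d\<in>S. norm (a d))"
    define q where "q = (\<lambda>d n. a d * \<beta> n * of_nat (d * n) powr (- s))"
    define \<phi> where "\<phi> = (\<lambda>n t. indicator {0..} t *\<^sub>R (\<Sum>d\<in>S. q d n * of_real (?L n) * of_real (exp (- (?L (d * n) * t)))))"
    have powr_shift: "of_nat k powr (- (s + of_real t)) = of_nat k powr (- s) * of_real (exp (- (?L k * t)))" if "k > 0" for k :: nat and t
      using that by (simp add: powr_def Ln_of_nat exp_of_real[symmetric] ring_distribs exp_add mult_ac flip: exp_add)
    have int_exp: "has_bochner_integral lborel (\<lambda>t. indicator {0..} t *\<^sub>R (q d n * of_real (?L n) * of_real (exp (- (?L (d * n) * t)))))
        (q d n * of_real (?L n / ?L (d * n)))" if "d \<in> S" "n > 0" for d n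
    proof (cases "n = 1")
      case False
      then have "d * n > 1" using pos[OF that(1)] that(2) mult_le_mono[of 1 d 2 n] by simp
      then have "?L (d * n) > 0" by (metis ln_gt_zero of_nat_1 of_nat_less_iff)
      from has_bochner_integral_mult_right[OF has_bochner_integral_of_real[OF integral_exp_neg[OF this]], of "q d n * of_real (?L n)"]
      show ?thesis by (simp add: scaleR_conv_of_real mult_ac)
    qed (simp add: has_bochner_integral_zero)
    have int_\<phi>: "has_bochner_integral lborel (\<phi> n) (\<Sum>d\<in>S. q d n * of_real (?L n / ?L (d * n)))" if "n > 0" for n
      unfolding \<phi>_def scaleR_sum_right using int_exp that by (intro has_bochner_integral_sum) auto
    have norm_q: "norm (q d n) \<le> norm (a d) * (norm (\<beta> n) * real n powr - Re s)" if "d \<in> S" "n > 0" for d n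
    proof -
      have "real (d * n) powr - Re s \<le> real n powr - Re s"
        using pos[OF that(1)] that(2) s by (intro powr_mono2') (auto simp: \<theta>_def)
      then have "norm (a d) * norm (\<beta> n) * real (d * n) powr - Re s \<le> norm (a d) * norm (\<beta> n) * real n powr - Re s"
        by (intro mult_left_mono) auto
      then show ?thesis
        using pos[OF that(1)] that(2) unfolding q_def by (simp add: norm_mult norm_of_nat_powr mult.assoc del: of_nat_mult)
    qed
    have norm_\<phi>: "norm (\<phi> n t) \<le> A * (norm (\<beta> n) * real n powr - Re s) * (?L n * (indicator {0..} t *\<^sub>R exp (- (?L n * t))))"
      if n: "n > 0" for n t
    proof (cases "t \<ge> 0")
      case True
      have "norm (\<phi> n t) \<le> (\<Sum>d\<in>S. norm (a d) * (norm (\<beta> n) * real n powr - Re s) * (?L n * exp (- (?L n * t))))"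
      proof -
        have "\<phi> n t = (\<Sum>d\<in>S. q d n * of_real (?L n) * of_real (exp (- (?L (d * n) * t))))"
          using True by (simp add: \<phi>_def)
        moreover have "norm \<dots> \<le> (\<Sum>d\<in>S. norm (a d) * (norm (\<beta> n) * real n powr - Re s) * (?L n * exp (- (?L n * t))))"
        proof (rule sum_norm_le)
          fix d assume d: "d \<in> S"
          have "?L n * t \<le> ?L (d * n) * t"
            using True n pos[OF d] by (intro mult_right_mono) auto
          then have "exp (- (?L (d * n) * t)) \<le> exp (- (?L n * t))"
            by (simp only: exp_le_cancel_iff neg_le_iff_le)
          then have le: "?L n * exp (- (?L (d * n) * t)) \<le> ?L n * exp (- (?L n * t))"
            using n by (intro mult_left_mono) auto
          have "norm (q d n) * (?L n * exp (- (?L (d * n) * t))) \<le> norm (a d) * (norm (\<beta> n) * real n powr - Re s) * (?L n * exp (- (?L n * t)))"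
            using n by (intro mult_mono norm_q d le) auto
          moreover have "norm (q d n * of_real (?L n) * of_real (exp (- (?L (d * n) * t)))) = norm (q d n) * (?L n * exp (- (?L (d * n) * t)))"
            using n unfolding norm_mult norm_of_real by simp
          ultimately show "norm (q d n * of_real (?L n) * of_real (exp (- (?L (d * n) * t)))) \<le> norm (a d) * (norm (\<beta> n) * real n powr - Re s) * (?L n * exp (- (?L n * t)))"
            by simp
        qed
        ultimately show ?thesis by simp
      qed
      then show ?thesis using True by (simp add: A_def sum_distrib_right mult.assoc)
    qed (simp add: \<phi>_def)
    \<comment> \<open>The exponential integrates to the reciprocal of the logarithm in front of it,
      so the bound contains no logarithm. For \<open>n = 1\<close> that logarithm is 0 and
      \<open>\<phi> n\<close> vanishes.\<close>
    have int_norm: "(\<integral>t. norm (\<phi> n t) \<partial>lborel) \<le> A * (norm (\<beta> n) * real n powr - Re s)" if n: "n > 0" for n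
    proof (cases "n = 1")
      case True
      have "\<phi> n t = 0" for t using True by (simp add: \<phi>_def)
      then show ?thesis by (simp add: A_def sum_nonneg)
    next
      case False
      then have "?L n > 0" using n by simp
      let ?K = "A * (norm (\<beta> n) * real n powr - Re s)"
      from has_bochner_integral_mult_right[OF integral_exp_neg[OF \<open>?L n > 0\<close>], of "?K * ?L n"]
      have hb: "has_bochner_integral lborel (\<lambda>t. ?K * (?L n * (indicator {0..} t *\<^sub>R exp (- (?L n * t))))) ?K"
        using \<open>?L n > 0\<close> by (simp add: mult.assoc)
      have "(\<integral>t. norm (\<phi> n t) \<partial>lborel) \<le> (\<integral>t. ?K * (?L n * (indicator {0..} t *\<^sub>R exp (- (?L n * t)))) \<partial>lborel)"
        using int_\<phi>[OF n] hb by (intro integral_mono norm_\<phi> n) (auto simp: has_bochner_integral_iff)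
      then show ?thesis unfolding has_bochner_integral_integral_eq[OF hb] .
    qed
    have sm: "summable (\<lambda>n. A * (norm (\<beta> (Suc n)) * real (Suc n) powr - Re s))"
      using s by (intro summable_mult \<theta>2) (simp add: \<theta>_def)
    have sumt: "(\<lambda>n. - \<phi> (Suc n) t) sums (indicator {0..} t *\<^sub>R (?f (s + of_real t) * deriv g (s + of_real t)))" for t
    proof (cases "t \<ge> 0")
      case True
      then have "Re (s + of_real t) > \<theta>1" using s by (simp add: \<theta>_def)
      from sums_mult[OF \<theta>1[OF this], of "?f (s + of_real t)"]
      have "(\<lambda>n. ?f (s + of_real t) * (- (of_real (?L (Suc n)) * \<beta> (Suc n)) * of_nat (Suc n) powr (- (s + of_real t)))) sums (?f (s + of_real t) * deriv g (s + of_real t))" .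
      moreover have "?f (s + of_real t) * (- (of_real (?L n) * \<beta> n) * of_nat n powr (- (s + of_real t))) = - \<phi> n t" if "n > 0" for n
      proof -
        have "?f (s + of_real t) * (- (of_real (?L n) * \<beta> n) * of_nat n powr (- (s + of_real t)))
            = (\<Sum>d\<in>S. - (a d * \<beta> n * of_real (?L n) * of_nat (d * n) powr (- (s + of_real t))))"
          unfolding sum_distrib_right of_nat_powr_mult by (intro sum.cong refl) (simp add: mult_ac)
        also have "\<dots> = (\<Sum>d\<in>S. - (q d n * of_real (?L n) * of_real (exp (- (?L (d * n) * t)))))"
        proof (intro sum.cong refl)
          fix d assume "d \<in> S"
          then have "d * n > 0" using pos that by simp
          from powr_shift[OF this, of t]
          show "- (a d * \<beta> n * of_real (?L n) * of_nat (d * n) powr (- (s + of_real t)))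
              = - (q d n * of_real (?L n) * of_real (exp (- (?L (d * n) * t))))"
            unfolding q_def by (simp only: mult_ac)
        qed
        finally show ?thesis using True by (simp add: \<phi>_def sum_negf)
      qed
      ultimately show ?thesis using True by (simp del: of_nat_Suc)
    qed (simp add: \<phi>_def)
    have "(\<lambda>n. \<integral>t. \<phi> (Suc n) t \<partial>lborel) sums (\<integral>t. (\<Sum>n. \<phi> (Suc n) t) \<partial>lborel)"
    proof (rule sums_integral)
      show "integrable lborel (\<phi> (Suc n))" for n
        using int_\<phi>[of "Suc n"] by (simp add: has_bochner_integral_iff)
      show "AE t in lborel. summable (\<lambda>n. norm (\<phi> (Suc n) t))"
      proof (rule AE_I2)
        fix t :: real
        have sm1: "summable (\<lambda>n. A * (norm (\<beta> (Suc n)) * real (Suc n) powr - (Re s - 1)))"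
          using s by (intro summable_mult \<theta>2) (simp add: \<theta>_def)
        show "summable (\<lambda>n. norm (\<phi> (Suc n) t))"
        proof (rule summable_comparison_test'[OF sm1])
          fix n
          let ?n = "Suc n"
          have "?L ?n * (indicator {0..} t *\<^sub>R exp (- (?L ?n * t))) \<le> real ?n * 1"
            using ln_le_minus_one[of "real ?n"] by (intro mult_mono) (auto simp: indicator_def)
          then have "norm (\<phi> ?n t) \<le> A * (norm (\<beta> ?n) * real ?n powr - Re s) * (real ?n * 1)"
            by (intro order_trans[OF norm_\<phi>] mult_left_mono) (auto simp: A_def intro!: mult_nonneg_nonneg sum_nonneg)
          also have "\<dots> = A * (norm (\<beta> ?n) * (real ?n powr - Re s * real ?n powr 1))"
            by simp
          also have "real ?n powr - Re s * real ?n powr 1 = real ?n powr - (Re s - 1)"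
            by (subst powr_add[symmetric]) simp
          finally show "norm (norm (\<phi> ?n t)) \<le> A * (norm (\<beta> ?n) * real ?n powr - (Re s - 1))"
            by simp
        qed
      qed
      show "summable (\<lambda>n. \<integral>t. norm (\<phi> (Suc n) t) \<partial>lborel)"
        by (rule summable_comparison_test'[OF sm]) (use int_norm in \<open>simp del: of_nat_Suc\<close>)
    qed
    moreover have "(\<integral>t. (\<Sum>n. \<phi> (Suc n) t) \<partial>lborel) = volterra g ?f s"
    proof -
      have "(\<Sum>n. \<phi> (Suc n) t) = - (indicator {0..} t *\<^sub>R (?f (s + of_real t) * deriv g (s + of_real t)))" for t
        using sums_minus[OF sumt[of t]] by (simp add: sums_iff)
      then show ?thesis by (simp add: volterra_def set_lebesgue_integral_def)
    qed
    moreover have "(\<integral>t. \<phi> (Suc n) t \<partial>lborel) = (\<Sum>d\<in>S. q d (Suc n) * of_real (?L (Suc n) / ?L (d * Suc n)))" for n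
      using int_\<phi>[of "Suc n"] by (simp add: has_bochner_integral_iff del: of_nat_Suc)
    ultimately have sums1: "(\<lambda>n. \<Sum>d\<in>S. q d (Suc n) * of_real (?L (Suc n) / ?L (d * Suc n))) sums volterra g ?f s"
      by simp
    \<comment> \<open>The contribution of \<open>d\<close> to the coefficient at \<open>k\<close>:
      here the index changes from that of the symbol to that of the product.\<close>
    let ?h = "\<lambda>d k. a d * \<beta> (k div d) * of_real (?L (k div d) / ?L k) * of_nat k powr (- s)"
    have hq: "?h d (d * Suc n) = q d (Suc n) * of_real (?L (Suc n) / ?L (d * Suc n))" if "d \<in> S" for d n
      using pos[OF that] unfolding q_def by (simp del: of_nat_mult of_nat_Suc mult_Suc_right)
    have "summable (\<lambda>n. ?h d (d * Suc n))" if d: "d \<in> S" for d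
    proof (rule summable_comparison_test'[OF summable_mult[OF \<theta>2[of "Re s"], of "norm (a d)"]])
      fix n
      have L: "?L (Suc n) \<le> ?L (d * Suc n)" "?L (Suc n) \<ge> 0"
        using pos[OF d] by (simp_all add: ln_mult del: of_nat_Suc mult_Suc_right)
      have "?L (Suc n) / ?L (d * Suc n) \<le> 1"
        using L by (subst divide_le_eq_1) linarith
      moreover have "?L (Suc n) / ?L (d * Suc n) \<ge> 0"
        using L by (intro divide_nonneg_nonneg) linarith+
      ultimately have "norm (q d (Suc n)) * \<bar>?L (Suc n) / ?L (d * Suc n)\<bar> \<le> norm (a d) * (norm (\<beta> (Suc n)) * real (Suc n) powr - Re s) * 1"
        using norm_q[OF d, of "Suc n"] by (intro mult_mono) auto
      then show "norm (?h d (d * Suc n)) \<le> norm (a d) * (norm (\<beta> (Suc n)) * real (Suc n) powr - Re s)"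
        unfolding hq[OF d] norm_mult norm_of_real by simp
    qed (use s in \<open>simp add: \<theta>_def\<close>)
    then have hs: "(\<lambda>n. ?h d (d * Suc n)) sums (\<Sum>n. ?h d (d * Suc n))" if "d \<in> S" for d
      using that by (simp only: summable_sums)
    have "(\<lambda>n. \<Sum>d\<in>S. ?h d (d * Suc n)) sums (\<Sum>d\<in>S. \<Sum>n. ?h d (d * Suc n))"
      by (intro sums_sum hs)
    moreover have "(\<lambda>n. \<Sum>d\<in>S. ?h d (d * Suc n)) sums volterra g ?f s"
      using sums1 by (rule sums_cong[THEN iffD1, rotated]) (intro sum.cong refl, rule hq[symmetric])
    ultimately have "volterra g ?f s = (\<Sum>d\<in>S. \<Sum>n. ?h d (d * Suc n))" using sums_unique2 by blast
    moreover have "(\<lambda>n. \<Sum>d\<in>S. if d dvd Suc n then ?h d (Suc n) else 0) sums (\<Sum>d\<in>S. \<Sum>n. ?h d (d * Suc n))"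
      by (intro sums_sum sums_multiples hs pos)
    moreover have "(\<Sum>d\<in>S. if d dvd Suc n then ?h d (Suc n) else 0) = volterra_coeff S a \<beta> (Suc n) * of_nat (Suc n) powr (- s)" for n
      unfolding volterra_coeff_def sum_distrib_right by (intro sum.cong refl) simp
    ultimately show ?thesis by simp
  qed
  then show ?thesis unfolding has_dirichlet_series_def by blast
qed

section \<open>Bohr lifts of polynomials\<close>

lemma bohr_lift_coeff:
  assumes "is_bohr_lift f F" "has_dirichlet_series f a" "n > 0"
  shows "fourier_coeff F (kappa n) = a n"
  using assms dirichlet_coeffs_unique unfolding is_bohr_lift_def
  by (metis Suc_leI One_nat_def)

text \<open>The lift picked by \<open>SOME\<close> shares its coefficients with \<open>F\<close>, by
  uniqueness of Dirichlet coefficients, and hence its norm.\<close>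

lemma H1_norm_eq_l1:
  assumes F: "is_bohr_lift f F"
  shows "H1_norm f = l1 F"
proof -
  have lift: "is_bohr_lift f (bohr_lift f)"
    unfolding bohr_lift_def using F by (rule someI[where P = "is_bohr_lift f"])
  obtain a where a: "has_dirichlet_series f a" using F unfolding is_bohr_lift_def by blast
  have "l1 (bohr_lift f) = l1 F"
  proof (rule l1_eq_fourier_coeff_eq)
    show "bohr_lift f \<in> H1_torus" "F \<in> H1_torus"
      using lift F by (simp_all add: is_bohr_lift_def)
    show "fourier_coeff (bohr_lift f) (kappa n) = fourier_coeff F (kappa n)" if "n > 0" for n
      using bohr_lift_coeff[OF lift a that] bohr_lift_coeff[OF F a that] by simp
  qed
  then show ?thesis by (simp add: H1_norm_def l1_def)
qed

lemma is_bohr_lift_polynomial: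
  assumes "finite S" "0 \<notin> S"
  shows "is_bohr_lift (\<lambda>s. \<Sum>n\<in>S. a n * of_nat n powr (- s)) (tpoly S a)"
  unfolding is_bohr_lift_def
  using tpoly_in_H1_torus[OF assms] has_dirichlet_series_polynomial[OF assms] fourier_coeff_tpoly[OF assms]
  by (intro conjI exI[of _ "\<lambda>n. if n \<in> S then a n else 0"]) auto

section \<open>Polynomial symbols\<close>

text \<open>The lift of the image is an unknown function of the Hardy space, but its coefficients
  are known. Its Folner mean is a polynomial built from them, and taking the mean does not increase
  the norm.\<close>

lemma l1_folner_volterra_le:
  assumes g: "has_dirichlet_series g \<beta>"
    and T: "\<And>f. f \<in> H1 \<Longrightarrow> volterra g f \<in> H1" "\<And>f. f \<in> H1 \<Longrightarrow> H1_norm (volterra g f) \<le> C * H1_norm f"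
    and S: "finite S" "0 \<notin> S" and N: "N > 0"
  shows "l1 (tpoly {n. n dvd N} (\<lambda>n. volterra_coeff S a \<beta> n * of_real (folner N n))) \<le> C * l1 (tpoly S a)"
proof -
  define f where "f = (\<lambda>s. \<Sum>n\<in>S. a n * of_nat n powr (- s))"
  have f: "is_bohr_lift f (tpoly S a)" unfolding f_def by (rule is_bohr_lift_polynomial[OF S])
  then have "f \<in> H1" unfolding H1_def by blast
  obtain F where F: "is_bohr_lift (volterra g f) F"
    using T(1)[OF \<open>f \<in> H1\<close>] unfolding H1_def by blast
  then have FH: "F \<in> H1_torus" by (simp add: is_bohr_lift_def)
  have "has_dirichlet_series (volterra g f) (volterra_coeff S a \<beta>)"
    unfolding f_def by (rule volterra_polynomial_series[OF g S])
  then have "fourier_coeff F (kappa n) = volterra_coeff S a \<beta> n" if "n > 0" for n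
    using bohr_lift_coeff[OF F _ that] by blast
  then have "folner_mean N F = tpoly {n. n dvd N} (\<lambda>n. volterra_coeff S a \<beta> n * of_real (folner N n))"
    unfolding folner_mean_def tpoly_def fun_eq_iff using N by (auto intro!: sum.cong intro: gr0I)
  then have "l1 (tpoly {n. n dvd N} (\<lambda>n. volterra_coeff S a \<beta> n * of_real (folner N n))) \<le> l1 F"
    using l1_folner_mean_le[OF N FH] by simp
  also have "\<dots> \<le> C * l1 (tpoly S a)"
    using T(2)[OF \<open>f \<in> H1\<close>] by (simp add: H1_norm_eq_l1[OF f] H1_norm_eq_l1[OF F])
  finally show ?thesis .
qed

lemma l1_twist:
  assumes "\<And>j. norm (\<omega> j) = 1"
  shows "l1 (tpoly S (\<lambda>n. a n * mon n \<omega>)) = l1 (tpoly S a)"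
  using l1_rotate[OF assms measurable_tpoly, of S a] by (simp add: tpoly_rotate)

text \<open>Twisting the symbol amounts to untwisting f, applying the operator with the original
  symbol and twisting the result; neither twist changes a norm. Averaging over the twists damps the
  symbol by \<open>folner K\<close> and leaves the outer \<open>folner N\<close> as it is.\<close>

lemma l1_folner_symbol_le:
  assumes bound: "\<And>a. l1 (tpoly {n. n dvd N} (\<lambda>n. volterra_coeff S a \<beta> n * of_real (folner N n))) \<le> C * l1 (tpoly S a)"
    and S: "finite S" "0 \<notin> S" and N: "N > 0" and K: "K > 0"
  shows "l1 (tpoly {n. n dvd N} (\<lambda>n. volterra_coeff S a (\<lambda>m. \<beta> m * of_real (folner K m)) n * of_real (folner N n))) \<le> C * l1 (tpoly S a)"
proof -
  let ?D = "{n. n dvd N}"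
  have D: "finite ?D" using finite_divisors_nat N by blast
  \<comment> \<open>Flattens the double sum over \<open>n\<close> and its divisors \<open>d\<close>
    into the single index set of the averaging lemma, with twist exponent
    \<open>n div d\<close>.\<close>
  define I where "I = (SIGMA n:?D. {d \<in> S. d dvd n})"
  have fin: "finite I" unfolding I_def using D S(1) by auto
  define c where "c = (\<lambda>(n, d). a d * \<beta> (n div d) * of_real (ln (real (n div d)) / ln (real n)) * of_real (folner N n))"
  have sum_I: "(\<Sum>i\<in>I. h (fst i) (snd i)) = (\<Sum>n\<in>?D. \<Sum>d\<in>S. if d dvd n then h n d else 0)"
    for h :: "nat \<Rightarrow> nat \<Rightarrow> complex"
  proof -
    have "(\<Sum>i\<in>I. h (fst i) (snd i)) = (\<Sum>n\<in>?D. \<Sum>d\<in>{d \<in> S. d dvd n}. h n d)"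
      unfolding I_def using D S(1) by (subst sum.Sigma) (auto simp: case_prod_beta)
    then show ?thesis using S(1) by (simp add: sum.inter_filter)
  qed
  have tpoly_I: "tpoly ?D (\<lambda>n. volterra_coeff S a \<gamma> n * of_real (folner N n)) z
      = (\<Sum>i\<in>I. a (snd i) * \<gamma> (fst i div snd i) * of_real (ln (real (fst i div snd i)) / ln (real (fst i))) * of_real (folner N (fst i)) * mon (fst i) z)"
    for a \<gamma> z
    unfolding tpoly_def volterra_coeff_def sum_distrib_right
    by (subst sum_I[of "\<lambda>n d. a d * \<gamma> (n div d) * of_real (ln (real (n div d)) / ln (real n)) * of_real (folner N n) * mon n z"])
      (intro sum.cong refl, simp)
  have "l1 (\<lambda>z. \<Sum>i\<in>I. c i * of_real (folner K (fst i div snd i)) * mon (fst i) z) \<le> C * l1 (tpoly S a)"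
  proof (rule l1_folner_average[OF K fin])
    fix i assume "i \<in> I"
    then have "fst i dvd N" "snd i dvd fst i" by (auto simp: I_def)
    then have "fst i > 0" using N by (auto intro: gr0I)
    then show "fst i div snd i > 0"
      using \<open>snd i dvd fst i\<close> by (metis dvd_div_eq_0_iff gr0I)
  next
    fix \<omega> assume "\<omega> \<in> space torus_measure"
    then have \<omega>: "norm (\<omega> j) = 1" for j by (simp add: space_torus)
    \<comment> \<open>On the circle conjugation inverts, so the twist at \<open>n div d\<close> is
      the twist at \<open>n\<close> times the inverse twist at \<open>d\<close>; the latter is
      absorbed into \<open>a\<close>.\<close>
    define a' where "a' = (\<lambda>n. a n * mon n (\<lambda>j. cnj (\<omega> j)))"
    have "(\<Sum>i\<in>I. c i * mon (fst i div snd i) \<omega> * mon (fst i) z)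
        = tpoly ?D (\<lambda>n. volterra_coeff S a' \<beta> n * of_real (folner N n)) (\<lambda>j. z j * \<omega> j)" for z
      unfolding tpoly_I
    proof (intro sum.cong refl)
      fix i assume "i \<in> I"
      then obtain n d where i: "i = (n, d)" "n dvd N" "d \<in> S" "d dvd n" by (auto simp: I_def)
      then have "n > 0" using N by (auto intro: gr0I)
      then have pos: "d > 0" "n div d > 0" using i S(2) by (auto intro: gr0I simp: dvd_div_eq_0_iff)
      have "mon n \<omega> = mon (d * (n div d)) \<omega>" using i(4) by simp
      also have "\<dots> = mon d \<omega> * mon (n div d) \<omega>" by (rule mon_mult[OF pos])
      finally have "mon d (\<lambda>j. cnj (\<omega> j)) * mon n \<omega> = (mon d (\<lambda>j. cnj (\<omega> j)) * mon d \<omega>) * mon (n div d) \<omega>"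
        by simp
      also have "mon d (\<lambda>j. cnj (\<omega> j)) * mon d \<omega> = 1"
        using norm_mon[of \<omega> d] \<omega> by (simp add: mon_cnj mult.commute[of "cnj _"] complex_norm_square[symmetric])
      finally have "mon (n div d) \<omega> = mon d (\<lambda>j. cnj (\<omega> j)) * mon n \<omega>" by simp
      then show "c i * mon (fst i div snd i) \<omega> * mon (fst i) z
          = a' (snd i) * \<beta> (fst i div snd i) * of_real (ln (real (fst i div snd i)) / ln (real (fst i)))
            * of_real (folner N (fst i)) * mon (fst i) (\<lambda>j. z j * \<omega> j)"
        by (simp add: i(1) c_def a'_def mon_times)
    qed
    then have "l1 (\<lambda>z. \<Sum>i\<in>I. c i * mon (fst i div snd i) \<omega> * mon (fst i) z)
        = l1 (tpoly ?D (\<lambda>n. volterra_coeff S a' \<beta> n * of_real (folner N n)))"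
      using l1_rotate[OF \<omega> measurable_tpoly] by simp
    also have "\<dots> \<le> C * l1 (tpoly S a')" by (rule bound)
    also have "l1 (tpoly S a') = l1 (tpoly S a)"
      unfolding a'_def by (rule l1_twist) (simp add: \<omega>)
    finally show "l1 (\<lambda>z. \<Sum>i\<in>I. c i * mon (fst i div snd i) \<omega> * mon (fst i) z) \<le> C * l1 (tpoly S a)" .
  qed
  moreover have "(\<lambda>z. \<Sum>i\<in>I. c i * of_real (folner K (fst i div snd i)) * mon (fst i) z)
      = tpoly ?D (\<lambda>n. volterra_coeff S a (\<lambda>m. \<beta> m * of_real (folner K m)) n * of_real (folner N n))"
    unfolding fun_eq_iff tpoly_I by (auto simp: c_def case_prod_beta mult_ac intro!: sum.cong)
  ultimately show ?thesis by simp
qed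

text \<open>For a finitely supported symbol the image is again a polynomial, supported on products.
  The logarithm from differentiation cancels the denominator in \<open>volterra_coeff\<close>, which
  leaves a Dirichlet convolution.\<close>

lemma dpoly_volterra_coeff:
  assumes S: "finite S" "0 \<notin> S" and T: "finite T" "0 \<notin> T" and \<gamma>: "\<And>m. m \<notin> T \<Longrightarrow> \<gamma> m = 0"
  defines "P \<equiv> (\<lambda>(d, m). d * m) ` (S \<times> T)"
  shows "dpoly P (deriv_coeffs (volterra_coeff S a \<gamma>)) z s = dpoly S a z s * dpoly T (deriv_coeffs \<gamma>) z s"
    and "n > 0 \<Longrightarrow> n \<notin> P \<Longrightarrow> volterra_coeff S a \<gamma> n = 0"
proof -
  let ?L = "\<lambda>n. ln (real n)"
  let ?e = "\<lambda>n. mon n z * exp (- s * of_real (?L n))"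
  have finP: "finite P" using S T by (simp add: P_def)
  have e_mult: "?e (d * m) = ?e d * ?e m" if "d > 0" "m > 0" for d m
    using that by (simp add: mon_mult ln_mult ring_distribs flip: exp_add)
  have Ppos: "n > 0" if "n \<in> P" for n using that S(2) T(2) unfolding P_def by (auto intro!: gr0I)
  have "dpoly P (deriv_coeffs (volterra_coeff S a \<gamma>)) z s
      = (\<Sum>n\<in>P. \<Sum>d\<in>S. if d dvd n then - (a d * \<gamma> (n div d) * of_real (?L (n div d)) * ?e n) else 0)"
    unfolding dpoly_def
  proof (intro sum.cong refl)
    fix n assume "n \<in> P"
    then have n: "n > 0" by (rule Ppos)
    \<comment> \<open>Division by zero at \<open>n = 1\<close> is harmless: then
      \<open>d = 1\<close> and both sides are 0.\<close>
    have *: "?L n * (?L (n div d) / ?L n) = ?L (n div d)" if "d dvd n" for d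
    proof (cases "n = 1")
      case True then show ?thesis using that by simp
    next
      case False then have "?L n \<noteq> 0" using n by simp
      then show ?thesis by simp
    qed
    have "deriv_coeffs (volterra_coeff S a \<gamma>) n = (\<Sum>d\<in>S. if d dvd n then - (a d * \<gamma> (n div d) * of_real (?L (n div d))) else 0)"
      unfolding deriv_coeffs_def volterra_coeff_def sum_distrib_left
    proof (intro sum.cong refl)
      fix d
      show "- of_real (?L n) * (if d dvd n then a d * \<gamma> (n div d) * of_real (?L (n div d) / ?L n) else 0)
          = (if d dvd n then - (a d * \<gamma> (n div d) * of_real (?L (n div d))) else 0)"
      proof (cases "d dvd n")
        case True
        then have "of_real (?L n) * of_real (?L (n div d) / ?L n) = complex_of_real (?L (n div d))"
          unfolding of_real_mult[symmetric] by (simp only: *)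
        then have "- (of_real (?L n) * of_real (?L (n div d) / ?L n)) * (a d * \<gamma> (n div d))
            = - complex_of_real (?L (n div d)) * (a d * \<gamma> (n div d))" by (simp only:)
        then show ?thesis using True by (simp only: if_True mult_ac mult_minus_left mult_minus_right)
      qed simp
    qed
    then show "deriv_coeffs (volterra_coeff S a \<gamma>) n * mon n z * exp (- s * of_real (?L n))
        = (\<Sum>d\<in>S. if d dvd n then - (a d * \<gamma> (n div d) * of_real (?L (n div d)) * ?e n) else 0)"
      by (simp only: sum_distrib_right) (intro sum.cong refl, simp)
  qed
  also have "\<dots> = (\<Sum>d\<in>S. \<Sum>n\<in>P. if d dvd n then - (a d * \<gamma> (n div d) * of_real (?L (n div d)) * ?e n) else 0)"
    by (rule sum.swap)
  also have "\<dots> = (\<Sum>d\<in>S. \<Sum>m\<in>T. - (a d * \<gamma> m * of_real (?L m) * (?e d * ?e m)))"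
  proof (rule sum.cong[OF refl])
    fix d assume d: "d \<in> S"
    then have d0: "d > 0" using S(2) by (auto intro: gr0I)
    have inj: "inj_on (\<lambda>m. d * m) T" using d0 by (auto intro: inj_onI)
    have "(\<Sum>m\<in>T. - (a d * \<gamma> m * of_real (?L m) * (?e d * ?e m)))
        = (\<Sum>n\<in>(\<lambda>m. d * m) ` T. if d dvd n then - (a d * \<gamma> (n div d) * of_real (?L (n div d)) * ?e n) else 0)"
      unfolding sum.reindex[OF inj] o_def
    proof (rule sum.cong[OF refl])
      fix m assume "m \<in> T"
      then have "m > 0" using T(2) by (auto intro: gr0I)
      then show "- (a d * \<gamma> m * of_real (?L m) * (?e d * ?e m))
          = (if d dvd d * m then - (a d * \<gamma> (d * m div d) * of_real (?L (d * m div d)) * ?e (d * m)) else 0)"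
        unfolding e_mult[OF d0 \<open>m > 0\<close>] using d0 by simp
    qed
    also have "\<dots> = (\<Sum>n\<in>P. if d dvd n then - (a d * \<gamma> (n div d) * of_real (?L (n div d)) * ?e n) else 0)"
    proof (rule sum.mono_neutral_left[OF finP])
      show "(\<lambda>m. d * m) ` T \<subseteq> P" using d by (auto simp: P_def)
      show "\<forall>n\<in>P - (\<lambda>m. d * m) ` T. (if d dvd n then - (a d * \<gamma> (n div d) * of_real (?L (n div d)) * ?e n) else 0) = 0"
      proof
        fix n assume n: "n \<in> P - (\<lambda>m. d * m) ` T"
        show "(if d dvd n then - (a d * \<gamma> (n div d) * of_real (?L (n div d)) * ?e n) else 0) = 0"
        proof (cases "d dvd n")
          case True
          then have "n div d \<notin> T" using n by (auto simp: image_iff)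
          then show ?thesis by (simp add: \<gamma>)
        qed simp
      qed
    qed
    finally show "(\<Sum>n\<in>P. if d dvd n then - (a d * \<gamma> (n div d) * of_real (?L (n div d)) * ?e n) else 0)
        = (\<Sum>m\<in>T. - (a d * \<gamma> m * of_real (?L m) * (?e d * ?e m)))" by simp
  qed
  also have "\<dots> = dpoly S a z s * dpoly T (deriv_coeffs \<gamma>) z s"
    unfolding dpoly_def sum_product by (intro sum.cong refl) (simp add: deriv_coeffs_def mult_ac)
  finally show "dpoly P (deriv_coeffs (volterra_coeff S a \<gamma>)) z s = dpoly S a z s * dpoly T (deriv_coeffs \<gamma>) z s" .
  show "volterra_coeff S a \<gamma> n = 0" if "n > 0" "n \<notin> P"
    unfolding volterra_coeff_def
  proof (intro sum.neutral ballI)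
    fix d assume d: "d \<in> S"
    show "(if d dvd n then a d * \<gamma> (n div d) * of_real (?L (n div d) / ?L n) else 0) = 0"
    proof (cases "d dvd n")
      case True
      then have "n div d \<notin> T" using that(2) d unfolding P_def by (force simp: image_iff)
      then show ?thesis by (simp add: \<gamma>)
    qed simp
  qed
qed

text \<open>For fixed \<open>K\<close> the image is a polynomial, so the outer damping is removed by
  letting \<open>N\<close> run through \<open>folner_seq\<close>.\<close>

lemma volterra_bounded_folner_symbol:
  assumes g: "has_dirichlet_series g \<beta>"
    and T: "\<And>f. f \<in> H1 \<Longrightarrow> volterra g f \<in> H1" "\<And>f. f \<in> H1 \<Longrightarrow> H1_norm (volterra g f) \<le> C * H1_norm f"
    and K: "K > 0"
  shows "volterra_bounded {m. m dvd K} (\<lambda>m. \<beta> m * of_real (folner K m)) C"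
  unfolding volterra_bounded_def
proof (intro allI impI)
  fix S :: "nat set" and a :: "nat \<Rightarrow> complex"
  assume S: "finite S" "0 \<notin> S"
  let ?T = "{m. m dvd K}" and ?\<gamma> = "\<lambda>m. \<beta> m * of_real (folner K m)"
  have finT: "finite ?T" and T0: "0 \<notin> ?T" using finite_divisors_nat K by auto
  define P where "P = (\<lambda>(d, m). d * m) ` (S \<times> ?T)"
  define c where "c = volterra_coeff S a ?\<gamma>"
  have \<gamma>0: "?\<gamma> m = 0" if "m \<notin> ?T" for m using that by (simp add: folner_eq_0)
  have dv: "dpoly P (deriv_coeffs (volterra_coeff S a ?\<gamma>)) z s = dpoly S a z s * dpoly ?T (deriv_coeffs ?\<gamma>) z s"
    "n > 0 \<Longrightarrow> n \<notin> P \<Longrightarrow> volterra_coeff S a ?\<gamma> n = 0" for z s n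
    unfolding P_def by (rule dpoly_volterra_coeff[OF S finT T0 \<gamma>0]; assumption)+
  have P: "finite P" "0 \<notin> P" using S finT T0 unfolding P_def by auto
  have mean: "folner_mean N (tpoly P c) = tpoly {n. n dvd N} (\<lambda>n. c n * of_real (folner N n))" if "N > 0" for N
    unfolding folner_mean_def tpoly_def fun_eq_iff
  proof (intro allI sum.cong refl)
    fix z n assume "n \<in> {d. d dvd N}"
    then have n: "n > 0" using that by (auto intro: gr0I)
    have "fourier_coeff (tpoly P c) (kappa n) = c n"
      using fourier_coeff_tpoly[OF P n, of c] dv(2)[OF n] by (simp add: c_def)
    then show "fourier_coeff (\<lambda>z. \<Sum>n\<in>P. c n * mon n z) (kappa n) * of_real (folner N n) * mon n z
        = c n * of_real (folner N n) * mon n z"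
      by (simp add: tpoly_def[abs_def])
  qed
  have le: "l1 (folner_mean N (tpoly P c)) \<le> C * l1 (tpoly S a)" if N: "N > 0" for N
    unfolding mean[OF N] unfolding c_def
    by (rule l1_folner_symbol_le[OF _ S N K]) (rule l1_folner_volterra_le[OF g T S N])
  have "l1 (tpoly P c) \<le> C * l1 (tpoly S a) + l1 (\<lambda>z. tpoly P c z - folner_mean (folner_seq k) (tpoly P c) z)" for k
    using l1_le_add_diff[OF integrable_tpoly[of P c] integrable_folner_mean[of "folner_seq k" "tpoly P c"]]
      le[OF folner_seq_pos[of k]] by linarith
  moreover have "(\<lambda>k. C * l1 (tpoly S a) + l1 (\<lambda>z. tpoly P c z - folner_mean (folner_seq k) (tpoly P c) z))
      \<longlonglongrightarrow> C * l1 (tpoly S a) + 0"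
    by (intro tendsto_intros folner_mean_tpoly_tendsto P)
  ultimately have "l1 (tpoly P c) \<le> C * l1 (tpoly S a) + 0"
    by (intro LIMSEQ_le_const) blast+
  then show "\<exists>P c. finite P \<and> 0 \<notin> P \<and> (\<forall>z s. dpoly P (deriv_coeffs c) z s = dpoly S a z s * dpoly ?T (deriv_coeffs ?\<gamma>) z s)
      \<and> l1 (tpoly P c) \<le> C * l1 (tpoly S a)"
    using P dv(1) unfolding c_def by (intro exI[of _ P] exI[of _ "volterra_coeff S a ?\<gamma>"]) simp
qed

text \<open>The constant is uniform in the damping, since \<open>folner\<close> is 1 at index 1 and
  leaves the constant term of the symbol unchanged. In the finite sum over \<open>S\<close> the
  damping can therefore be removed.\<close>

lemma polynomial_pairing_le:
  assumes g: "has_dirichlet_series g \<beta>"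
    and T: "\<And>f. f \<in> H1 \<Longrightarrow> volterra g f \<in> H1" "\<And>f. f \<in> H1 \<Longrightarrow> H1_norm (volterra g f) \<le> C * H1_norm f"
    and C: "C > 0" and S: "finite S" "0 \<notin> S"
  shows "norm (\<Sum>n\<in>S. a n * cnj (\<beta> n)) \<le> (norm (\<beta> 1) + 4 * C) * l1 (tpoly S a)"
proof -
  let ?w = "\<lambda>k n. folner (folner_seq k) n"
  have "norm (\<Sum>n\<in>S. a n * cnj (\<beta> n * of_real (?w k n))) \<le> (norm (\<beta> 1) + 4 * C) * l1 (tpoly S a)" for k
  proof -
    let ?K = "folner_seq k"
    have K: "?K > 0" by (rule folner_seq_pos)
    have "norm (\<Sum>n\<in>S \<inter> {m. m dvd ?K}. a n * cnj (\<beta> n * of_real (?w k n)))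
        \<le> (norm (\<beta> 1 * of_real (?w k 1)) + 4 * C) * l1 (tpoly S a)"
      using finite_divisors_nat[OF K] K
      by (intro pairing_le volterra_bounded_folner_symbol[OF g T] S C) auto
    moreover have "(\<Sum>n\<in>S \<inter> {m. m dvd ?K}. a n * cnj (\<beta> n * of_real (?w k n)))
        = (\<Sum>n\<in>S. a n * cnj (\<beta> n * of_real (?w k n)))"
    proof (rule sum.mono_neutral_left)
      show "\<forall>n\<in>S - S \<inter> {m. m dvd ?K}. a n * cnj (\<beta> n * of_real (?w k n)) = 0"
        by (simp add: folner_eq_0)
    qed (use S(1) in auto)
    ultimately show ?thesis by (simp add: folner_1[OF K])
  qed
  moreover have "(\<lambda>k. \<Sum>n\<in>S. a n * cnj (\<beta> n * of_real (?w k n))) \<longlonglongrightarrow> (\<Sum>n\<in>S. a n * cnj (\<beta> n * of_real 1))"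
  proof (intro tendsto_intros folner_tendsto_1)
    fix n assume "n \<in> S" then show "n > 0" using S(2) by (auto intro: gr0I)
  qed
  ultimately have "norm (\<Sum>n\<in>S. a n * cnj (\<beta> n * of_real 1)) \<le> (norm (\<beta> 1) + 4 * C) * l1 (tpoly S a)"
    by (intro LIMSEQ_le_const2[OF tendsto_norm]) blast+
  then show ?thesis by simp
qed

section \<open>Extension of the functional\<close>

text \<open>The pairing of \<open>g\<close> with a Folner mean, for arbitrary coefficients. A
  functional defined as the limit of these inherits linearity, with no choice of approximating
  polynomials.\<close>

definition folner_pairing :: "(nat \<Rightarrow> complex) \<Rightarrow> nat \<Rightarrow> (nat \<Rightarrow> complex) \<Rightarrow> complex" where
  "folner_pairing \<beta> k a = (\<Sum>n | n dvd folner_seq k. a n * of_real (folner (folner_seq k) n) * cnj (\<beta> n))"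

lemma folner_pairing_cong:
  assumes "\<And>n. n > 0 \<Longrightarrow> a n = b n"
  shows "folner_pairing \<beta> k a = folner_pairing \<beta> k b"
  unfolding folner_pairing_def using assms folner_seq_pos[of k] by (auto intro!: sum.cong intro: gr0I)

lemma folner_pairing_add: "folner_pairing \<beta> k (\<lambda>n. a n + b n) = folner_pairing \<beta> k a + folner_pairing \<beta> k b"
  by (simp add: folner_pairing_def distrib_right sum.distrib)

lemma folner_pairing_scale: "folner_pairing \<beta> k (\<lambda>n. c * a n) = c * folner_pairing \<beta> k a"
  by (simp add: folner_pairing_def sum_distrib_left mult.assoc)

lemma folner_pairing_finite_tendsto:
  assumes "finite S" "0 \<notin> S" "\<And>n. n > 0 \<Longrightarrow> n \<notin> S \<Longrightarrow> a n = 0"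
  shows "(\<lambda>k. folner_pairing \<beta> k a) \<longlonglongrightarrow> (\<Sum>n\<in>S. a n * cnj (\<beta> n))"
proof -
  have "folner_pairing \<beta> k a = (\<Sum>n\<in>S. a n * of_real (folner (folner_seq k) n) * cnj (\<beta> n))" for k
  proof -
    let ?D = "{n. n dvd folner_seq k}" and ?h = "\<lambda>n. a n * of_real (folner (folner_seq k) n) * cnj (\<beta> n)"
    have D: "finite ?D" using finite_divisors_nat folner_seq_pos by blast
    have "n > 0" if "n \<in> ?D" for n using that folner_seq_pos[of k] by (auto intro: gr0I)
    then have "sum ?h ?D = sum ?h (?D \<inter> S)"
      using D assms(3) by (intro sum.mono_neutral_right) auto
    also have "\<dots> = sum ?h S"
      using assms(1) folner_eq_0[of _ "folner_seq k"] by (intro sum.mono_neutral_left) auto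
    finally show ?thesis by (simp add: folner_pairing_def)
  qed
  moreover have "(\<lambda>k. \<Sum>n\<in>S. a n * of_real (folner (folner_seq k) n) * cnj (\<beta> n)) \<longlonglongrightarrow> (\<Sum>n\<in>S. a n * of_real 1 * cnj (\<beta> n))"
  proof (intro tendsto_intros folner_tendsto_1)
    fix n assume "n \<in> S" then show "n > 0" using assms(2) by (auto intro: gr0I)
  qed
  ultimately show ?thesis by simp
qed

context
  fixes \<beta> :: "nat \<Rightarrow> complex" and A :: real
  assumes A: "A \<ge> 0"
    and pairing: "\<And>S a. finite S \<Longrightarrow> 0 \<notin> S \<Longrightarrow> norm (\<Sum>n\<in>S. a n * cnj (\<beta> n)) \<le> A * l1 (tpoly S a)"
begin

lemma norm_folner_pairing_le:
  assumes F: "F \<in> H1_torus"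
  shows "norm (folner_pairing \<beta> k (\<lambda>n. fourier_coeff F (kappa n))) \<le> A * l1 F"
proof -
  let ?K = "folner_seq k"
  have "norm (folner_pairing \<beta> k (\<lambda>n. fourier_coeff F (kappa n))) \<le> A * l1 (folner_mean ?K F)"
    unfolding folner_pairing_def folner_mean_def
    using finite_divisors_nat[OF folner_seq_pos] folner_seq_pos[of k] by (intro pairing) auto
  also have "\<dots> \<le> A * l1 F"
    by (intro mult_left_mono l1_folner_mean_le folner_seq_pos F A)
  finally show ?thesis .
qed

text \<open>The pairings are bounded uniformly in \<open>k\<close> and converge on polynomials, so
  convergence passes to the closure.\<close>

lemma convergent_folner_pairing:
  assumes F: "F \<in> H1_torus"
  shows "convergent (\<lambda>k. folner_pairing \<beta> k (\<lambda>n. fourier_coeff F (kappa n)))"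
  unfolding Cauchy_convergent_iff[symmetric]
proof (rule CauchyI)
  fix e :: real assume e: "e > 0"
  let ?p = "\<lambda>F k. folner_pairing \<beta> k (\<lambda>n. fourier_coeff F (kappa n))"
  have A1: "A + 1 > 0" using A by simp
  have "e / (3 * (A + 1)) > 0" using e A1 by simp
  then obtain S a where S: "finite S" "0 \<notin> S" "l1 (\<lambda>z. F z - tpoly S a z) < e / (3 * (A + 1))"
    using H1_torus_approx[OF F] by metis
  let ?P = "tpoly S a"
  have FP: "(\<lambda>z. F z - ?P z) \<in> H1_torus"
    by (rule H1_torus_diff[OF F tpoly_in_H1_torus[OF S(1,2)]])
  have close: "norm (?p F k - ?p ?P k) < e / 3" for k
  proof -
    have "?p F k - ?p ?P k = ?p (\<lambda>z. F z - ?P z) k"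
      using fourier_coeff_diff[OF H1_torus_integrable[OF F] integrable_tpoly]
      by (simp add: folner_pairing_def left_diff_distrib sum_subtractf)
    then have "norm (?p F k - ?p ?P k) \<le> A * l1 (\<lambda>z. F z - ?P z)"
      using norm_folner_pairing_le[OF FP] by simp
    also have "\<dots> \<le> (A + 1) * l1 (\<lambda>z. F z - ?P z)"
      by (intro mult_right_mono l1_nonneg) simp
    also have "\<dots> < (A + 1) * (e / (3 * (A + 1)))"
      using S(3) A1 by (intro mult_strict_left_mono)
    also have "\<dots> = e / 3" using A1 by (simp add: field_simps)
    finally show ?thesis .
  qed
  have "(\<lambda>k. ?p ?P k) \<longlonglongrightarrow> (\<Sum>n\<in>S. fourier_coeff ?P (kappa n) * cnj (\<beta> n))"
    using S by (intro folner_pairing_finite_tendsto) (auto simp: fourier_coeff_tpoly)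
  then have "Cauchy (?p ?P)" by (rule LIMSEQ_imp_Cauchy)
  then obtain M where M: "\<And>m n. m \<ge> M \<Longrightarrow> n \<ge> M \<Longrightarrow> norm (?p ?P m - ?p ?P n) < e / 3"
    using e unfolding Cauchy_iff by (metis divide_pos_pos zero_less_numeral)
  have tri: "norm (u - v) \<le> norm (u - u') + norm (u' - v') + norm (v - v')" for u v u' v' :: complex
    using norm_triangle_ineq[of "u - u'" "u' - v"] norm_triangle_ineq[of "u' - v'" "v' - v"]
      norm_minus_commute[of v v'] by simp
  have "norm (?p F m - ?p F n) < e" if "m \<ge> M" "n \<ge> M" for m n
    using tri[of "?p F m" "?p F n" "?p ?P m" "?p ?P n"] close[of m] close[of n] M[OF that] by linarith
  then show "\<exists>M. \<forall>m\<ge>M. \<forall>n\<ge>M. norm (?p F m - ?p F n) < e" by blast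
qed

text \<open>For a Dirichlet series the choice of coefficients is free only at index 0, and 0 does
  not divide the positive number \<open>folner_seq k\<close>.\<close>

definition extension :: "(complex \<Rightarrow> complex) \<Rightarrow> complex" where
  "extension f = lim (\<lambda>k. folner_pairing \<beta> k (SOME a. has_dirichlet_series f a))"

lemma extension_eqI:
  assumes a: "has_dirichlet_series f a" and lim: "(\<lambda>k. folner_pairing \<beta> k a) \<longlonglongrightarrow> x"
  shows "extension f = x"
proof -
  have "has_dirichlet_series f (SOME a. has_dirichlet_series f a)" using a by (rule someI[where P = "has_dirichlet_series f"])
  then have "folner_pairing \<beta> k (SOME a. has_dirichlet_series f a) = folner_pairing \<beta> k a" for k
    by (intro folner_pairing_cong dirichlet_coeffs_unique[OF _ a])
  then show ?thesis unfolding extension_def using lim by (simp add: limI)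
qed

lemma extension_tendsto:
  assumes F: "is_bohr_lift f F" and a: "has_dirichlet_series f a"
  shows "(\<lambda>k. folner_pairing \<beta> k a) \<longlonglongrightarrow> extension f" "norm (extension f) \<le> A * l1 F"
proof -
  have FH: "F \<in> H1_torus" using F by (simp add: is_bohr_lift_def)
  have eq: "folner_pairing \<beta> k (\<lambda>n. fourier_coeff F (kappa n)) = folner_pairing \<beta> k a" for k
    by (intro folner_pairing_cong bohr_lift_coeff[OF F a])
  obtain x where x: "(\<lambda>k. folner_pairing \<beta> k a) \<longlonglongrightarrow> x"
    using convergent_folner_pairing[OF FH] unfolding eq convergent_def by blast
  then have "extension f = x" by (rule extension_eqI[OF a])
  with x show "(\<lambda>k. folner_pairing \<beta> k a) \<longlonglongrightarrow> extension f" by simp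
  then show "norm (extension f) \<le> A * l1 F"
    using norm_folner_pairing_le[OF FH] unfolding eq by (intro LIMSEQ_le_const2[OF tendsto_norm]) blast+
qed

lemma bounded_functional_extension: "bounded_functional_on_H1 extension"
  unfolding bounded_functional_on_H1_def
proof (intro conjI ballI allI)
  fix f h assume "f \<in> H1" "h \<in> H1"
  then obtain F G where F: "is_bohr_lift f F" and G: "is_bohr_lift h G" unfolding H1_def by blast
  then obtain a b where a: "has_dirichlet_series f a" and b: "has_dirichlet_series h b"
    unfolding is_bohr_lift_def by blast
  show "extension (\<lambda>s. f s + h s) = extension f + extension h"
    by (rule extension_eqI[OF has_dirichlet_series_add[OF a b]])
      (simp only: folner_pairing_add, rule tendsto_add[OF extension_tendsto(1)[OF F a] extension_tendsto(1)[OF G b]])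
next
  fix c f assume "f \<in> H1"
  then obtain F where F: "is_bohr_lift f F" unfolding H1_def by blast
  then obtain a where a: "has_dirichlet_series f a" unfolding is_bohr_lift_def by blast
  show "extension (\<lambda>s. c * f s) = c * extension f"
    by (rule extension_eqI[OF has_dirichlet_series_scale[OF a]])
      (simp only: folner_pairing_scale, rule tendsto_mult_left[OF extension_tendsto(1)[OF F a]])
next
  have "norm (extension f) \<le> A * H1_norm f" if f: "f \<in> H1" for f
  proof -
    obtain F where F: "is_bohr_lift f F" using f unfolding H1_def by blast
    then obtain a where a: "has_dirichlet_series f a" unfolding is_bohr_lift_def by blast
    show ?thesis using extension_tendsto(2)[OF F a] by (simp add: H1_norm_eq_l1[OF F])
  qed
  then show "\<exists>C. \<forall>f\<in>H1. norm (extension f) \<le> C * H1_norm f" by blast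
qed

lemma extension_polynomial:
  "extension (\<lambda>s. \<Sum>n=1..N. a n * of_nat n powr (- s)) = (\<Sum>n=1..N. a n * cnj (\<beta> n))"
proof (rule extension_eqI[OF has_dirichlet_series_polynomial])
  let ?a = "\<lambda>n. if n \<in> {1..N} then a n else 0"
  have "(\<lambda>k. folner_pairing \<beta> k ?a) \<longlonglongrightarrow> (\<Sum>n\<in>{1..N}. ?a n * cnj (\<beta> n))"
    by (rule folner_pairing_finite_tendsto) auto
  also have "(\<Sum>n\<in>{1..N}. ?a n * cnj (\<beta> n)) = (\<Sum>n=1..N. a n * cnj (\<beta> n))"
    by (rule sum.cong) auto
  finally show "(\<lambda>k. folner_pairing \<beta> k ?a) \<longlonglongrightarrow> (\<Sum>n=1..N. a n * cnj (\<beta> n))" .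
qed auto

end

theorem corollary6p4:
  fixes g :: "complex \<Rightarrow> complex"
  assumes "g \<in> class_D"
    and "acts_boundedly_on_H1 (volterra g)"
  shows "in_H1_dual g"
proof -
  obtain \<beta> where \<beta>: "has_dirichlet_series g \<beta>"
    using assms(1) unfolding class_D_def by blast
  obtain C where C: "\<And>f. f \<in> H1 \<Longrightarrow> volterra g f \<in> H1" "\<And>f. f \<in> H1 \<Longrightarrow> H1_norm (volterra g f) \<le> C * H1_norm f"
    using assms(2) unfolding acts_boundedly_on_H1_def by blast
  \<comment> \<open>Cauchy-Schwarz is applied with parameter \<open>M\<close>, by which it divides;
    \<open>C\<close> itself may fail to be positive.\<close>
  define M where "M = max C 1"
  have "H1_norm (volterra g f) \<le> M * H1_norm f" if "f \<in> H1" for f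
  proof -
    have "H1_norm f \<ge> 0" by (simp add: H1_norm_def)
    then have "C * H1_norm f \<le> M * H1_norm f" by (intro mult_right_mono) (simp_all add: M_def)
    then show ?thesis using C(2)[OF that] by linarith
  qed
  then have pairing: "norm (\<Sum>n\<in>S. a n * cnj (\<beta> n)) \<le> (norm (\<beta> 1) + 4 * M) * l1 (tpoly S a)"
    if "finite S" "0 \<notin> S" for S a
    by (intro polynomial_pairing_le[OF \<beta> C(1)] that) (auto simp: M_def)
  have nonneg: "norm (\<beta> 1) + 4 * M \<ge> 0" by (simp add: M_def)
  show ?thesis
    unfolding in_H1_dual_def
    by (intro exI[of _ \<beta>] exI[of _ "extension \<beta>"] conjI allI \<beta>
        bounded_functional_extension[OF nonneg pairing] extension_polynomial[OF nonneg pairing])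
qed

end
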